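(* For the speed-scaled Euclidean TSPD model with drone speed factor $\alpha\ge1$, and every $h>0$, let $Z_1,\ldots,Z_4$ be $\mathrm{Exponential}(1)$ and $U_0,\ldots,U_4$ be $\mathrm{Uniform}[0,1]$, all independent; put $W_0=0$, $W_i=\sum_{j=1}^iZ_j$, $L_{ij}=L_{ji}=\sqrt{(W_j-W_i)^2+h^4(U_i-U_j)^2}$, and $$\mathrm{Tri}(i,j;k)=\max\Big\{L_{ij},\tfrac1\alpha(L_{ik}+L_{kj})\Big\},\qquad \mathrm{Quin}(i,i_1,i_2,j;k)=\max\Big\{L_{ii_1}+L_{i_1i_2}+L_{i_2j},\tfrac1\alpha(L_{ik}+L_{kj})\Big\}.$$ Then $$\beta_{\mathsf{TSPD}}\le\frac1{4h}\,\mathbb{E}[M],$$ where $M$ is the minimum of the following twelve quantities: $\mathrm{Tri}(0,1;2)+\mathrm{Tri}(1,4;3)$, $\mathrm{Tri}(0,1;3)+\mathrm{Tri}(1,4;2)$, $\mathrm{Tri}(0,2;1)+\mathrm{Tri}(2,4;3)$, $\mathrm{Tri}(0,2;3)+\mathrm{Tri}(2,4;1)$, $\mathrm{Tri}(0,3;1)+\mathrm{Tri}(3,4;2)$, $\mathrm{Tri}(0,3;2)+\mathrm{Tri}(3,4;1)$, $\mathrm{Quin}(0,1,3,4;2)$, $\mathrm{Quin}(0,3,1,4;2)$, $\mathrm{Quin}(0,1,2,4;3)$, $\mathrm{Quin}(0,2,1,4;3)$, $\mathrm{Quin}(0,2,3,4;1)$, $\mathrm{Quin}(0,3,2,4;1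)$.
   Context: Traveling Salesman Problem with Drone (TSPD). Let $\|\cdot\|_T$ (truck metric) and $\|\cdot\|_D$ (drone metric) be norms on $\mathbb{R}^2$, and let $\mathcal X\subset\mathbb{R}^2$ be a finite set of customer points (nodes). In a solution each node is exactly one of: a truck node (visited only by the truck), a drone node (served only by the drone), or a combined node (visited by both vehicles; a synchronization point). A ring $r$ is given by two distinct combined nodes serving as start and end nodes, together with at most one drone node and any number (possibly zero) of truck nodes between them. In ring $r$ the truck follows a path $\mathcal T_r$ from the start node through all truck nodes of the ring (in some order) to the end node, and, if a drone node is present, the drone follows the path $\mathcal D_r$ from the start node to the drone node to the end node. With $t(\mathcal T_r)$ the sum of the $\|\cdot\|_T$-lengths of the edges of $\mathcal T_r$ and $d(\mathcal D_r)$ the sum of the $\|\cdot\|_D$-lengths of the edges of $\mathcal D_r$, the cost $c(r)$ of the ring is the minimum, over the choices of $\mathcal T_r,\mathcal D_r$, of $\max\{t(\mathcal T_r),d(\mathcal D_r)\}$ if the ring contains a drone node, and of $t(\mathcal T_r)$ otherwise. A feasible solution for $\mathcal X$ is a set $\mathcal R(\mathcal X)$ of rings that together cover all points of $\mathcal X$ and are concatenated through their combined nodes to form a single cyclic tour; each point of $\mathcal X$ is served exactly once: a combined node is shared by exactly two adjacent rings, and every other point belongs to exactly one ring. The optimal makespan is $\mathsf{TSPD}(\mathcal X)=\min_{\mathcal R(\mathcal X)}\sum_{r\in\mathcal R(\mathcal X)}c(r)$. Conventions: $\mathsf{TSPD}(\mathcal X)=0$ if $|\mathcal X|\le1$, and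 $\mathsf{TSPD}(\{x,y\})=2\|x-y\|_T$ for $x\ne y$. Speed-scaled Euclidean model: $\|p\|_T=\|p\|_2$ and $\|p\|_D=\frac1\alpha\|p\|_2$, where $\alpha\ge1$. Asymptotic constant: for $X_1,X_2,\ldots$ i.i.d. uniform on $[0,1]^2$, $\beta_{\mathsf{TSPD}}$ is the constant such that $\mathsf{TSPD}(\{X_1,\ldots,X_n\})/\sqrt n\to\beta_{\mathsf{TSPD}}$ almost surely and in expectation as $n\to\infty$ (this limit is known to exist). *)

theory Defs
  imports "HOL-Probability.Probability" "HOL-Combinatorics.Multiset_Permutations"
begin

section \<open>The Traveling Salesman Problem with Drone\<close>

text \<open>The product norm on \<^typ>\<open>real \<times> real\<close> is the Euclidean norm.\<close>

type_synonym point = "real \<times> real"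

datatype tspd_ring =
  Ring (ring_start: point) (ring_end: point) (truck_nodes: "point set") (drone_node: "point option")

definition inner_nodes :: "tspd_ring \<Rightarrow> point set" where
  "inner_nodes r = truck_nodes r \<union> set_option (drone_node r)"

definition ring_nodes :: "tspd_ring \<Rightarrow> point set" where
  "ring_nodes r = {ring_start r, ring_end r} \<union> inner_nodes r"

definition valid_ring :: "tspd_ring \<Rightarrow> bool" where
  "valid_ring r \<longleftrightarrow>
     ring_start r \<noteq> ring_end r \<and>
     finite (truck_nodes r) \<and>
     truck_nodes r \<inter> set_option (drone_node r) = {} \<and>
     {ring_start r, ring_end r} \<inter> inner_nodes r = {}"

text \<open>\<open>path_length N [x\<^sub>0, \<dots>, x\<^sub>m]\<close> is the length of the polygonal path in the norm \<open>N\<close>.\<close>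

fun path_length :: "(point \<Rightarrow> real) \<Rightarrow> point list \<Rightarrow> real" where
  "path_length N (x # y # xs) = N (y - x) + path_length N (y # xs)"
| "path_length N _ = 0"

text \<open>\<open>NT\<close> is the truck norm and \<open>ND\<close> the drone norm. The minimum is over the orders in which the
  truck visits its nodes; the path of the drone is determined by the ring.\<close>

definition ring_cost :: "(point \<Rightarrow> real) \<Rightarrow> (point \<Rightarrow> real) \<Rightarrow> tspd_ring \<Rightarrow> real" where
  "ring_cost NT ND r =
     (MIN ts \<in> permutations_of_set (truck_nodes r).
        case drone_node r of
          None \<Rightarrow> path_length NT (ring_start r # ts @ [ring_end r])
        | Some d \<Rightarrow> max (path_length NT (ring_start r # ts @ [ring_end r]))
                        (path_length ND [ring_start r, d, ring_end r]))"

text \<open>Each ring ends where its cyclic successor starts, and no combined node is passed twice.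
  For valid rings the list has at least two members.\<close>

definition cyclic_tour :: "tspd_ring list \<Rightarrow> bool" where
  "cyclic_tour rs \<longleftrightarrow>
     rs \<noteq> [] \<and> distinct (map ring_start rs) \<and> map ring_end rs = rotate1 (map ring_start rs)"

text \<open>In the last condition \<open>x\<close> is a truck or drone node, \<open>s\<close> any ring it occurs in, in whatever
  role.\<close>

definition feasible :: "point set \<Rightarrow> tspd_ring set \<Rightarrow> bool" where
  "feasible X R \<longleftrightarrow>
     (\<forall>r\<in>R. valid_ring r) \<and>
     (\<exists>rs. set rs = R \<and> cyclic_tour rs) \<and>
     (\<Union>r\<in>R. ring_nodes r) = X \<and>
     (\<forall>r\<in>R. \<forall>x\<in>inner_nodes r. \<forall>s\<in>R. x \<in> ring_nodes s \<longrightarrow> s = r)"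

definition TSPD :: "(point \<Rightarrow> real) \<Rightarrow> (point \<Rightarrow> real) \<Rightarrow> point set \<Rightarrow> real" where
  "TSPD NT ND X =
     (if card X \<le> 1 then 0 else MIN R \<in> {R. feasible X R}. \<Sum>r\<in>R. ring_cost NT ND r)"

text \<open>The minimum in \<^const>\<open>TSPD\<close> is over a finite nonempty set, and the convention for two points
  agrees with the general definition.\<close>

lemma finite_feasible:
  assumes "finite X"
  shows "finite {R. feasible X R}"
proof -
  let ?A = "(\<lambda>(a, b, T, d). Ring a b T d) ` (X \<times> X \<times> Pow X \<times> insert None (Some ` X))"
  have "R \<subseteq> ?A" if "feasible X R" for R
  proof
    fix r assume "r \<in> R"
    then have "ring_nodes r \<subseteq> X"
      using that by (auto simp: feasible_def)
    then show "r \<in> ?A"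
      by (cases r; cases "drone_node r")
         (simp_all add: ring_nodes_def inner_nodes_def image_iff)
  qed
  then have "{R. feasible X R} \<subseteq> Pow ?A"
    by blast
  moreover have "finite (Pow ?A)"
    using assms by simp
  ultimately show ?thesis
    by (rule finite_subset)
qed

lemma ex_feasible:
  assumes "finite X" "a \<in> X" "b \<in> X" "a \<noteq> b"
  shows "feasible X {Ring a b (X - {a, b}) None, Ring b a {} None}"
  unfolding feasible_def
proof (intro conjI)
  show "\<exists>rs. set rs = {Ring a b (X - {a, b}) None, Ring b a {} None} \<and> cyclic_tour rs"
    using assms by (intro exI[of _ "[Ring a b (X - {a, b}) None, Ring b a {} None]"])
      (auto simp: cyclic_tour_def)
qed (use assms in \<open>auto simp: valid_ring_def ring_nodes_def inner_nodes_def\<close>)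

lemma TSPD_pair:
  assumes "x \<noteq> y" and sym: "\<And>p. NT (- p) = NT p"
  shows "TSPD NT ND {x, y} = 2 * NT (x - y)"
proof -
  let ?r = "Ring x y {} None" and ?s = "Ring y x {} None"
  have "R = {?r, ?s}" if R: "feasible {x, y} R" for R
  proof -
    have ring: "r = ?r \<or> r = ?s" if "r \<in> R" for r
    proof -
      have "ring_nodes r \<subseteq> {x, y}" "valid_ring r"
        using R that by (auto simp: feasible_def)
      then show ?thesis
        by (cases r; cases "drone_node r")
           (auto simp: ring_nodes_def inner_nodes_def valid_ring_def)
    qed
    from R obtain rs where rs: "set rs = R" "cyclic_tour rs"
      by (auto simp: feasible_def)
    have ends: "ring_start ` R = ring_end ` R"
      using rs by (metis cyclic_tour_def set_map set_rotate1)
    have "R \<noteq> {}"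
      using rs by (auto simp: cyclic_tour_def)
    moreover have "R \<subseteq> {?r, ?s}"
      using ring by blast
    ultimately consider "R = {?r}" | "R = {?s}" | "R = {?r, ?s}"
      by blast
    then show ?thesis
      using ends \<open>x \<noteq> y\<close> by cases simp_all
  qed
  moreover have "feasible {x, y} {?r, ?s}"
    using ex_feasible[of "{x, y}" x y] \<open>x \<noteq> y\<close> by simp
  ultimately have "{R. feasible {x, y} R} = {{?r, ?s}}"
    by blast
  then show ?thesis
    using \<open>x \<noteq> y\<close> sym[of "x - y"] by (simp add: TSPD_def ring_cost_def)
qed

definition TSPD_speed :: "real \<Rightarrow> point set \<Rightarrow> real" where
  "TSPD_speed \<alpha> X = TSPD (\<lambda>p. norm p) (\<lambda>p. 1 / \<alpha> * norm p) X"


section \<open>The random block of five consecutive nodes\<close>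

text \<open>Throughout, \<open>z\<close> and \<open>u\<close> are realizations of the exponential gaps and the uniform heights.\<close>

definition W :: "(nat \<Rightarrow> real) \<Rightarrow> nat \<Rightarrow> real" where
  "W z i = (\<Sum>j = 1..i. z j)"

definition L :: "real \<Rightarrow> (nat \<Rightarrow> real) \<Rightarrow> (nat \<Rightarrow> real) \<Rightarrow> nat \<Rightarrow> nat \<Rightarrow> real" where
  "L h z u i j = sqrt ((W z j - W z i)\<^sup>2 + h ^ 4 * (u i - u j)\<^sup>2)"

definition Tri :: "real \<Rightarrow> (nat \<Rightarrow> nat \<Rightarrow> real) \<Rightarrow> nat \<Rightarrow> nat \<Rightarrow> nat \<Rightarrow> real" where
  "Tri \<alpha> l i j k = max (l i j) (1 / \<alpha> * (l i k + l k j))"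

definition Quin :: "real \<Rightarrow> (nat \<Rightarrow> nat \<Rightarrow> real) \<Rightarrow> nat \<Rightarrow> nat \<Rightarrow> nat \<Rightarrow> nat \<Rightarrow> nat \<Rightarrow> real" where
  "Quin \<alpha> l i i1 i2 j k = max (l i i1 + l i1 i2 + l i2 j) (1 / \<alpha> * (l i k + l k j))"

definition block_min :: "real \<Rightarrow> (nat \<Rightarrow> nat \<Rightarrow> real) \<Rightarrow> real" where
  "block_min \<alpha> l = Min {
     Tri \<alpha> l 0 1 2 + Tri \<alpha> l 1 4 3,
     Tri \<alpha> l 0 1 3 + Tri \<alpha> l 1 4 2,
     Tri \<alpha> l 0 2 1 + Tri \<alpha> l 2 4 3,
     Tri \<alpha> l 0 2 3 + Tri \<alpha> l 2 4 1,
     Tri \<alpha> l 0 3 1 + Tri \<alpha> l 3 4 2,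
     Tri \<alpha> l 0 3 2 + Tri \<alpha> l 3 4 1,
     Quin \<alpha> l 0 1 3 4 2,
     Quin \<alpha> l 0 3 1 4 2,
     Quin \<alpha> l 0 1 2 4 3,
     Quin \<alpha> l 0 2 1 4 3,
     Quin \<alpha> l 0 2 3 4 1,
     Quin \<alpha> l 0 3 2 4 1}"

end

theory Submission
  imports Defs "HOL-Real_Asymp.Real_Asymp"
begin

text \<open>Cut the square into \<open>m\<close> horizontal strips and visit \<open>n = 4 K \<approx> h\<^sup>2 m\<^sup>2\<close> random points in
  boustrophedon order. For each offset \<open>0, \<dots>, 3\<close>, the cyclic order splits into blocks of five
  consecutive points sharing their end points; routing each block by the cheapest of the twelve
  patterns is feasible, so averaging over the offsets bounds \<open>4 TSPD\<close> by the sum of the block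
  minima over all windows of five consecutive points. Windows straddling two strips are short
  unless some strip misses a margin of width \<open>\<epsilon>\<close> at a wall, which is exponentially unlikely. For
  the windows inside a strip no Poisson limit is needed: five given points are consecutive in a
  strip, with horizontal extent \<open>d\<close>, with conditional probability
  \<open>(1 - d / m) ^ (n - 5) \<le> exp (- \<lambda> d)\<close> where \<open>\<lambda> = (n - 5) / m\<close>, and substituting
  \<open>z = \<lambda> \<Delta>x\<close> for the successive gaps bounds the expectation by the one over exponential gaps, at the
  cost of the factor \<open>n ^ 5 m / (n - 5) ^ 5\<close> only.\<close>

text \<open>Up to 4 m windows straddle two strips, and m is of order sqrt n, so bounding each of
  them by a constant would spoil the result. Forcing them to the walls leaves a total of 16 m
  \<epsilon>, which becomes 4 \<epsilon> / h after division by 4 sqrt n; \<epsilon> goes to 0 only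
  after n has gone to infinity. Samples with an empty margin are charged the trivial bound 32 K,
  against which a probability with exponent of order -m wins. The factor n ^ 5 m / (n - 5) ^ 5
  compares at most n ^ 5 ordered tuples in m strips with five factors 1 / (n - 5) = 1 / (\<lambda>
  m). Each of the four gaps yields one of them; the fifth is 1 / m from the first point, whose
  abscissa is just uniform, times 1 / \<lambda> from rescaling the cost. Scaling by \<lambda> turns
  a strip into one of height \<lambda> / m, and the comparison with \<open>L\<close> requires this
  to be at most \<open>h\<^sup>2\<close>. Hence n is rounded down to a multiple of 4 below
  \<open>h\<^sup>2 * m\<^sup>2\<close>, and the limit is read off along this subsequence. The tour
  is found by sorting and its makespan is not known to be measurable; it is therefore dominated by
  explicit measurable sums before any integral is evaluated.\<close>

section \<open>Tours built from legs\<close>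

text \<open>A leg \<open>(a, ts, d)\<close> is a ring without its end node: start node, truck nodes in visiting order,
  drone node. The end node is the start node of the next leg.\<close>

type_synonym leg = "point \<times> point list \<times> point"

definition leg_nodes :: "leg \<Rightarrow> point list" where
  "leg_nodes l = fst l # fst (snd l) @ [snd (snd l)]"

definition leg_ring :: "leg \<Rightarrow> point \<Rightarrow> tspd_ring" where
  "leg_ring l e = Ring (fst l) e (set (fst (snd l))) (Some (snd (snd l)))"

fun tour_rings :: "leg list \<Rightarrow> point \<Rightarrow> tspd_ring list" where
  "tour_rings [] e = []"
| "tour_rings (l # ls) e = leg_ring l (if ls = [] then e else fst (hd ls)) # tour_rings ls e"

lemma tour_rings_append:
  "tour_rings (xs @ ys) e = tour_rings xs (if ys = [] then e else fst (hd ys)) @ tour_rings ys e"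
  by (induction xs) auto

lemma map_ring_start_tour_rings: "map ring_start (tour_rings ls e) = map fst ls"
  by (induction ls) (auto simp: leg_ring_def)

lemma map_ring_end_tour_rings:
  "ls \<noteq> [] \<Longrightarrow> map ring_end (tour_rings ls e) = tl (map fst ls) @ [e]"
proof (induction ls)
  case (Cons l ls)
  then show ?case by (cases ls) (auto simp: leg_ring_def)
qed simp

lemma in_tour_ringsD:
  "r \<in> set (tour_rings ls e) \<Longrightarrow> \<exists>l\<in>set ls. \<exists>e'. r = leg_ring l e'"
  by (induction ls) (auto simp del: split_paired_Ex)

text \<open>Inside a tour a ring is determined by its start node, so one leg cannot occur with two
  end nodes. This turns equality of legs into equality of rings in the uniqueness condition of
  \<open>feasible\<close>.\<close>

lemma tour_rings_same_leg:
  assumes "distinct (map fst ls)" "leg_ring l e1 \<in> set (tour_rings ls e)"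
    "leg_ring l e2 \<in> set (tour_rings ls e)"
  shows "e1 = e2"
proof -
  have "inj_on ring_start (set (tour_rings ls e))"
    using assms(1) by (metis distinct_map map_ring_start_tour_rings)
  then show ?thesis
    using assms(2,3) by (force simp: inj_on_def leg_ring_def)
qed

lemma leg_ring_in_tour_rings:
  "l \<in> set ls \<Longrightarrow> \<exists>e'. leg_ring l e' \<in> set (tour_rings ls e)"
  by (induction ls) (auto simp del: split_paired_Ex)

lemma inj_concat_nodes:
  assumes "distinct (concat (map leg_nodes ls))" "l \<in> set ls" "l' \<in> set ls"
    "x \<in> set (leg_nodes l)" "x \<in> set (leg_nodes l')"
  shows "fst l = fst l' \<and> leg_nodes l = leg_nodes l'"
proof -
  have "leg_nodes l = leg_nodes l'"
    using assms by (auto simp: distinct_concat_iff)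
  then show ?thesis by (simp add: leg_nodes_def)
qed

lemma distinct_leg_starts:
  assumes "distinct (concat (map leg_nodes ls))"
  shows "distinct (map fst ls)"
  using assms by (induction ls) (fastforce simp: leg_nodes_def)+

text \<open>The node lists of the legs partition the points. So a truck or drone node meets only its
  own ring, while a combined node starts one leg and ends the ring of the preceding one.\<close>

lemma feasible_tour_rings:
  assumes d: "distinct (concat (map leg_nodes ls))" and len: "length ls \<ge> 2"
  shows "feasible (set (concat (map leg_nodes ls))) (set (tour_rings ls (fst (hd ls))))"
proof -
  define e where "e = fst (hd ls)"
  define rs where "rs = tour_rings ls e"
  have ne: "ls \<noteq> []" using len by auto
  have ds: "distinct (map fst ls)" using distinct_leg_starts[OF d] .
  have ends: "map ring_end rs = rotate1 (map ring_start rs)"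
    unfolding rs_def map_ring_start_tour_rings map_ring_end_tour_rings[OF ne]
    using ne by (cases ls) (auto simp: e_def)
  have cyc: "cyclic_tour rs"
    using ne ends ds unfolding cyclic_tour_def
    by (metis Nil_is_map_conv map_ring_start_tour_rings rs_def)
  have inner: "inner_nodes (leg_ring l e') = set (tl (leg_nodes l))" for l e'
    by (auto simp: inner_nodes_def leg_ring_def leg_nodes_def)
  have same: "l = l'" if "l \<in> set ls" "l' \<in> set ls"
    "x \<in> set (leg_nodes l)" "x \<in> set (leg_nodes l')" for l l' x
    using inj_concat_nodes[OF d that] ds that by (auto simp: distinct_map inj_on_def)
  have dl: "distinct (leg_nodes l)" if "l \<in> set ls" for l
    using d that by (auto simp: distinct_concat_iff)
  have start_end: "ring_start r \<noteq> ring_end r" if "r \<in> set rs" for r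
  proof -
    obtain i where i: "i < length rs" "r = rs ! i"
      using \<open>r \<in> set rs\<close> by (auto simp: in_set_conv_nth)
    have lr: "length rs = length ls" 
      by (metis length_map map_ring_start_tour_rings rs_def)
    have "ring_end r = map ring_end rs ! i" using i by simp
    also have "\<dots> = map ring_start rs ! (Suc i mod length rs)"
      unfolding ends using i by (simp add: nth_rotate1)
    finally have "ring_end r = map fst ls ! (Suc i mod length rs)"
      by (simp add: rs_def map_ring_start_tour_rings)
    moreover have "ring_start r = map fst ls ! i"
      using i by (metis map_ring_start_tour_rings nth_map rs_def)
    \<comment> \<open>With at least two legs the cyclic successor is a different leg, so the ring
      does not end where it starts.\<close>
    moreover have "Suc i mod length rs \<noteq> i"
      using i lr len by (cases "Suc i = length rs") auto
    moreover have "Suc i mod length rs < length ls" "i < length ls" using i lr len by (auto intro: mod_less_divisor)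
    ultimately show ?thesis using ds by (metis length_map nth_eq_iff_index_eq)
  qed
  have end_start: "\<exists>l\<in>set ls. ring_end r = fst l" if "r \<in> set rs" for r
  proof -
    have "ring_end r \<in> set (map ring_end rs)" using that by simp
    then have "ring_end r \<in> set (map fst ls)"
      unfolding ends by (simp add: rs_def map_ring_start_tour_rings del: set_map)
    then show ?thesis by auto
  qed
  have hd_in: "fst l \<in> set (leg_nodes l)" for l by (simp add: leg_nodes_def)
  have hd_notin: "fst l \<notin> set (tl (leg_nodes l))" if "l \<in> set ls" for l
    using dl[OF that] by (simp add: leg_nodes_def)
  have valid: "valid_ring r" if r: "r \<in> set rs" for r
  proof -
    obtain l e' where l: "l \<in> set ls" "r = leg_ring l e'"
      using r in_tour_ringsD unfolding rs_def by blast
    obtain l' where l': "l' \<in> set ls" "ring_end r = fst l'" using end_start[OF r] by blast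
    have "e' \<notin> set (tl (leg_nodes l))"
    proof
      assume a: "e' \<in> set (tl (leg_nodes l))"
      have e': "e' = fst l'" using l' l by (simp add: leg_ring_def)
      have "e' \<in> set (leg_nodes l)" using a by (simp add: leg_nodes_def)
      then have "l = l'" using same[OF l(1) l'(1)] hd_in e' by blast
      then show False using hd_notin[OF l(1)] a e' by simp
    qed
    then show ?thesis
      using start_end[OF r] hd_notin[OF l(1)] dl[OF l(1)] unfolding valid_ring_def l(2) inner
      by (auto simp: leg_ring_def leg_nodes_def)
  qed
  have un: "(\<Union>r\<in>set rs. ring_nodes r) = set (concat (map leg_nodes ls))"
  proof
    show "(\<Union>r\<in>set rs. ring_nodes r) \<subseteq> set (concat (map leg_nodes ls))"
    proof
      fix x assume "x \<in> (\<Union>r\<in>set rs. ring_nodes r)"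
      then obtain r where r: "r \<in> set rs" "x \<in> ring_nodes r" by blast
      obtain l e' where l: "l \<in> set ls" "r = leg_ring l e'"
        using r in_tour_ringsD unfolding rs_def by blast
      have "x \<in> set (leg_nodes l) \<or> x = ring_end r"
        using r(2) l(2) by (auto simp: ring_nodes_def inner_nodes_def leg_ring_def leg_nodes_def)
      then show "x \<in> set (concat (map leg_nodes ls))"
        using l(1) end_start[OF r(1)] hd_in by fastforce
    qed
    show "set (concat (map leg_nodes ls)) \<subseteq> (\<Union>r\<in>set rs. ring_nodes r)"
    proof
      fix x assume "x \<in> set (concat (map leg_nodes ls))"
      then obtain l where l: "l \<in> set ls" "x \<in> set (leg_nodes l)" by auto
      then obtain e' where "leg_ring l e' \<in> set rs"
        using leg_ring_in_tour_rings unfolding rs_def by blast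
      moreover have "x \<in> ring_nodes (leg_ring l e')"
        using l(2) by (auto simp: ring_nodes_def inner_nodes_def leg_ring_def leg_nodes_def)
      ultimately show "x \<in> (\<Union>r\<in>set rs. ring_nodes r)" by blast
    qed
  qed
  have uniq: "s = r" if r: "r \<in> set rs" "x \<in> inner_nodes r" and s: "s \<in> set rs" "x \<in> ring_nodes s"
    for r s x
  proof -
    obtain l e' where l: "l \<in> set ls" "r = leg_ring l e'"
      using r in_tour_ringsD unfolding rs_def by blast
    obtain k e'' where k: "k \<in> set ls" "s = leg_ring k e''"
      using s in_tour_ringsD unfolding rs_def by blast
    have x: "x \<in> set (tl (leg_nodes l))" using r(2) unfolding l(2) inner .
    then have x': "x \<in> set (leg_nodes l)" by (simp add: leg_nodes_def)
    have "x \<noteq> ring_end s"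
    proof
      assume a: "x = ring_end s"
      obtain l' where l': "l' \<in> set ls" "ring_end s = fst l'" using end_start[OF s(1)] by blast
      have "l = l'" using same[OF l(1) l'(1) x'] hd_in a l' by simp
      then show False using hd_notin[OF l(1)] x a l' by simp
    qed
    then have "x \<in> set (leg_nodes k)"
      using s(2) k(2) by (auto simp: ring_nodes_def inner_nodes_def leg_ring_def leg_nodes_def)
    then have "l = k" using same[OF l(1) k(1) x'] by simp
    then show ?thesis
      using tour_rings_same_leg[OF ds, of l e' e e''] r(1) s(1) l k by (simp add: rs_def)
  qed
  show ?thesis
    unfolding feasible_def e_def[symmetric] rs_def[symmetric]
    using valid cyc un uniq by blast
qed

text \<open>The order in which \<open>ts\<close> lists the truck nodes is one candidate in the
  minimum over all orders.\<close>

lemma ring_cost_leg_ring_le: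
  assumes "distinct ts"
  shows "ring_cost NT ND (leg_ring (a, ts, d) e) \<le>
    max (path_length NT (a # ts @ [e])) (path_length ND [a, d, e])"
proof -
  have "ts \<in> permutations_of_set (set ts)"
    using assms by (simp add: permutations_of_set_def)
  then show ?thesis
    unfolding ring_cost_def leg_ring_def
    by (intro Min_le) (simp_all add: image_iff, force)
qed

lemma TSPD_le_tour_rings:
  assumes d: "distinct (concat (map leg_nodes ls))" and len: "length ls \<ge> 2"
  shows "TSPD NT ND (set (concat (map leg_nodes ls)))
    \<le> sum_list (map (ring_cost NT ND) (tour_rings ls (fst (hd ls))))"
proof -
  let ?X = "set (concat (map leg_nodes ls))" and ?rs = "tour_rings ls (fst (hd ls))"
  have "distinct (map ring_start ?rs)"
    using distinct_leg_starts[OF d] by (simp add: map_ring_start_tour_rings)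
  \<comment> \<open>\<open>TSPD\<close> sums over the set of rings; distinctness allows summing over
    the list instead.\<close>
  then have dr: "distinct ?rs" by (simp add: distinct_map)
  have "length ls \<le> length (concat (map leg_nodes ls))"
    by (induction ls) (auto simp: leg_nodes_def)
  then have card: "\<not> card ?X \<le> 1"
    using d len distinct_card by fastforce
  have "(MIN R \<in> {R. feasible ?X R}. \<Sum>r\<in>R. ring_cost NT ND r) \<le> (\<Sum>r\<in>set ?rs. ring_cost NT ND r)"
    using feasible_tour_rings[OF d len] finite_feasible[of ?X]
    by (intro Min_le) auto
  then show ?thesis
    using card dr by (simp add: TSPD_def sum_list_distinct_conv_sum_set del: set_concat)
qed

section \<open>Windows of five consecutive points\<close>

lemma block_min_le:
  shows   "block_min \<alpha> l \<le> Tri \<alpha> l 0 1 2 + Tri \<alpha> l 1 4 3"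
  "block_min \<alpha> l \<le> Tri \<alpha> l 0 1 3 + Tri \<alpha> l 1 4 2"
  "block_min \<alpha> l \<le> Tri \<alpha> l 0 2 1 + Tri \<alpha> l 2 4 3"
  "block_min \<alpha> l \<le> Tri \<alpha> l 0 2 3 + Tri \<alpha> l 2 4 1"
  "block_min \<alpha> l \<le> Tri \<alpha> l 0 3 1 + Tri \<alpha> l 3 4 2"
  "block_min \<alpha> l \<le> Tri \<alpha> l 0 3 2 + Tri \<alpha> l 3 4 1"
  "block_min \<alpha> l \<le> Quin \<alpha> l 0 1 3 4 2"
  "block_min \<alpha> l \<le> Quin \<alpha> l 0 3 1 4 2"
  "block_min \<alpha> l \<le> Quin \<alpha> l 0 1 2 4 3"
  "block_min \<alpha> l \<le> Quin \<alpha> l 0 2 1 4 3"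
  "block_min \<alpha> l \<le> Quin \<alpha> l 0 2 3 4 1"
  "block_min \<alpha> l \<le> Quin \<alpha> l 0 3 2 4 1"
  unfolding block_min_def by (rule Min_le; simp)+

lemma block_min_in:
  "block_min \<alpha> l \<in> {Tri \<alpha> l 0 1 2 + Tri \<alpha> l 1 4 3,
     Tri \<alpha> l 0 1 3 + Tri \<alpha> l 1 4 2,
     Tri \<alpha> l 0 2 1 + Tri \<alpha> l 2 4 3,
     Tri \<alpha> l 0 2 3 + Tri \<alpha> l 2 4 1,
     Tri \<alpha> l 0 3 1 + Tri \<alpha> l 3 4 2,
     Tri \<alpha> l 0 3 2 + Tri \<alpha> l 3 4 1,
     Quin \<alpha> l 0 1 3 4 2,
     Quin \<alpha> l 0 3 1 4 2,
     Quin \<alpha> l 0 1 2 4 3,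
     Quin \<alpha> l 0 2 1 4 3,
     Quin \<alpha> l 0 2 3 4 1,
     Quin \<alpha> l 0 3 2 4 1}"
  unfolding block_min_def by (rule Min_in) simp_all

definition window_cost :: "real \<Rightarrow> (nat \<Rightarrow> point) \<Rightarrow> real" where
  "window_cost \<alpha> p = block_min \<alpha> (\<lambda>i j. norm (p i - p j))"

lemma window_cost_cong:
  assumes "\<And>i. i \<le> 4 \<Longrightarrow> p i = q i"
  shows "window_cost \<alpha> p = window_cost \<alpha> q"
proof -
  have "p 0 = q 0" "p 1 = q 1" "p 2 = q 2" "p 3 = q 3" "p 4 = q 4"
    using assms by simp_all
  then show ?thesis
    unfolding window_cost_def block_min_def Tri_def Quin_def by (simp only:)
qed

abbreviation speed_ring_cost :: "real \<Rightarrow> tspd_ring \<Rightarrow> real" where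
  "speed_ring_cost \<alpha> \<equiv> ring_cost (\<lambda>p. norm p) (\<lambda>p. 1 / \<alpha> * norm p)"

lemma speed_ring_cost_Tri:
  "speed_ring_cost \<alpha> (leg_ring (p i, [], p k) (p j)) \<le> Tri \<alpha> (\<lambda>i j. norm (p i - p j)) i j k"
  by (rule order_trans[OF ring_cost_leg_ring_le])
    (simp_all add: Tri_def norm_minus_commute add_divide_distrib)

lemma speed_ring_cost_Quin:
  assumes "p i1 \<noteq> p i2"
  shows "speed_ring_cost \<alpha> (leg_ring (p i, [p i1, p i2], p k) (p j))
    \<le> Quin \<alpha> (\<lambda>i j. norm (p i - p j)) i i1 i2 j k"
  by (rule order_trans[OF ring_cost_leg_ring_le])
    (use assms in \<open>simp_all add: Quin_def norm_minus_commute add_divide_distrib\<close>)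

text \<open>A sum of two \<open>Tri\<close> terms is a pair of legs without truck nodes, a
  \<open>Quin\<close> term is one leg with two truck nodes. The last node \<open>p 4\<close> is left
  out of the legs since the next block contributes it as its start. Injectivity stops before index 4
  because for the last block \<open>p 4\<close> is an arbitrary end node.\<close>

lemma ex_window_legs:
  assumes inj: "inj_on p {..<4}"
  obtains ls where "ls \<noteq> []" "fst (hd ls) = p 0"
    "mset (concat (map leg_nodes ls)) = {#p 0, p 1, p 2, p 3#}"
    "sum_list (map (speed_ring_cost \<alpha>) (tour_rings ls (p 4))) \<le> window_cost \<alpha> p"
proof -
  let ?l = "\<lambda>i j. norm (p i - p j)"
  have p: "p 1 \<noteq> p 2" "p 2 \<noteq> p 1" "p 1 \<noteq> p 3" "p 3 \<noteq> p 1" "p 2 \<noteq> p 3" "p 3 \<noteq> p 2"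
    using inj by (simp_all add: inj_on_eq_iff)
  note goal = that
  \<comment> \<open>Here \<open>i\<close> is the inner combined node, and \<open>k\<close> and
    \<open>k'\<close> are the drone nodes of the two rings.\<close>
  have tri: thesis
    if "window_cost \<alpha> p = Tri \<alpha> ?l 0 i k + Tri \<alpha> ?l i 4 k'"
      "{#p 0, p k, p i, p k'#} = {#p 0, p 1, p 2, p 3#}" for i k k'
    using that add_mono[OF speed_ring_cost_Tri[of \<alpha> p 0 k i] speed_ring_cost_Tri[of \<alpha> p i k' 4]]
    by (intro goal[of "[(p 0, [], p k), (p i, [], p k')]"]) (auto simp: leg_nodes_def)
  have quin: thesis
    if "window_cost \<alpha> p = Quin \<alpha> ?l 0 i j 4 k"
      "{#p 0, p i, p j, p k#} = {#p 0, p 1, p 2, p 3#}" "p i \<noteq> p j" for i j k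
    using that speed_ring_cost_Quin[of p i j \<alpha> 0 k 4]
    by (intro goal[of "[(p 0, [p i, p j], p k)]"]) (auto simp: leg_nodes_def)
  show thesis
    using block_min_in[of \<alpha> ?l, folded window_cost_def] unfolding insert_iff empty_iff
    by (elim disjE FalseE)
      ((erule tri, simp add: add_mset_commute) |
       (erule quin, simp add: add_mset_commute, use p in simp))+
qed

text \<open>The end node \<open>e\<close> stays open so that the induction can prepend a block that
  ends at the first node of the remaining list; the cycle is closed later by taking \<open>e\<close>
  as the head. The lower bound \<open>K\<close> on the number of legs secures the two rings that a
  tour needs.\<close>

lemma length_tour:
  assumes "length ps = 4 * K" "distinct ps"
  shows "\<exists>ls. length ls \<ge> K \<and> (K > 0 \<longrightarrow> fst (hd ls) = hd ps) \<and>
    mset (concat (map leg_nodes ls)) = mset ps \<and>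
    sum_list (map (speed_ring_cost \<alpha>) (tour_rings ls e))
      \<le> (\<Sum>k<K. window_cost \<alpha> (\<lambda>i. (ps @ [e]) ! (4 * k + i)))"
  using assms
proof (induction K arbitrary: ps)
  case 0
  then show ?case by (intro exI[of _ "[]"]) auto
next
  case (Suc K)
  obtain a b c d qs where ps: "ps = a # b # c # d # qs"
    using Suc.prems(1) by (auto simp: length_Suc_conv numeral_eq_Suc)
  obtain ls where ls: "length ls \<ge> K" "K > 0 \<longrightarrow> fst (hd ls) = hd qs"
    "mset (concat (map leg_nodes ls)) = mset qs"
    "sum_list (map (speed_ring_cost \<alpha>) (tour_rings ls e))
      \<le> (\<Sum>k<K. window_cost \<alpha> (\<lambda>i. (qs @ [e]) ! (4 * k + i)))"
    using Suc.IH[of qs] Suc.prems by (auto simp: ps)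
  define p where "p = (\<lambda>i. (ps @ [e]) ! i)"
  have pv: "p 0 = a" "p 1 = b" "p 2 = c" "p 3 = d" "p 4 = (qs @ [e]) ! 0"
    by (simp_all add: p_def ps numeral_eq_Suc)
  have "inj_on p {..<4}"
    using Suc.prems by (auto simp: inj_on_def p_def nth_append nth_eq_iff_index_eq)
  then obtain xs where xs: "xs \<noteq> []" "fst (hd xs) = a"
    "mset (concat (map leg_nodes xs)) = {#a, b, c, d#}"
    "sum_list (map (speed_ring_cost \<alpha>) (tour_rings xs (p 4))) \<le> window_cost \<alpha> p"
    using ex_window_legs[of p \<alpha>] unfolding pv(1-4) by metis
  have p4: "(if ls = [] then e else fst (hd ls)) = p 4"
  proof (cases "K = 0")
    case True
    then have "qs = []" using Suc.prems by (auto simp: ps)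
    moreover from this have "ls = []" using ls(3) by (cases ls) (auto simp: leg_nodes_def)
    ultimately show ?thesis by (simp add: pv)
  next
    case False
    then have "qs \<noteq> []" "ls \<noteq> []" using Suc.prems ls(1) by (auto simp: ps)
    then show ?thesis using ls(2) False by (simp add: pv nth_append hd_conv_nth)
  qed
  have "(\<Sum>k<Suc K. window_cost \<alpha> (\<lambda>i. (ps @ [e]) ! (4 * k + i))) =
    window_cost \<alpha> p + (\<Sum>k<K. window_cost \<alpha> (\<lambda>i. (qs @ [e]) ! (4 * k + i)))"
    unfolding sum.lessThan_Suc_shift by (simp add: p_def ps numeral_eq_Suc)
  moreover have "Suc K \<le> length (xs @ ls)"
    using xs(1) ls(1) by (cases xs) auto
  ultimately show ?case
    using xs ls(3,4) by (intro exI[of _ "xs @ ls"]) (simp add: tour_rings_append p4 ps)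
qed

lemma TSPD_le_windows:
  assumes len: "length ps = 4 * K" "K \<ge> 2" and "distinct ps"
  shows "TSPD_speed \<alpha> (set ps) \<le> (\<Sum>k<K. window_cost \<alpha> (\<lambda>i. ps ! ((4 * k + i) mod (4 * K))))"
proof -
  obtain ls where ls: "length ls \<ge> K" "fst (hd ls) = hd ps"
    "mset (concat (map leg_nodes ls)) = mset ps"
    "sum_list (map (speed_ring_cost \<alpha>) (tour_rings ls (hd ps)))
      \<le> (\<Sum>k<K. window_cost \<alpha> (\<lambda>i. (ps @ [hd ps]) ! (4 * k + i)))"
    using length_tour[OF len(1) assms(3), of \<alpha> "hd ps"] len by auto
  have "distinct (concat (map leg_nodes ls))" "set (concat (map leg_nodes ls)) = set ps"
    using ls(3) assms(3) by (metis mset_eq_imp_distinct_iff, metis mset_eq_setD)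
  then have "TSPD_speed \<alpha> (set ps) \<le> sum_list (map (speed_ring_cost \<alpha>) (tour_rings ls (hd ps)))"
    using TSPD_le_tour_rings[of ls] ls(1,2) len(2) by (simp add: TSPD_speed_def)
  also have "\<dots> \<le> (\<Sum>k<K. window_cost \<alpha> (\<lambda>i. (ps @ [hd ps]) ! (4 * k + i)))"
    by (fact ls(4))
  also have "\<dots> = (\<Sum>k<K. window_cost \<alpha> (\<lambda>i. ps ! ((4 * k + i) mod (4 * K))))"
  proof (intro sum.cong refl)
    fix k assume "k \<in> {..<K}"
    then have eq: "(ps @ [hd ps]) ! (4 * k + i) = ps ! ((4 * k + i) mod (4 * K))" if "i \<le> 4" for i
    proof (cases "4 * k + i < 4 * K")
      case True
      then show ?thesis using len by (simp add: nth_append)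
    next
      case False
      \<comment> \<open>Index 4 K is reached only by the end node of the last block, where the
        appended head of the list is met.\<close>
      then have "4 * k + i = 4 * K" using that \<open>k \<in> {..<K}\<close> by auto
      then show ?thesis using len by (auto simp: nth_append intro: hd_conv_nth)
    qed
    show "window_cost \<alpha> (\<lambda>i. (ps @ [hd ps]) ! (4 * k + i)) =
        window_cost \<alpha> (\<lambda>i. ps ! ((4 * k + i) mod (4 * K)))"
      by (intro window_cost_cong eq)
  qed
  finally show ?thesis .
qed

section \<open>Averaging over the four block offsets\<close>

lemma sum_groups_of_four:
  fixes f :: "nat \<Rightarrow> real"
  shows "(\<Sum>k<K. \<Sum>r<4. f (4 * k + r)) = (\<Sum>j<4 * K. f j)"
  by (induction K) (simp_all add: numeral_eq_Suc)

lemma four_TSPD_le_windows: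
  assumes len: "length ps = 4 * K" "K \<ge> 2" and "distinct ps"
  shows "4 * TSPD_speed \<alpha> (set ps) \<le> (\<Sum>j<4 * K. window_cost \<alpha> (\<lambda>i. ps ! ((j + i) mod (4 * K))))"
proof -
  let ?c = "\<lambda>j. window_cost \<alpha> (\<lambda>i. ps ! ((j + i) mod (4 * K)))"
  have "TSPD_speed \<alpha> (set ps) \<le> (\<Sum>k<K. ?c (4 * k + r))" for r
  proof -
    have "TSPD_speed \<alpha> (set ps) \<le>
      (\<Sum>k<K. window_cost \<alpha> (\<lambda>i. rotate r ps ! ((4 * k + i) mod (4 * K))))"
      \<comment> \<open>Rotation keeps the set of points and moves the block boundaries by
        \<open>r\<close>.\<close>
      using TSPD_le_windows[of "rotate r ps" K \<alpha>] assms by simp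
    also have "\<dots> = (\<Sum>k<K. ?c (4 * k + r))"
      using len by (simp add: nth_rotate mod_add_right_eq add_ac)
    finally show ?thesis .
  qed
  then have "(\<Sum>r<4::nat. TSPD_speed \<alpha> (set ps)) \<le> (\<Sum>r<4. \<Sum>k<K. ?c (4 * k + r))"
    by (intro sum_mono)
  also have "\<dots> = (\<Sum>k<K. \<Sum>r<4. ?c (4 * k + r))"
    by (rule sum.swap)
  also have "\<dots> = (\<Sum>j<4 * K. ?c j)"
    by (rule sum_groups_of_four)
  finally show ?thesis by simp
qed

section \<open>Path bound and reversal symmetry of the block minimum\<close>

lemma Quin_le_path:
  assumes "\<alpha> \<ge> 1" and nn: "\<And>i j. l i j \<ge> (0::real)" and tri: "\<And>i j k. l i k \<le> l i j + l j k"
  shows "Quin \<alpha> l 0 1 3 4 2 \<le> l 0 1 + l 1 2 + l 2 3 + l 3 4"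
proof -
  \<comment> \<open>As \<alpha> \<ge> 1, the drone is no slower than the truck, so by the triangle
    inequality its flight 0, 2, 4 takes at most the plain path; the truck skips node 2 and is within
    the plain path too.\<close>
  have "1 / \<alpha> * (l 0 2 + l 2 4) \<le> 1 * (l 0 2 + l 2 4)"
    using assms(1) nn[of 0 2] nn[of 2 4] by (intro mult_right_mono) auto
  then show ?thesis
    using tri[of 0 2 1] tri[of 2 4 3] tri[of 1 3 2] by (simp add: Quin_def)
qed

lemma block_min_le_path:
  assumes "\<alpha> \<ge> 1" "\<And>i j. l i j \<ge> (0::real)" "\<And>i j k. l i k \<le> l i j + l j k"
  shows "block_min \<alpha> l \<le> l 0 1 + l 1 2 + l 2 3 + l 3 4"
proof -
  have "block_min \<alpha> l \<le> Quin \<alpha> l 0 1 3 4 2" by (rule block_min_le)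
  then show ?thesis using Quin_le_path[of \<alpha> l] assms by fastforce
qed

lemma window_cost_le_path:
  assumes "\<alpha> \<ge> 1"
  shows "window_cost \<alpha> p \<le>
    norm (p 0 - p 1) + norm (p 1 - p 2) + norm (p 2 - p 3) + norm (p 3 - p 4)"
  unfolding window_cost_def using assms
  by (intro block_min_le_path) (auto intro: norm_diff_triangle_ineq order_trans[OF _ norm_triangle_ineq])

lemma block_min_nonneg:
  assumes "\<And>i j. l i j \<ge> (0::real)"
  shows "block_min \<alpha> l \<ge> 0"
  unfolding block_min_def Tri_def Quin_def
  using assms by (intro Min.boundedI) (auto intro!: add_nonneg_nonneg simp: le_max_iff_disj)

lemma window_cost_nonneg: "window_cost \<alpha> p \<ge> 0"
  unfolding window_cost_def by (rule block_min_nonneg) simp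

text \<open>Relabelling i as 4 - i permutes the twelve patterns. Strips of odd number are swept from
  right to left, and this symmetry lets their windows be listed from left to right as well.\<close>

lemma block_min_reverse_le:
  assumes sym: "\<And>i j. l i j = l j i"
  shows "block_min \<alpha> (\<lambda>i j. l (4 - i) (4 - j)) \<le> block_min \<alpha> l"
proof -
  let ?r = "\<lambda>i j. l (4 - i) (4 - j)"
  have T: "Tri \<alpha> ?r i j k = Tri \<alpha> l (4 - j) (4 - i) (4 - k)" for i j k
    using sym[of "4 - i" "4 - j"] sym[of "4 - i" "4 - k"] sym[of "4 - k" "4 - j"]
    by (simp only: Tri_def add_ac)
  have Q: "Quin \<alpha> ?r i a b j k = Quin \<alpha> l (4 - j) (4 - b) (4 - a) (4 - i) (4 - k)" for i j k a b
    using sym[of "4 - i" "4 - a"] sym[of "4 - a" "4 - b"] sym[of "4 - b" "4 - j"]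
      sym[of "4 - i" "4 - k"] sym[of "4 - k" "4 - j"]
    by (simp only: Quin_def add_ac)
  show ?thesis
    using block_min_in[of \<alpha> l] block_min_le[of \<alpha> ?r] unfolding T Q insert_iff empty_iff
    by (elim disjE FalseE) simp_all
qed

lemma window_cost_reverse_le: "window_cost \<alpha> p \<le> window_cost \<alpha> (\<lambda>i. p (4 - i))"
proof -
  have "window_cost \<alpha> p = window_cost \<alpha> (\<lambda>i. p (4 - (4 - i)))"
    by (rule window_cost_cong) simp
  also have "\<dots> \<le> window_cost \<alpha> (\<lambda>i. p (4 - i))"
    unfolding window_cost_def
    by (rule block_min_reverse_le[of "\<lambda>i j. norm (p (4 - i) - p (4 - j))"]) (rule norm_minus_commute)
  finally show ?thesis .
qed

section \<open>The boustrophedon sweep\<close>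

definition strip :: "nat \<Rightarrow> point \<Rightarrow> int" where
  "strip m p = \<lfloor>real m * snd p\<rfloor>"

definition strip_pos :: "nat \<Rightarrow> point \<Rightarrow> real" where
  "strip_pos m p = (if even (strip m p) then fst p else 1 - fst p)"

text \<open>On the unit square the position lies in \<open>[0, 1]\<close>, so the factor 2 makes the key sort by strip
  first, including between neighbouring strips that are swept in opposite directions.\<close>

definition sweep_key :: "nat \<Rightarrow> point \<Rightarrow> real" where
  "sweep_key m p = 2 * of_int (strip m p) + strip_pos m p"

text \<open>The top edge is left out because its points would fall into a strip with number m; it is
  a null set.\<close>

definition unit_square :: "point set" where
  "unit_square = {0..1} \<times> {0..<1}"

lemma strip_pos_bounds: "p \<in> unit_square \<Longrightarrow> 0 \<le> strip_pos m p \<and> strip_pos m p \<le> 1"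
  by (auto simp: unit_square_def strip_pos_def)

lemma strip_bounds:
  assumes "p \<in> unit_square" "m \<ge> 1"
  shows "0 \<le> strip m p" "strip m p < int m"
proof -
  have "real m * snd p < real m * 1"
    using assms by (intro mult_strict_left_mono) (auto simp: unit_square_def)
  then show "strip m p < int m" by (simp add: strip_def floor_less_iff)
  show "0 \<le> strip m p" using assms by (auto simp: strip_def unit_square_def)
qed

lemma strip_less_imp_key_less:
  assumes "p \<in> unit_square" "q \<in> unit_square" "strip m p < strip m q"
  shows "sweep_key m p < sweep_key m q"
proof -
  have "real_of_int (strip m p) + 1 \<le> real_of_int (strip m q)"
    using assms(3) by linarith
  then show ?thesis
    using strip_pos_bounds[OF assms(1), of m] strip_pos_bounds[OF assms(2), of m]
    by (simp add: sweep_key_def)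
qed

lemma key_le_imp_strip_le:
  assumes "p \<in> unit_square" "q \<in> unit_square" "sweep_key m p \<le> sweep_key m q"
  shows "strip m p \<le> strip m q"
  using strip_less_imp_key_less[of q p m] assms by force

text \<open>Within a strip the position is affine in the abscissa with slope 1 or -1. Hence distinct
  abscissas, which hold almost surely, make the sweep order strict.\<close>

lemma sweep_key_inj:
  assumes "p \<in> unit_square" "q \<in> unit_square" "sweep_key m p = sweep_key m q"
  shows "fst p = fst q"
proof -
  have "strip m p = strip m q"
    using key_le_imp_strip_le[of p q m] key_le_imp_strip_le[of q p m] assms by force
  then show ?thesis
    using assms(3) by (auto simp: sweep_key_def strip_pos_def split: if_splits)
qed

lemma norm_diff_unit_square:
  assumes "p \<in> unit_square" "q \<in> unit_square"
  shows "norm (p - q) \<le> 2"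
proof -
  have "norm (p - q) \<le> \<bar>fst p - fst q\<bar> + \<bar>snd p - snd q\<bar>"
    by (simp add: norm_prod_def sqrt_sum_squares_le_sum_abs)
  also have "\<dots> \<le> 1 + 1"
    using assms by (intro add_mono) (auto simp: unit_square_def)
  finally show ?thesis by simp
qed

text \<open>The constant 8 is that of four steps of length at most 2. It serves for windows that
  wrap around the end of the sweep and for the fallback bound on bad samples.\<close>

lemma window_cost_le_unit_square:
  assumes "\<alpha> \<ge> 1" "\<And>i. i \<le> 4 \<Longrightarrow> p i \<in> unit_square"
  shows "window_cost \<alpha> p \<le> 8"
proof -
  have "norm (p i - p j) \<le> 2" if "i \<le> 4" "j \<le> 4" for i j
    using that by (intro norm_diff_unit_square assms(2)) auto
  from this[of 0 1] this[of 1 2] this[of 2 3] this[of 3 4] show ?thesis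
    using window_cost_le_path[OF assms(1), of p] by simp
qed

text \<open>Applied to the strip numbers along the sweep: they lie between 0 and m, so their
  increases across all windows total at most 4 m.\<close>

lemma sum_telescope_four:
  fixes f :: "nat \<Rightarrow> real"
  shows "(\<Sum>i<N. f (i + 4) - f i) = f N + f (N + 1) + f (N + 2) + f (N + 3) - (f 0 + f 1 + f 2 + f 3)"
  by (induction N) (simp_all add: numeral_eq_Suc)

text \<open>Geometry is kept apart from sorting: the estimates see a sequence with strictly
  increasing key, later instantiated by the sample composed with a sorting permutation.\<close>

locale sweep =
  fixes m n :: nat and y :: "nat \<Rightarrow> point"
  assumes m: "m \<ge> 1"
    and square: "\<And>i. i < n \<Longrightarrow> y i \<in> unit_square"
    and key_mono: "\<And>i j. i < j \<Longrightarrow> j < n \<Longrightarrow> sweep_key m (y i) < sweep_key m (y j)"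
begin

lemma key_less_iff: "i < n \<Longrightarrow> j < n \<Longrightarrow> sweep_key m (y i) < sweep_key m (y j) \<longleftrightarrow> i < j"
  using key_mono by (metis less_asym linorder_neqE_nat)

lemma strip_mono: "i \<le> j \<Longrightarrow> j < n \<Longrightarrow> strip m (y i) \<le> strip m (y j)"
  using key_mono[of i j] square[of i] square[of j]
  by (cases "i = j") (auto intro!: key_le_imp_strip_le)

lemma strip_less_imp_less:
  "i < n \<Longrightarrow> j < n \<Longrightarrow> strip m (y i) < strip m (y j) \<Longrightarrow> i < j"
  using strip_mono by (meson leD leI)

lemma same_strip_pos_less_iff:
  assumes "i < n" "j < n" "strip m (y i) = strip m (y j)"
  shows "strip_pos m (y i) < strip_pos m (y j) \<longleftrightarrow> i < j"
  using key_less_iff[OF assms(1,2)] assms(3) by (simp add: sweep_key_def)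

text \<open>The window has only three points between its ends, so it cannot contain the at least four
  points of a margin.\<close>

lemma straddling_near_wall:
  fixes \<epsilon> :: real
  assumes ex: "\<And>s. s < m \<Longrightarrow> card {j\<in>{..<n}. strip m (y j) = int s \<and> strip_pos m (y j) \<ge> 1 - \<epsilon>} \<ge> 4"
    and en: "\<And>s. s < m \<Longrightarrow> card {j\<in>{..<n}. strip m (y j) = int s \<and> strip_pos m (y j) \<le> \<epsilon>} \<ge> 4"
    and i: "i + 4 < n" and straddle: "strip m (y i) \<noteq> strip m (y (i + 4))"
    and j: "i \<le> j" "j \<le> i + 4"
  shows "(strip m (y j) = strip m (y i) \<or> strip m (y j) = strip m (y i) + 1) \<and>
    (if even (strip m (y i)) then fst (y j) \<ge> 1 - \<epsilon> else fst (y j) \<le> \<epsilon>)"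
proof -
  have few: "\<not> card A \<ge> 4" if "A \<subseteq> {i<..<i + 4}" for A
  proof -
    have "card A \<le> card {i<..<i + 4}" using that by (intro card_mono) auto
    then show ?thesis by simp
  qed
  have nat_strip: "int (nat (strip m (y l))) = strip m (y l)" "nat (strip m (y l)) < m" if "l < n" for l
    using strip_bounds[OF square[OF that] m] by auto
  have lt: "strip m (y i) < strip m (y (i + 4))"
    using straddle strip_mono[of i "i + 4"] i by auto
  have le: "strip m (y i) \<le> strip m (y j)" "strip m (y j) \<le> strip m (y (i + 4))"
    using strip_mono i j by auto
  \<comment> \<open>A strip jumped over by the window would have all its points strictly inside the
    window.\<close>
  have next_strip: "strip m (y (i + 4)) = strip m (y i) + 1"
  proof (rule ccontr)
    assume "\<not> ?thesis"
    then have gap: "strip m (y i) + 1 < strip m (y (i + 4))" using lt by simp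
    let ?s = "nat (strip m (y i) + 1)"
    have s: "int ?s = strip m (y i) + 1" "?s < m"
      using strip_bounds[OF square[of i] m] strip_bounds[OF square[of "i + 4"] m] i gap by auto
    have "{j\<in>{..<n}. strip m (y j) = int ?s \<and> strip_pos m (y j) \<ge> 1 - \<epsilon>} \<subseteq> {i<..<i + 4}"
      using strip_less_imp_less[of i] strip_less_imp_less[of _ "i + 4"] i gap unfolding s(1) by auto
    then show False using few ex[OF s(2)] by blast
  qed
  \<comment> \<open>If \<open>y j\<close> stopped short of the margin, every point of the exit
    margin would come after \<open>y j\<close> and before \<open>y (i + 4)\<close>, which lies in a
    later strip.\<close>
  have exit: "strip_pos m (y j) \<ge> 1 - \<epsilon>" if "strip m (y j) = strip m (y i)"
  proof (rule ccontr)
    assume a: "\<not> ?thesis"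
    let ?s = "nat (strip m (y i))"
    have "{l\<in>{..<n}. strip m (y l) = int ?s \<and> strip_pos m (y l) \<ge> 1 - \<epsilon>} \<subseteq> {i<..<i + 4}"
    proof clarify
      fix l assume l: "l < n" "strip m (y l) = int ?s" "strip_pos m (y l) \<ge> 1 - \<epsilon>"
      then have eq: "strip m (y l) = strip m (y i)" using nat_strip[of i] i by simp
      have "j < l"
        using same_strip_pos_less_iff[of j l] a l eq that i j by auto
      moreover have "l < i + 4" using strip_less_imp_less[of l "i + 4"] l i eq lt by auto
      ultimately show "l \<in> {i<..<i + 4}" using j by auto
    qed
    then show False using few ex[of ?s] nat_strip[of i] i by auto
  qed
  have entry: "strip_pos m (y j) \<le> \<epsilon>" if "strip m (y j) = strip m (y (i + 4))"
  proof (rule ccontr)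
    assume a: "\<not> ?thesis"
    let ?s = "nat (strip m (y (i + 4)))"
    have "{l\<in>{..<n}. strip m (y l) = int ?s \<and> strip_pos m (y l) \<le> \<epsilon>} \<subseteq> {i<..<i + 4}"
    proof clarify
      fix l assume l: "l < n" "strip m (y l) = int ?s" "strip_pos m (y l) \<le> \<epsilon>"
      then have eq: "strip m (y l) = strip m (y (i + 4))" using nat_strip[of "i + 4"] i by simp
      have "l < j"
        using same_strip_pos_less_iff[of l j] a l eq that i j by auto
      moreover have "i < l" using strip_less_imp_less[of i l] l i eq lt by auto
      ultimately show "l \<in> {i<..<i + 4}" using j by auto
    qed
    then show False using few en[of ?s] nat_strip[of "i + 4"] i by auto
  qed
  \<comment> \<open>The sweep alternates direction, so leaving one strip and entering the next
    happen at the same wall.\<close>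
  show ?thesis
  proof (cases "strip m (y j) = strip m (y i)")
    case True
    then show ?thesis using exit by (auto simp: strip_pos_def)
  next
    case False
    then have "strip m (y j) = strip m (y i) + 1" using le next_strip by linarith
    then show ?thesis using entry next_strip by (auto simp: strip_pos_def)
  qed
qed

text \<open>Both points lie within \<epsilon> of the same wall and inside two neighbouring strips of
  total height 2 / m.\<close>

lemma straddling_step:
  fixes \<epsilon> :: real
  assumes ex: "\<And>s. s < m \<Longrightarrow> card {j\<in>{..<n}. strip m (y j) = int s \<and> strip_pos m (y j) \<ge> 1 - \<epsilon>} \<ge> 4"
    and en: "\<And>s. s < m \<Longrightarrow> card {j\<in>{..<n}. strip m (y j) = int s \<and> strip_pos m (y j) \<le> \<epsilon>} \<ge> 4"
    and i: "i + 4 < n" and straddle: "strip m (y i) \<noteq> strip m (y (i + 4))"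
    and j: "i \<le> j" "j \<le> i + 4" and k: "i \<le> k" "k \<le> i + 4"
  shows "norm (y j - y k) \<le> \<epsilon> + 2 / m"
proof -
  have sq: "y j \<in> unit_square" "y k \<in> unit_square" using square i j k by auto
  note nj = straddling_near_wall[OF ex en i straddle j] and nk = straddling_near_wall[OF ex en i straddle k]
  have "\<bar>fst (y j) - fst (y k)\<bar> \<le> \<epsilon>"
    using nj nk sq by (auto simp: unit_square_def split: if_splits)
  moreover have "\<bar>snd (y j) - snd (y k)\<bar> \<le> 2 / m"
  proof -
    have fl: "real_of_int (strip m p) \<le> real m * snd p" "real m * snd p < real_of_int (strip m p) + 1" for p
      unfolding strip_def by linarith+
    have "real_of_int (strip m (y i)) \<le> real_of_int (strip m (y l))"
      "real_of_int (strip m (y l)) \<le> real_of_int (strip m (y i)) + 1" if "l = j \<or> l = k" for l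
      using that nj[THEN conjunct1] nk[THEN conjunct1] by auto
    from this[of j] this[of k] have "\<bar>real m * snd (y j) - real m * snd (y k)\<bar> \<le> 2"
      using fl[of "y j"] fl[of "y k"] by simp
    then have "m * \<bar>snd (y j) - snd (y k)\<bar> \<le> 2"
      unfolding right_diff_distrib[symmetric] abs_mult by simp
    then show ?thesis using m by (simp add: field_simps)
  qed
  moreover have "norm (y j - y k) \<le> \<bar>fst (y j) - fst (y k)\<bar> + \<bar>snd (y j) - snd (y k)\<bar>"
    by (simp add: norm_prod_def sqrt_sum_squares_le_sum_abs)
  ultimately show ?thesis by linarith
qed

text \<open>A straddling window costs at most 4 (\<epsilon> + 2 / m) and is charged to the increase
  of the strip number across it, which is at least 1. Since these increases total at most 4 m, this
  gives 16 m \<epsilon> + 32; the four windows that wrap around add another 32.\<close>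

lemma sum_windows_le:
  fixes \<epsilon> :: real
  assumes \<alpha>: "\<alpha> \<ge> 1" and \<epsilon>: "\<epsilon> \<ge> 0" and n: "n \<ge> 4"
    and ex: "\<And>s. s < m \<Longrightarrow> card {j\<in>{..<n}. strip m (y j) = int s \<and> strip_pos m (y j) \<ge> 1 - \<epsilon>} \<ge> 4"
    and en: "\<And>s. s < m \<Longrightarrow> card {j\<in>{..<n}. strip m (y j) = int s \<and> strip_pos m (y j) \<le> \<epsilon>} \<ge> 4"
  shows "(\<Sum>j<n. window_cost \<alpha> (\<lambda>i. y ((j + i) mod n))) \<le>
    (\<Sum>j\<in>{j\<in>{..<n - 4}. strip m (y j) = strip m (y (j + 4))}. window_cost \<alpha> (\<lambda>i. y (j + i)))
      + (16 * m * \<epsilon> + 64)"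
proof -
  let ?w = "\<lambda>j. window_cost \<alpha> (\<lambda>i. y ((j + i) mod n))"
  let ?I = "\<lambda>j. strip m (y j) = strip m (y (j + 4))"
  let ?d = "\<lambda>j. real_of_int (strip m (y (j + 4))) - real_of_int (strip m (y j))"
  have "(\<Sum>j<n. ?w j) = (\<Sum>j<n - 4. ?w j) + (\<Sum>j\<in>{n-4..<n}. ?w j)"
    using n by (simp add: lessThan_atLeast0 sum.atLeastLessThan_concat)
  moreover have "(\<Sum>j\<in>{n-4..<n}. ?w j) \<le> (\<Sum>j\<in>{n-4..<n}. 8)"
    using n by (intro sum_mono window_cost_le_unit_square \<alpha> square) auto
  moreover have "(\<Sum>j\<in>{n-4..<n}. 8) = (32::real)"
    using n by simp
  moreover have "(\<Sum>j<n - 4. ?w j) \<le>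
     (\<Sum>j<n - 4. (if ?I j then window_cost \<alpha> (\<lambda>i. y (j + i)) else 0) + 4 * (\<epsilon> + 2 / m) * ?d j)"
  proof (intro sum_mono)
    fix j assume "j \<in> {..<n - 4}"
    then have j: "j + 4 < n" by auto
    have w: "?w j = window_cost \<alpha> (\<lambda>i. y (j + i))"
      using j by (intro window_cost_cong) auto
    show "?w j \<le> (if ?I j then window_cost \<alpha> (\<lambda>i. y (j + i)) else 0) + 4 * (\<epsilon> + 2 / m) * ?d j"
    proof (cases "?I j")
      case True
      then show ?thesis using w by simp
    next
      case False
      note st = straddling_step[OF ex en j False]
      have "?w j \<le> 4 * (\<epsilon> + 2 / m)"
        unfolding w using window_cost_le_path[OF \<alpha>, of "\<lambda>i. y (j + i)"]
          st[of "j + 0" "j + 1"] st[of "j + 1" "j + 2"] st[of "j + 2" "j + 3"] st[of "j + 3" "j + 4"]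
        by simp
      moreover have "?d j \<ge> 1"
        using False strip_mono[of j "j + 4"] j by linarith
      then have "4 * (\<epsilon> + 2 / m) * 1 \<le> 4 * (\<epsilon> + 2 / m) * ?d j"
        using \<epsilon> by (intro mult_left_mono) auto
      ultimately show ?thesis using False by simp
    qed
  qed
  moreover have "(\<Sum>j<n - 4. ?d j) \<le> 4 * real m"
  proof -
    have b: "0 \<le> real_of_int (strip m (y j))" "real_of_int (strip m (y j)) \<le> real m" if "j < n" for j
      using strip_bounds[OF square[OF that] m] by linarith+
    have "n - 4 < n" "n - 4 + 1 < n" "n - 4 + 2 < n" "n - 4 + 3 < n" "0 < n" "1 < n" "2 < n" "3 < n"
      using n by linarith+
    note this[THEN b(1)] this[THEN b(2)]
    then show ?thesis
      unfolding sum_telescope_four[of "\<lambda>j. real_of_int (strip m (y j))"] by linarith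
  qed
  then have "4 * (\<epsilon> + 2 / m) * (\<Sum>j<n - 4. ?d j) \<le> 4 * (\<epsilon> + 2 / m) * (4 * real m)"
    using \<epsilon> by (intro mult_left_mono) auto
  moreover have "4 * (\<epsilon> + 2 / m) * (4 * real m) = 16 * m * \<epsilon> + 32"
    using m by (simp add: field_simps)
  moreover have "(\<Sum>j<n - 4. if ?I j then window_cost \<alpha> (\<lambda>i. y (j + i)) else 0) =
      (\<Sum>j\<in>{j\<in>{..<n - 4}. ?I j}. window_cost \<alpha> (\<lambda>i. y (j + i)))"
    by (rule sum.inter_filter[symmetric]) simp
  ultimately show ?thesis
    unfolding sum.distrib sum_distrib_left[symmetric] by linarith
qed

end

lemma ex_sweep_order:
  fixes x :: "nat \<Rightarrow> point" and n :: nat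
  assumes sq: "\<And>i. i < n \<Longrightarrow> x i \<in> unit_square" and inj: "inj_on (\<lambda>i. fst (x i)) {..<n}"
  obtains \<sigma> where "bij_betw \<sigma> {..<n} {..<n}"
    "\<And>i j. i < j \<Longrightarrow> j < n \<Longrightarrow> sweep_key m (x (\<sigma> i)) < sweep_key m (x (\<sigma> j))"
proof -
  define ks where "ks = sort_key (\<lambda>i. sweep_key m (x i)) [0..<n]"
  have ks: "distinct ks" "set ks = {..<n}" "length ks = n"
    by (auto simp: ks_def)
  have bij: "bij_betw ((!) ks) {..<n} {..<n}"
    by (rule bij_betw_nth) (use ks in auto)
  have "sweep_key m (x (ks ! i)) < sweep_key m (x (ks ! j))" if "i < j" "j < n" for i j
  proof -
    have "sorted (map (\<lambda>i. sweep_key m (x i)) ks)"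
      unfolding ks_def by (rule sorted_sort_key)
    then have "sweep_key m (x (ks ! i)) \<le> sweep_key m (x (ks ! j))"
      using that ks(3) by (auto dest!: sorted_nth_mono[of _ i j])
    moreover have "sweep_key m (x (ks ! i)) \<noteq> sweep_key m (x (ks ! j))"
    proof
      assume a: "sweep_key m (x (ks ! i)) = sweep_key m (x (ks ! j))"
      have b: "ks ! i < n" "ks ! j < n" using that ks by (metis lessThan_iff nth_mem less_trans)+
      have "ks ! i = ks ! j"
        using inj_onD[OF inj sweep_key_inj[OF sq sq a]] b by simp
      then show False using that ks by (simp add: nth_eq_iff_index_eq)
    qed
    ultimately show ?thesis by simp
  qed
  then show ?thesis using that bij by blast
qed

section \<open>Counting windows by five-tuples of indices\<close>

definition tuples :: "nat \<Rightarrow> (nat \<Rightarrow> nat) set" where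
  "tuples n = {t \<in> {..4} \<rightarrow>\<^sub>E {..<n}. inj_on t {..4}}"

text \<open>The tuple runs from left to right whatever the direction of the sweep. Once the five
  points are fixed, the last conjunct is one separate condition on each remaining point, so that its
  probability will factorise.\<close>

definition consecutive :: "nat \<Rightarrow> nat \<Rightarrow> nat \<Rightarrow> (nat \<Rightarrow> point) \<Rightarrow> (nat \<Rightarrow> nat) \<Rightarrow> bool" where
  "consecutive m n s x t \<longleftrightarrow>
    (\<forall>k\<le>4. x (t k) \<in> unit_square \<and> strip m (x (t k)) = int s) \<and> (\<forall>k<4. fst (x (t k)) < fst (x (t (Suc k)))) \<and>
    (\<forall>j\<in>{..<n} - t ` {..4}.
      \<not> (strip m (x j) = int s \<and> fst (x (t 0)) < fst (x j) \<and> fst (x j) < fst (x (t 4))))"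

lemma finite_tuples: "finite (tuples n)"
  unfolding tuples_def by (rule finite_subset[OF _ finite_PiE[of "{..4}" "\<lambda>_. {..<n}"]]) auto

lemma card_tuples_le: "card (tuples n) \<le> n ^ 5"
proof -
  have "card (tuples n) \<le> card ({..4::nat} \<rightarrow>\<^sub>E {..<n})"
    unfolding tuples_def by (intro card_mono finite_PiE) auto
  also have "\<dots> = n ^ 5" by (simp add: card_PiE)
  finally show ?thesis .
qed

text \<open>The sweep visits at most these windows, possibly reversed; unlike the sweep order itself, this
  sum is visibly a measurable function of the points.\<close>

definition window_sum :: "real \<Rightarrow> nat \<Rightarrow> nat \<Rightarrow> (nat \<Rightarrow> point) \<Rightarrow> real" where
  "window_sum \<alpha> m n x =
    (\<Sum>(t, s)\<in>tuples n \<times> {..<m}. of_bool (consecutive m n s x t) * window_cost \<alpha> (\<lambda>k. x (t k)))"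

lemma (in sweep) same_strip_window:
  assumes "j + 4 < n" "strip m (y j) = strip m (y (j + 4))" "k \<le> 4"
  shows "strip m (y (j + k)) = strip m (y j)"
  using strip_mono[of j "j + k"] strip_mono[of "j + k" "j + 4"] assms by force

text \<open>Windows inject into the summands of \<open>window_sum\<close> through their tuple and
  strip, and the other summands are nonnegative. In strips of odd number the tuple is the reversed
  window, whose cost is no smaller.\<close>

lemma (in sweep) sum_inside_windows_le:
  assumes bij: "bij_betw \<sigma> {..<n} {..<n}" and y: "\<And>i. i < n \<Longrightarrow> y i = x (\<sigma> i)"
  shows "(\<Sum>j\<in>{j\<in>{..<n - 4}. strip m (y j) = strip m (y (j + 4))}. window_cost \<alpha> (\<lambda>i. y (j + i)))
    \<le> window_sum \<alpha> m n x"
proof -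
  define I where "I = {j\<in>{..<n - 4}. strip m (y j) = strip m (y (j + 4))}"
  define ix where "ix = (\<lambda>j k. if even (strip m (y j)) then j + k else j + (4 - k))"
  define tup where "tup = (\<lambda>j. restrict (\<lambda>k. \<sigma> (ix j k)) {..4})"
  define st where "st = (\<lambda>j. nat (strip m (y j)))"
  have I: "j + 4 < n" "strip m (y j) = strip m (y (j + 4))" if "j \<in> I" for j
    using that by (auto simp: I_def)
  have \<sigma>n: "\<sigma> i < n" if "i < n" for i using bij that by (auto simp: bij_betw_def)
  have \<sigma>inj: "\<sigma> i = \<sigma> j \<longleftrightarrow> i = j" if "i < n" "j < n" for i j
    using bij that by (auto simp: bij_betw_def inj_on_def)
  have ixb: "j \<le> ix j k" "ix j k \<le> j + 4" if "k \<le> 4" for j k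
    using that by (auto simp: ix_def)
  have st: "int (st j) = strip m (y j)" "st j < m" if "j < n" for j
    using strip_bounds[OF square[OF that] m] by (auto simp: st_def)
  have strips: "strip m (y (ix j k)) = int (st j)" if "j \<in> I" "k \<le> 4" for j k
    using same_strip_window[OF I[OF that(1)], of "ix j k - j"] ixb[OF that(2), of j] st I[OF that(1)]
    by simp
  have tup_x: "x (tup j k) = y (ix j k)" if "j \<in> I" "k \<le> 4" for j k
    using that ixb[OF that(2), of j] I[OF that(1)] y[of "ix j k"] by (simp add: tup_def)
  have tup: "tup j \<in> tuples n" if "j \<in> I" for j
  proof -
    have "inj_on (tup j) {..4}"
    proof (rule inj_onI)
      fix k l assume kl: "k \<in> {..4}" "l \<in> {..4}" "tup j k = tup j l"
      then have "ix j k = ix j l"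
        using \<sigma>inj[of "ix j k" "ix j l"] ixb[of k j] ixb[of l j] I[OF that] by (simp add: tup_def)
      then show "k = l" using kl by (auto simp: ix_def split: if_splits)
    qed
    moreover have "tup j \<in> {..4} \<rightarrow>\<^sub>E {..<n}"
      unfolding tup_def using ixb[of _ j] I[OF that] by (force intro!: \<sigma>n)
    ultimately show ?thesis by (simp add: tuples_def)
  qed
  have pos_fst: "fst (y a) < fst (y b) \<longleftrightarrow> (if even (strip m (y a)) then a < b else b < a)"
    if "a < n" "b < n" "strip m (y a) = strip m (y b)" for a b
    using same_strip_pos_less_iff[OF that] same_strip_pos_less_iff[OF that(2,1) that(3)[symmetric]] that(3)
    by (auto simp: strip_pos_def)
  have cons: "consecutive m n (st j) x (tup j)" if j: "j \<in> I" for j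
    unfolding consecutive_def
  proof (intro conjI allI impI ballI notI)
    fix k :: nat assume "k \<le> 4"
    then show "x (tup j k) \<in> unit_square" "strip m (x (tup j k)) = int (st j)"
      using strips[OF j] tup_x[OF j] square ixb[of k j] I(1)[OF j] by auto
  next
    fix k :: nat assume k: "k < 4"
    have "ix j k < n" "ix j (Suc k) < n"
      using ixb[of k j] ixb[of "Suc k" j] I(1)[OF j] k by auto
    moreover have "strip m (y (ix j k)) = strip m (y (ix j (Suc k)))"
      "even (strip m (y (ix j k))) = even (strip m (y j))"
      using strips[OF j, of k] strips[OF j, of "Suc k"] st(1)[of j] I(1)[OF j] k by auto
    moreover have "if even (strip m (y j)) then ix j k < ix j (Suc k) else ix j (Suc k) < ix j k"
      using k by (auto simp: ix_def)
    ultimately have "fst (y (ix j k)) < fst (y (ix j (Suc k)))"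
      using pos_fst[of "ix j k" "ix j (Suc k)"] by simp
    then show "fst (x (tup j k)) < fst (x (tup j (Suc k)))"
      using tup_x[OF j, of k] tup_x[OF j, of "Suc k"] k by simp
  next
    fix l assume l: "l \<in> {..<n} - tup j ` {..4}"
      and b: "strip m (x l) = int (st j) \<and> fst (x (tup j 0)) < fst (x l) \<and> fst (x l) < fst (x (tup j 4))"
    have "l \<in> \<sigma> ` {..<n}" using l bij by (auto simp: bij_betw_def)
    then obtain i where i: "i < n" "l = \<sigma> i" by auto
    have "j < i \<and> i < j + 4"
    proof -
      have n: "ix j 0 < n" "ix j 4 < n"
        using ixb[of 0 j] ixb[of 4 j] I(1)[OF j] by auto
      have eq: "strip m (y (ix j 0)) = strip m (y i)" "strip m (y i) = strip m (y (ix j 4))"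
        "strip m (y i) = strip m (y j)" "strip m (y (ix j 0)) = strip m (y j)"
        using strips[OF j, of 0] strips[OF j, of 4] st(1)[of j] I(1)[OF j] b y[OF i(1)] i(2) by auto
      have "fst (y (ix j 0)) < fst (y i)" "fst (y i) < fst (y (ix j 4))"
        using b tup_x[OF j, of 0] tup_x[OF j, of 4] y[OF i(1)] i(2) by auto
      then have "if even (strip m (y j)) then ix j 0 < i \<and> i < ix j 4 else i < ix j 0 \<and> ix j 4 < i"
        using pos_fst[OF n(1) i(1) eq(1)] pos_fst[OF i(1) n(2) eq(2)] eq(3,4) by simp
      then show ?thesis by (auto simp: ix_def split: if_splits)
    qed
    then have "i = ix j (if even (strip m (y j)) then i - j else 4 - (i - j))"
      by (auto simp: ix_def)
    moreover have "(if even (strip m (y j)) then i - j else 4 - (i - j)) \<in> {..4}"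
      using \<open>j < i \<and> i < j + 4\<close> by auto
    ultimately have "l \<in> tup j ` {..4}"
      unfolding i(2) by (intro image_eqI) (auto simp: tup_def)
    then show False using l by simp
  qed
  have inj: "inj_on (\<lambda>j. (tup j, st j)) I"
  proof (rule inj_onI)
    fix i j assume ij: "i \<in> I" "j \<in> I" "(tup i, st i) = (tup j, st j)"
    then have par: "strip m (y i) = strip m (y j)"
      using st(1)[of i] st(1)[of j] I(1)[OF ij(1)] I(1)[OF ij(2)] by simp
    have "tup i 0 = tup j 0" "tup i 4 = tup j 4" using ij by auto
    then have "ix i 0 = ix j 0" "ix i 4 = ix j 4"
      using \<sigma>inj[of "ix i 0" "ix j 0"] \<sigma>inj[of "ix i 4" "ix j 4"]
        ixb[of 0 i] ixb[of 0 j] ixb[of 4 i] ixb[of 4 j] I[OF ij(1)] I[OF ij(2)]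
      by (simp_all add: tup_def)
    then show "i = j" using par by (auto simp: ix_def split: if_splits)
  qed
  have wc: "window_cost \<alpha> (\<lambda>i. y (j + i)) \<le> window_cost \<alpha> (\<lambda>k. x (tup j k))" if j: "j \<in> I" for j
  proof (cases "even (strip m (y j))")
    case True
    then have "window_cost \<alpha> (\<lambda>i. y (j + i)) = window_cost \<alpha> (\<lambda>k. x (tup j k))"
      using tup_x[OF j] by (intro window_cost_cong) (simp add: ix_def)
    then show ?thesis by simp
  next
    case False
    have "window_cost \<alpha> (\<lambda>i. y (j + i)) \<le> window_cost \<alpha> (\<lambda>i. y (j + (4 - i)))"
      by (rule window_cost_reverse_le)
    also have "\<dots> = window_cost \<alpha> (\<lambda>k. x (tup j k))"
      using tup_x[OF j] False by (intro window_cost_cong) (simp add: ix_def)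
    finally show ?thesis .
  qed
  have "(\<Sum>j\<in>I. window_cost \<alpha> (\<lambda>i. y (j + i))) \<le>
      (\<Sum>j\<in>I. case (tup j, st j) of (t, s) \<Rightarrow>
        of_bool (consecutive m n s x t) * window_cost \<alpha> (\<lambda>k. x (t k)))"
    using wc cons by (intro sum_mono) simp
  also have "\<dots> = (\<Sum>(t, s)\<in>(\<lambda>j. (tup j, st j)) ` I.
        of_bool (consecutive m n s x t) * window_cost \<alpha> (\<lambda>k. x (t k)))"
    unfolding sum.reindex[OF inj] comp_def ..
  also have "\<dots> \<le> window_sum \<alpha> m n x"
    unfolding window_sum_def
  proof (rule sum_mono2)
    show "(\<lambda>j. (tup j, st j)) ` I \<subseteq> tuples n \<times> {..<m}"
      using tup st(2)[OF add_lessD1[OF I(1)]] by auto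
  qed (auto simp: finite_tuples window_cost_nonneg)
  finally show ?thesis unfolding I_def .
qed

lemma ex_sweep_tour:
  fixes x :: "nat \<Rightarrow> point" and K :: nat
  assumes m: "m \<ge> 1" and K: "K \<ge> 2"
    and sq: "\<And>i. i < 4 * K \<Longrightarrow> x i \<in> unit_square" and inj: "inj_on (\<lambda>i. fst (x i)) {..<4 * K}"
  obtains \<sigma> where "bij_betw \<sigma> {..<4 * K} {..<4 * K}" "sweep m (4 * K) (\<lambda>i. x (\<sigma> i))"
    "4 * TSPD_speed \<alpha> (x ` {..<4 * K}) \<le>
      (\<Sum>j<4 * K. window_cost \<alpha> (\<lambda>i. x (\<sigma> ((j + i) mod (4 * K)))))"
proof -
  obtain \<sigma> where \<sigma>: "bij_betw \<sigma> {..<4 * K} {..<4 * K}"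
    "\<And>i j. i < j \<Longrightarrow> j < 4 * K \<Longrightarrow> sweep_key m (x (\<sigma> i)) < sweep_key m (x (\<sigma> j))"
    using ex_sweep_order[OF sq inj] by metis
  define y where "y = (\<lambda>i. x (\<sigma> i))"
  define ps where "ps = map y [0..<4 * K]"
  have \<sigma>n: "\<sigma> i < 4 * K" if "i < 4 * K" for i using \<sigma>(1) that by (auto simp: bij_betw_def)
  have sw: "sweep m (4 * K) y"
    by standard (use m sq \<sigma> \<sigma>n in \<open>auto simp: y_def\<close>)
  then interpret sweep m "4 * K" y .
  have "inj_on y {..<4 * K}"
    using key_less_iff by (intro inj_onI) (metis lessThan_iff less_irrefl linorder_neqE_nat)
  then have "distinct ps" by (simp add: ps_def distinct_map lessThan_atLeast0)
  moreover have "set ps = x ` {..<4 * K}"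
    unfolding ps_def y_def set_map set_upt
    using bij_betw_imp_surj_on[OF \<sigma>(1)] by (metis image_image lessThan_atLeast0)
  ultimately have "4 * TSPD_speed \<alpha> (x ` {..<4 * K}) \<le>
      (\<Sum>j<4 * K. window_cost \<alpha> (\<lambda>i. ps ! ((j + i) mod (4 * K))))"
    using four_TSPD_le_windows[of ps K \<alpha>] K by (simp add: ps_def)
  also have "\<dots> = (\<Sum>j<4 * K. window_cost \<alpha> (\<lambda>i. y ((j + i) mod (4 * K))))"
    using K by (intro sum.cong refl window_cost_cong) (auto simp: ps_def)
  finally have le: "4 * TSPD_speed \<alpha> (x ` {..<4 * K}) \<le>
    (\<Sum>j<4 * K. window_cost \<alpha> (\<lambda>i. y ((j + i) mod (4 * K))))" .
  show thesis
    using that \<sigma>(1) sw le unfolding y_def by blast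
qed

text \<open>Fallback for badly spread samples: a sweep with a single strip already yields 4 K
  windows of cost at most 8.\<close>

lemma four_TSPD_le_linear:
  fixes x :: "nat \<Rightarrow> point" and K :: nat
  assumes \<alpha>: "\<alpha> \<ge> 1" and K: "K \<ge> 2"
    and sq: "\<And>i. i < 4 * K \<Longrightarrow> x i \<in> unit_square" and inj: "inj_on (\<lambda>i. fst (x i)) {..<4 * K}"
  shows "4 * TSPD_speed \<alpha> (x ` {..<4 * K}) \<le> 32 * K"
proof -
  obtain \<sigma> where \<sigma>: "bij_betw \<sigma> {..<4 * K} {..<4 * K}" "sweep 1 (4 * K) (\<lambda>i. x (\<sigma> i))"
    and le: "4 * TSPD_speed \<alpha> (x ` {..<4 * K}) \<le>
      (\<Sum>j<4 * K. window_cost \<alpha> (\<lambda>i. x (\<sigma> ((j + i) mod (4 * K)))))"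
    using ex_sweep_tour[OF order_refl K sq inj] by blast
  note le
  also have "(\<Sum>j<4 * K. window_cost \<alpha> (\<lambda>i. x (\<sigma> ((j + i) mod (4 * K))))) \<le> (\<Sum>j<4 * K. 8)"
    using K by (intro sum_mono window_cost_le_unit_square \<alpha> sweep.square[OF \<sigma>(2)]) auto
  finally show ?thesis by simp
qed

text \<open>Which end of a strip is its entry and which its exit depends on the parity of the strip;
  stating the hypotheses for the left and right ends avoids this distinction.\<close>

lemma four_TSPD_le_window_sum:
  fixes x :: "nat \<Rightarrow> point" and K :: nat
  assumes \<alpha>: "\<alpha> \<ge> 1" and \<epsilon>: "\<epsilon> \<ge> 0" and m: "m \<ge> 1" and K: "K \<ge> 2"
    and sq: "\<And>i. i < 4 * K \<Longrightarrow> x i \<in> unit_square" and inj: "inj_on (\<lambda>i. fst (x i)) {..<4 * K}"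
    and R: "\<And>s. s < m \<Longrightarrow> card {j\<in>{..<4 * K}. strip m (x j) = int s \<and> fst (x j) \<ge> 1 - \<epsilon>} \<ge> 4"
    and L: "\<And>s. s < m \<Longrightarrow> card {j\<in>{..<4 * K}. strip m (x j) = int s \<and> fst (x j) \<le> \<epsilon>} \<ge> 4"
  shows "4 * TSPD_speed \<alpha> (x ` {..<4 * K}) \<le> window_sum \<alpha> m (4 * K) x + (16 * m * \<epsilon> + 64)"
proof -
  obtain \<sigma> where \<sigma>: "bij_betw \<sigma> {..<4 * K} {..<4 * K}" "sweep m (4 * K) (\<lambda>i. x (\<sigma> i))"
    and le: "4 * TSPD_speed \<alpha> (x ` {..<4 * K}) \<le>
      (\<Sum>j<4 * K. window_cost \<alpha> (\<lambda>i. x (\<sigma> ((j + i) mod (4 * K)))))"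
    using ex_sweep_tour[OF m K sq inj] by blast
  define y where "y = (\<lambda>i. x (\<sigma> i))"
  interpret sweep m "4 * K" y
    using \<sigma>(2) by (simp add: y_def)
  \<comment> \<open>Sorting permutes the indices, so counts over the sorted and the original points
    agree.\<close>
  have card: "card {j\<in>{..<4 * K}. Q (y j)} = card {j\<in>{..<4 * K}. Q (x j)}" for Q
  proof (rule bij_betw_same_card[of \<sigma>])
    show "bij_betw \<sigma> {j\<in>{..<4 * K}. Q (y j)} {j\<in>{..<4 * K}. Q (x j)}"
      using \<sigma>(1) unfolding bij_betw_def y_def
      by (auto simp: inj_on_def set_eq_iff image_iff) (metis image_iff lessThan_iff)
  qed
  have "card {j\<in>{..<4 * K}. strip m (y j) = int s \<and> strip_pos m (y j) \<ge> 1 - \<epsilon>} \<ge> 4"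
    "card {j\<in>{..<4 * K}. strip m (y j) = int s \<and> strip_pos m (y j) \<le> \<epsilon>} \<ge> 4" if "s < m" for s
  proof -
    have "strip m p = int s \<and> strip_pos m p \<ge> 1 - \<epsilon> \<longleftrightarrow> strip m p = int s \<and>
      (if even s then fst p \<ge> 1 - \<epsilon> else fst p \<le> \<epsilon>)"
      "strip m p = int s \<and> strip_pos m p \<le> \<epsilon> \<longleftrightarrow> strip m p = int s \<and>
      (if even s then fst p \<le> \<epsilon> else fst p \<ge> 1 - \<epsilon>)" for p
      by (auto simp: strip_pos_def)
    note eqs = this
    show "card {j\<in>{..<4 * K}. strip m (y j) = int s \<and> strip_pos m (y j) \<ge> 1 - \<epsilon>} \<ge> 4"
      unfolding eqs card[of "\<lambda>p. strip m p = int s \<and> (if even s then fst p \<ge> 1 - \<epsilon> else fst p \<le> \<epsilon>)"]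
      using R[OF that] L[OF that] by (cases "even s") simp_all
    show "card {j\<in>{..<4 * K}. strip m (y j) = int s \<and> strip_pos m (y j) \<le> \<epsilon>} \<ge> 4"
      unfolding eqs card[of "\<lambda>p. strip m p = int s \<and> (if even s then fst p \<le> \<epsilon> else fst p \<ge> 1 - \<epsilon>)"]
      using R[OF that] L[OF that] by (cases "even s") simp_all
  qed
  note mg = this
  have "4 \<le> 4 * K" using K by simp
  from sum_windows_le[OF \<alpha> \<epsilon> this mg] sum_inside_windows_le[OF \<sigma>(1), of x \<alpha>] le
  show ?thesis unfolding y_def by simp
qed

section \<open>Integration over strips\<close>

abbreviation unif_square :: "point measure" where
  "unif_square \<equiv> uniform_measure lborel ({0..1} \<times> {0..1})"

abbreviation unif :: "real measure" where
  "unif \<equiv> uniform_measure lborel {0..1}"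

abbreviation expo :: "real measure" where
  "expo \<equiv> density lborel (\<lambda>x. ennreal (exponential_density 1 x))"

lemma prob_space_unif: "prob_space unif"
  by (rule prob_space_uniform_measure) auto

lemma prob_space_expo: "prob_space expo"
  by (rule prob_space_exponential_density) simp

lemma emeasure_lborel_Times:
  "A \<in> sets borel \<Longrightarrow> B \<in> sets borel \<Longrightarrow>
    emeasure (lborel :: point measure) (A \<times> B) = emeasure lborel A * emeasure lborel B"
  unfolding lborel_prod[symmetric] by (subst lborel.emeasure_pair_measure_Times) auto

lemma emeasure_unit_square: "emeasure (lborel :: point measure) ({0..1} \<times> {0..1}) = 1"
  by (simp add: emeasure_lborel_Times)

lemma prob_space_unif_square: "prob_space unif_square"
  by (rule prob_space_uniform_measure) (simp_all add: emeasure_unit_square)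

lemma nn_integral_unif:
  assumes [measurable]: "f \<in> borel_measurable borel"
  shows "(\<integral>\<^sup>+x. f x \<partial>unif) = (\<integral>\<^sup>+x. f x * indicator {0..1} x \<partial>lborel)"
  by (subst nn_integral_uniform_measure) (auto simp: divide_ennreal_def)

lemma nn_integral_unif_square:
  assumes [measurable]: "f \<in> borel_measurable borel"
  shows "(\<integral>\<^sup>+p. f p \<partial>unif_square) =
    (\<integral>\<^sup>+x. \<integral>\<^sup>+y. f (x, y) * indicator {0..1} x * indicator {0..1} y \<partial>lborel \<partial>lborel)"
proof -
  have [measurable]: "({0..1} \<times> {0..1} :: point set) \<in> sets borel"
    by (intro borel_Times) auto
  have "(\<integral>\<^sup>+p. f p \<partial>unif_square) = (\<integral>\<^sup>+p. f p * indicator ({0..1} \<times> {0..1}) p \<partial>lborel)"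
    by (subst nn_integral_uniform_measure) (auto simp: emeasure_unit_square divide_ennreal_def)
  also have "\<dots> = (\<integral>\<^sup>+p. f p * indicator ({0..1} \<times> {0..1}) p \<partial>(lborel \<Otimes>\<^sub>M lborel))"
    by (simp add: lborel_prod)
  also have "\<dots> = (\<integral>\<^sup>+x. \<integral>\<^sup>+y. f (x, y) * indicator ({0..1} \<times> {0..1}) (x, y) \<partial>lborel \<partial>lborel)"
    by (rule lborel.nn_integral_fst[symmetric]) (simp add: lborel_prod)
  finally show ?thesis by (simp add: indicator_times mult.assoc)
qed

section \<open>Strips in coordinates and the substitution by exponential gaps\<close>

lemma strip_eq_iff:
  "m \<ge> 1 \<Longrightarrow> strip m p = int s \<longleftrightarrow> real s / m \<le> snd p \<and> snd p < (real s + 1) / m"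
  by (auto simp: strip_def floor_eq_iff field_simps)

lemma measurable_strip [measurable]: "strip m \<in> borel \<rightarrow>\<^sub>M count_space UNIV"
  unfolding strip_def[abs_def] by (simp add: borel_prod[symmetric])

lemma unit_square_sets [measurable]: "unit_square \<in> sets borel"
  unfolding unit_square_def by (simp add: borel_Times)

text \<open>Open intervals occur as the gaps that no further point may enter, closed ones as the
  margins at the walls.\<close>

lemma emeasure_strip_box:
  assumes m: "m \<ge> 1" and s: "s < m" and ab: "0 \<le> a" "a \<le> b" "b \<le> 1" and B: "B = {a<..<b} \<or> B = {a..b}"
  shows "emeasure unif_square {p. strip m p = int s \<and> fst p \<in> B} = ennreal ((b - a) / m)"
proof -
  have eq: "{p. strip m p = int s \<and> fst p \<in> B} = B \<times> {real s / m..<(real s + 1) / m}"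
    using strip_eq_iff[OF m] by auto
  have "(real s + 1) / m \<le> 1" using s m by (simp add: field_simps)
  then have sub: "B \<times> {real s / m..<(real s + 1) / m} \<subseteq> {0..1} \<times> {0..1}"
  proof -
    have "0 \<le> y" if "real s / m \<le> y" for y
      by (rule order_trans[OF _ that]) simp
    then have "{real s / m..<(real s + 1) / m} \<subseteq> {0..1}"
      using \<open>(real s + 1) / m \<le> 1\<close> by auto
    then show ?thesis using ab B by (intro Sigma_mono) auto
  qed
  have bm: "B \<in> sets borel" using B by auto
  have "emeasure unif_square (B \<times> {real s / m..<(real s + 1) / m}) =
      emeasure lborel (B \<times> {real s / m..<(real s + 1) / m})"
    using sub bm by (subst emeasure_uniform_measure)
      (simp_all add: emeasure_unit_square divide_ennreal_def Int_absorb1 borel_Times)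
  also have "\<dots> = ennreal (b - a) * ennreal (1 / m)"
  proof -
    have "emeasure lborel B = ennreal (b - a)" using B ab by auto
    moreover have "real s / m \<le> (real s + 1) / m" by (simp add: divide_right_mono)
    then have "emeasure lborel {real s / m..<(real s + 1) / m} = ennreal (1 / m)"
      by (simp add: diff_divide_distrib[symmetric])
    ultimately show ?thesis using bm by (subst emeasure_lborel_Times) simp_all
  qed
  also have "\<dots> = ennreal ((b - a) / m)"
    using ab by (simp add: ennreal_mult[symmetric])
  finally show ?thesis unfolding eq .
qed

lemma nn_integral_strip_height:
  assumes m: "m \<ge> (1::nat)" and [measurable]: "f \<in> borel_measurable borel"
  shows "(\<integral>\<^sup>+y. f y * indicator {real s / m..<(real s + 1) / m} y \<partial>lborel) \<le>
    ennreal (1 / m) * (\<integral>\<^sup>+u. f ((s + u) / m) \<partial>unif)"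
proof -
  have "(\<integral>\<^sup>+y. f y * indicator {real s / m..<(real s + 1) / m} y \<partial>lborel) =
    ennreal \<bar>1 / m\<bar> * (\<integral>\<^sup>+u. f (s / m + 1 / m * u) *
      indicator {real s / m..<(real s + 1) / m} (s / m + 1 / m * u) \<partial>lborel)"
    using m by (intro nn_integral_real_affine) simp_all
  also have "\<dots> \<le> ennreal (1 / m) * (\<integral>\<^sup>+u. f ((s + u) / m) * indicator {0..1} u \<partial>lborel)"
  proof -
    have eq: "s / m + 1 / m * u = (s + u) / m" for u :: real
      by (simp add: add_divide_distrib)
    have "u \<in> {0..1}" if "(s + u) / m \<in> {real s / m..<(real s + 1) / m}" for u :: real
      using that m by (simp add: divide_le_cancel divide_less_cancel)
    then have ind: "indicator {real s / m..<(real s + 1) / m} ((s + u) / m) \<le> (indicator {0..1} u :: ennreal)" for u :: real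
      by (simp add: indicator_def)
    have "\<bar>1 / real m\<bar> = 1 / m" by simp
    then show ?thesis
      unfolding eq by (simp only:) (intro mult_left_mono nn_integral_mono ind zero_le)
  qed
  also have "\<dots> = ennreal (1 / m) * (\<integral>\<^sup>+u. f ((s + u) / m) \<partial>unif)"
    by (subst nn_integral_unif) auto
  finally show ?thesis .
qed

text \<open>The weight \<open>exp z\<close> cancels the exponential density, which leaves Lebesgue
  measure on the half-line.\<close>

lemma nn_integral_expo:
  assumes [measurable]: "f \<in> borel_measurable borel"
  shows "(\<integral>\<^sup>+z. f z * ennreal (exp z) \<partial>expo) = (\<integral>\<^sup>+z. f z * indicator {0..} z \<partial>lborel)"
proof -
  have "ennreal (exponential_density 1 z) * (f z * ennreal (exp z)) = f z * indicator {0..} z" for z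
  proof -
    have "ennreal (exponential_density 1 z) * ennreal (exp z) = indicator {0..} z"
      by (auto simp: exponential_density_def ennreal_mult[symmetric] exp_minus split: split_indicator)
    then show ?thesis by (metis mult.assoc mult.commute)
  qed
  then show ?thesis
    by (subst nn_integral_density) auto
qed

text \<open>Substitution x = a + z / lam. The weight \<open>exp z\<close> is the price of writing a
  Lebesgue integral over \<open>expo\<close>; the probability of an empty gap will pay for
  it.\<close>

lemma nn_integral_beyond:
  assumes lam: "lam > 0" and [measurable]: "f \<in> borel_measurable borel"
  shows "(\<integral>\<^sup>+x. f x * indicator {a<..} x \<partial>lborel) \<le>
    ennreal (1 / lam) * (\<integral>\<^sup>+z. f (a + z / lam) * ennreal (exp z) \<partial>expo)"
proof -
  have "(\<integral>\<^sup>+x. f x * indicator {a<..} x \<partial>lborel) =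
    ennreal \<bar>1 / lam\<bar> * (\<integral>\<^sup>+z. f (a + 1 / lam * z) * indicator {a<..} (a + 1 / lam * z) \<partial>lborel)"
    using lam by (intro nn_integral_real_affine) auto
  also have "\<dots> \<le> ennreal (1 / lam) * (\<integral>\<^sup>+z. f (a + z / lam) * indicator {0..} z \<partial>lborel)"
  proof -
    have eq: "a + 1 / lam * z = a + z / lam" for z by simp
    have ind: "indicator {a<..} (a + z / lam) \<le> (indicator {0..} z :: ennreal)" for z
      using lam by (auto split: split_indicator simp: zero_less_divide_iff)
    have "\<bar>1 / lam\<bar> = 1 / lam" using lam by simp
    then show ?thesis
      unfolding eq by (simp only:) (intro mult_left_mono nn_integral_mono ind zero_le)
  qed
  also have "\<dots> = ennreal (1 / lam) * (\<integral>\<^sup>+z. f (a + z / lam) * ennreal (exp z) \<partial>expo)"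
    by (subst nn_integral_expo) auto
  finally show ?thesis .
qed

text \<open>\<open>unif\<close> carries the Borel sigma-algebra only up to an equality of
  \<open>sets\<close>. This rule and its analogues for \<open>expo\<close> and
  \<open>unif_square\<close> let \<open>measurable\<close> enter iterated integrals.\<close>

lemma borel_measurable_nn_integral_unif [measurable (raw)]:
  assumes "case_prod f \<in> borel_measurable (N \<Otimes>\<^sub>M borel)"
  shows "(\<lambda>x. \<integral>\<^sup>+y. f x y \<partial>unif) \<in> borel_measurable N"
proof -
  interpret prob_space unif by (rule prob_space_unif)
  have "sets (N \<Otimes>\<^sub>M unif) = sets (N \<Otimes>\<^sub>M borel)" by (intro sets_pair_measure_cong) auto
  then show ?thesis
    using assms by (intro borel_measurable_nn_integral) (simp cong: measurable_cong_sets)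
qed

lemma borel_measurable_nn_integral_expo [measurable (raw)]:
  assumes "case_prod f \<in> borel_measurable (N \<Otimes>\<^sub>M borel)"
  shows "(\<lambda>x. \<integral>\<^sup>+y. f x y \<partial>expo) \<in> borel_measurable N"
proof -
  interpret prob_space expo by (rule prob_space_expo)
  have "sets (N \<Otimes>\<^sub>M expo) = sets (N \<Otimes>\<^sub>M borel)" by (intro sets_pair_measure_cong) auto
  then show ?thesis
    using assms by (intro borel_measurable_nn_integral) (simp cong: measurable_cong_sets)
qed

lemma measurable_Pair_point [measurable (raw)]:
  "f \<in> borel_measurable M \<Longrightarrow> g \<in> borel_measurable M \<Longrightarrow> (\<lambda>x. (f x, g x) :: point) \<in> M \<rightarrow>\<^sub>M borel"
  by (simp add: borel_prod[symmetric])

lemma measurable_fst_point [measurable (raw)]: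
  "f \<in> M \<rightarrow>\<^sub>M (borel :: point measure) \<Longrightarrow> (\<lambda>x. fst (f x)) \<in> borel_measurable M"
  by (simp add: borel_prod[symmetric])

lemma nn_integral_strip:
  assumes m: "m \<ge> 1" and [measurable]: "f \<in> borel_measurable borel" "A \<in> sets borel"
  shows "(\<integral>\<^sup>+p. f p * indicator {p. strip m p = int s \<and> fst p \<in> A} p \<partial>unif_square) \<le>
    ennreal (1 / m) * (\<integral>\<^sup>+x. (\<integral>\<^sup>+u. f (x, (s + u) / m) \<partial>unif) * indicator (A \<inter> {0..1}) x \<partial>lborel)"
proof -
  have "{p. strip m p = int s \<and> fst p \<in> A} = A \<times> {real s / m..<(real s + 1) / m}"
    using strip_eq_iff[OF m] by auto
  moreover have "A \<times> {real s / m..<(real s + 1) / m} \<in> sets (borel :: point measure)"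
    by (intro borel_Times) auto
  ultimately have [measurable]: "{p. strip m p = int s \<and> fst p \<in> A} \<in> sets borel" by simp
  have "(\<integral>\<^sup>+p. f p * indicator {p. strip m p = int s \<and> fst p \<in> A} p \<partial>unif_square) =
    (\<integral>\<^sup>+x. \<integral>\<^sup>+y. f (x, y) * indicator {p. strip m p = int s \<and> fst p \<in> A} (x, y) *
      indicator {0..1} x * indicator {0..1} y \<partial>lborel \<partial>lborel)"
    by (rule nn_integral_unif_square) measurable
  also have "\<dots> \<le> (\<integral>\<^sup>+x. (\<integral>\<^sup>+y. f (x, y) * indicator {real s / m..<(real s + 1) / m} y \<partial>lborel) *
      indicator (A \<inter> {0..1}) x \<partial>lborel)"
    using strip_eq_iff[OF m, where s = s]
    by (subst nn_integral_multc[symmetric]) (auto intro!: nn_integral_mono split: split_indicator)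
  also have "\<dots> \<le> (\<integral>\<^sup>+x. ennreal (1 / m) * (\<integral>\<^sup>+u. f (x, (s + u) / m) \<partial>unif) *
      indicator (A \<inter> {0..1}) x \<partial>lborel)"
    by (intro nn_integral_mono mult_right_mono nn_integral_strip_height[OF m]) auto
  also have "\<dots> = ennreal (1 / m) * (\<integral>\<^sup>+x. (\<integral>\<^sup>+u. f (x, (s + u) / m) \<partial>unif) *
      indicator (A \<inter> {0..1}) x \<partial>lborel)"
    unfolding mult.assoc by (rule nn_integral_cmult) measurable
  finally show ?thesis .
qed

lemma nn_integral_strip_first:
  assumes m: "m \<ge> 1" and [measurable]: "f \<in> borel_measurable borel"
  shows "(\<integral>\<^sup>+p. f p * indicator {p. strip m p = int s} p \<partial>unif_square) \<le>
    ennreal (1 / m) * (\<integral>\<^sup>+x. \<integral>\<^sup>+u. f (x, (s + u) / m) \<partial>unif \<partial>unif)"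
  using nn_integral_strip[OF m, of f UNIV s] by (subst nn_integral_unif) simp_all

lemma nn_integral_strip_step:
  assumes m: "m \<ge> 1" and lam: "lam > 0" and [measurable]: "f \<in> borel_measurable borel"
  shows "(\<integral>\<^sup>+p. f p * indicator {p. strip m p = int s \<and> a < fst p} p \<partial>unif_square) \<le>
    ennreal (1 / (lam * m)) *
      (\<integral>\<^sup>+z. (\<integral>\<^sup>+u. f (a + z / lam, (s + u) / m) \<partial>unif) * ennreal (exp z) \<partial>expo)"
proof -
  have "(\<integral>\<^sup>+p. f p * indicator {p. strip m p = int s \<and> a < fst p} p \<partial>unif_square) \<le>
    ennreal (1 / m) * (\<integral>\<^sup>+x. (\<integral>\<^sup>+u. f (x, (s + u) / m) \<partial>unif) * indicator ({a<..} \<inter> {0..1}) x \<partial>lborel)"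
    using nn_integral_strip[OF m, of f "{a<..}" s] by simp
  \<comment> \<open>The walls are dropped, which can only enlarge the integral, so that the gap
    ranges over a whole half-line.\<close>
  also have "\<dots> \<le> ennreal (1 / m) *
      (\<integral>\<^sup>+x. (\<integral>\<^sup>+u. f (x, (s + u) / m) \<partial>unif) * indicator {a<..} x \<partial>lborel)"
    by (intro mult_left_mono nn_integral_mono) (auto split: split_indicator)
  also have "\<dots> \<le> ennreal (1 / m) * (ennreal (1 / lam) *
      (\<integral>\<^sup>+z. (\<integral>\<^sup>+u. f (a + z / lam, (s + u) / m) \<partial>unif) * ennreal (exp z) \<partial>expo))"
    by (intro mult_left_mono nn_integral_beyond[OF lam]) auto
  also have "\<dots> = ennreal (1 / (lam * m)) *
      (\<integral>\<^sup>+z. (\<integral>\<^sup>+u. f (a + z / lam, (s + u) / m) \<partial>unif) * ennreal (exp z) \<partial>expo)"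
    using lam by (simp add: mult.assoc[symmetric] ennreal_mult[symmetric] mult.commute)
  finally show ?thesis .
qed

section \<open>Measurability and scaling of the block minimum\<close>

lemma borel_measurable_block_min [measurable (raw)]:
  assumes "\<And>i j. (\<lambda>w. l w i j) \<in> borel_measurable N"
  shows "(\<lambda>w. block_min \<alpha> (l w)) \<in> borel_measurable N"
proof -
  note [measurable] = assms
  have T: "(\<lambda>w. Tri \<alpha> (l w) i j k) \<in> borel_measurable N" for i j k
    unfolding Tri_def by measurable
  have Q: "(\<lambda>w. Quin \<alpha> (l w) i a b j k) \<in> borel_measurable N" for i a b j k
    unfolding Quin_def by measurable
  show ?thesis
    unfolding block_min_def
    by (simp only: Min_insert Min_singleton finite.intros insert_not_empty not_False_eq_True)
      (intro borel_measurable_min borel_measurable_add T Q)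
qed

lemma borel_measurable_window_cost [measurable (raw)]:
  fixes p :: "'c \<Rightarrow> nat \<Rightarrow> point"
  assumes "\<And>i. (\<lambda>w. p w i) \<in> borel_measurable N"
  shows "(\<lambda>w. window_cost \<alpha> (p w)) \<in> borel_measurable N"
proof -
  note [measurable] = assms
  show ?thesis unfolding window_cost_def by measurable
qed

text \<open>Every pattern is built from distances by sums, maxima and the positive factor 1 /
  \<alpha>, hence is monotone and positively homogeneous in them.\<close>

lemma block_min_scale_le:
  assumes c: "c \<ge> 0" and \<alpha>: "\<alpha> \<ge> 1" and le: "\<And>i j. l' i j \<le> c * l i j"
  shows "block_min \<alpha> l' \<le> c * block_min \<alpha> l"
proof -
  have T: "Tri \<alpha> l' i j k \<le> c * Tri \<alpha> l i j k" for i j k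
  proof -
    have "1 / \<alpha> * (l' i k + l' k j) \<le> 1 / \<alpha> * (c * l i k + c * l k j)"
      using \<alpha> le by (intro mult_left_mono add_mono) auto
    also have "\<dots> = c * (1 / \<alpha> * (l i k + l k j))" by (simp add: algebra_simps)
    also have "\<dots> \<le> c * Tri \<alpha> l i j k"
      unfolding Tri_def using c by (intro mult_left_mono) auto
    finally have "1 / \<alpha> * (l' i k + l' k j) \<le> c * Tri \<alpha> l i j k" .
    moreover have "l' i j \<le> c * Tri \<alpha> l i j k"
      unfolding Tri_def using c by (intro order_trans[OF le] mult_left_mono) auto
    ultimately show ?thesis unfolding Tri_def[of \<alpha> l'] by simp
  qed
  have Q: "Quin \<alpha> l' i a b j k \<le> c * Quin \<alpha> l i a b j k" for i a b j k
  proof -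
    have "1 / \<alpha> * (l' i k + l' k j) \<le> 1 / \<alpha> * (c * l i k + c * l k j)"
      using \<alpha> le by (intro mult_left_mono add_mono) auto
    also have "\<dots> = c * (1 / \<alpha> * (l i k + l k j))" by (simp add: algebra_simps)
    also have "\<dots> \<le> c * Quin \<alpha> l i a b j k"
      unfolding Quin_def using c by (intro mult_left_mono) auto
    finally have "1 / \<alpha> * (l' i k + l' k j) \<le> c * Quin \<alpha> l i a b j k" .
    moreover have "l' i a + l' a b + l' b j \<le> c * (l i a + l a b + l b j)"
      using le[of i a] le[of a b] le[of b j] by (simp add: algebra_simps)
    then have "l' i a + l' a b + l' b j \<le> c * Quin \<alpha> l i a b j k"
      unfolding Quin_def using c by (elim order_trans) (intro mult_left_mono, auto)
    ultimately show ?thesis unfolding Quin_def[of \<alpha> l'] by simp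
  qed
  have TT: "Tri \<alpha> l' i j k + Tri \<alpha> l' i' j' k' \<le> c * (Tri \<alpha> l i j k + Tri \<alpha> l i' j' k')" for i j k i' j' k'
    using add_mono[OF T T] by (simp add: distrib_left)
  have le': "block_min \<alpha> l' \<le> c * t"
    if "t \<in> {Tri \<alpha> l 0 1 2 + Tri \<alpha> l 1 4 3, Tri \<alpha> l 0 1 3 + Tri \<alpha> l 1 4 2,
      Tri \<alpha> l 0 2 1 + Tri \<alpha> l 2 4 3, Tri \<alpha> l 0 2 3 + Tri \<alpha> l 2 4 1,
      Tri \<alpha> l 0 3 1 + Tri \<alpha> l 3 4 2, Tri \<alpha> l 0 3 2 + Tri \<alpha> l 3 4 1,
      Quin \<alpha> l 0 1 3 4 2, Quin \<alpha> l 0 3 1 4 2, Quin \<alpha> l 0 1 2 4 3,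
      Quin \<alpha> l 0 2 1 4 3, Quin \<alpha> l 0 2 3 4 1, Quin \<alpha> l 0 3 2 4 1}" for t
    using that unfolding insert_iff empty_iff
    by (elim disjE FalseE; hypsubst) (rule order_trans[OF _ TT] order_trans[OF _ Q], rule block_min_le)+
  show ?thesis by (rule le'[OF block_min_in])
qed

text \<open>After multiplication by \<open>lam\<close> the horizontal displacement is that of
  \<open>W\<close>, and the vertical one is \<open>lam / m\<close> times the difference of heights.
  The hypothesis \<open>lam \<le> h\<^sup>2 * m\<close> bounds this factor by
  \<open>h\<^sup>2\<close>, which is the origin of \<open>h ^ 4\<close> under the root in
  \<open>L\<close>.\<close>

lemma window_cost_le_block_min:
  assumes lam: "lam > 0" "lam \<le> h\<^sup>2 * m" and m: "m \<ge> (1::nat)" and \<alpha>: "\<alpha> \<ge> 1"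
  shows "window_cost \<alpha> (\<lambda>k. (x + W z k / lam, (s + u k) / m)) \<le> 1 / lam * block_min \<alpha> (L h z u)"
  unfolding window_cost_def
proof (rule block_min_scale_le)
  fix i j
  define a b where "a = W z j - W z i" and "b = u i - u j"
  have "norm ((x + W z i / lam, (s + u i) / m) - (x + W z j / lam, (s + u j) / m)) =
      sqrt ((a / lam)\<^sup>2 + (b / m)\<^sup>2)"
  proof -
    have "(x + W z i / lam) - (x + W z j / lam) = - (a / lam)"
      "(s + u i) / m - (s + u j) / m = b / m"
      by (simp_all add: a_def b_def diff_divide_distrib add_divide_distrib)
    then show ?thesis by (simp only: norm_prod_def fst_diff snd_diff fst_conv snd_conv) (simp add: power_divide)
  qed
  also have "\<dots> \<le> sqrt ((a\<^sup>2 + h ^ 4 * b\<^sup>2) / lam\<^sup>2)"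
  proof (rule real_sqrt_le_mono)
    have "lam\<^sup>2 \<le> (h\<^sup>2 * m)\<^sup>2" using lam by (intro power_mono) auto
    then have "(lam / m)\<^sup>2 \<le> h ^ 4"
      using m by (simp add: power_divide power_mult_distrib divide_le_eq flip: power_mult)
    then have "(lam / m)\<^sup>2 * b\<^sup>2 / lam\<^sup>2 \<le> h ^ 4 * b\<^sup>2 / lam\<^sup>2"
      by (intro divide_right_mono mult_right_mono) auto
    moreover have "(lam / m)\<^sup>2 * b\<^sup>2 / lam\<^sup>2 = (b / m)\<^sup>2"
      using lam by (simp add: power_divide)
    ultimately show "(a / lam)\<^sup>2 + (b / m)\<^sup>2 \<le> (a\<^sup>2 + h ^ 4 * b\<^sup>2) / lam\<^sup>2"
      by (simp add: add_divide_distrib power_divide)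
  qed
  also have "\<dots> = 1 / lam * L h z u i j"
    using lam by (simp add: L_def a_def b_def real_sqrt_divide)
  finally show "norm ((x + W z i / lam, (s + u i) / m) - (x + W z j / lam, (s + u j) / m))
    \<le> 1 / lam * L h z u i j" .
qed (use lam \<alpha> in auto)

text \<open>The exponential weight bounds the probability that no further point falls between \<open>v\<close> and \<open>p\<close>;
  it cancels the factor \<open>exp z\<close> that appears in \<open>nn_integral_strip_step\<close>.\<close>

definition step_kernel :: "nat \<Rightarrow> nat \<Rightarrow> real \<Rightarrow> point \<Rightarrow> point \<Rightarrow> ennreal" where
  "step_kernel m s lam v p =
    ennreal (exp (- (lam * (fst p - fst v)))) * indicator {p. strip m p = int s \<and> fst v < fst p} p"

text \<open>One layer of the iterated integral. The form \<open>g p \<le> c * F p\<close> lets the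
  bound for the inner layers be plugged in with their constants collected in \<open>c\<close>, and
  measurability is asked of the explicit function \<open>F\<close> rather than of the inner integral
  \<open>g\<close>.\<close>

lemma nn_integral_step_kernel:
  assumes m: "m \<ge> 1" and lam: "lam > 0" and [measurable]: "F \<in> borel_measurable borel"
    and g: "\<And>p. g p \<le> c * F p"
  shows "(\<integral>\<^sup>+p. g p * step_kernel m s lam v p \<partial>unif_square) \<le>
    ennreal (1 / (lam * m)) * c * (\<integral>\<^sup>+z. \<integral>\<^sup>+u. F (fst v + z / lam, (s + u) / m) \<partial>unif \<partial>expo)"
proof -
  let ?f = "\<lambda>p. c * F p * ennreal (exp (- (lam * (fst p - fst v))))"
  have "(\<integral>\<^sup>+p. g p * step_kernel m s lam v p \<partial>unif_square) \<le>
    (\<integral>\<^sup>+p. ?f p * indicator {p. strip m p = int s \<and> fst v < fst p} p \<partial>unif_square)"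
    unfolding step_kernel_def mult.assoc[symmetric]
    by (intro nn_integral_mono mult_right_mono g) auto
  also have "\<dots> \<le> ennreal (1 / (lam * m)) *
      (\<integral>\<^sup>+z. (\<integral>\<^sup>+u. ?f (fst v + z / lam, (s + u) / m) \<partial>unif) * ennreal (exp z) \<partial>expo)"
    by (intro nn_integral_strip_step m lam) measurable
  also have "(\<integral>\<^sup>+z. (\<integral>\<^sup>+u. ?f (fst v + z / lam, (s + u) / m) \<partial>unif) * ennreal (exp z) \<partial>expo) =
      (\<integral>\<^sup>+z. c * (\<integral>\<^sup>+u. F (fst v + z / lam, (s + u) / m) \<partial>unif) \<partial>expo)"
  proof (intro nn_integral_cong)
    fix z
    have "(\<integral>\<^sup>+u. ?f (fst v + z / lam, (s + u) / m) \<partial>unif) =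
      (\<integral>\<^sup>+u. (c * ennreal (exp (- z))) * F (fst v + z / lam, (s + u) / m) \<partial>unif)"
      using lam by (simp add: mult_ac)
    also have "\<dots> = (c * ennreal (exp (- z))) * (\<integral>\<^sup>+u. F (fst v + z / lam, (s + u) / m) \<partial>unif)"
      by (rule nn_integral_cmult) measurable
    also have "\<dots> * ennreal (exp z) =
      c * (\<integral>\<^sup>+u. F (fst v + z / lam, (s + u) / m) \<partial>unif) * (ennreal (exp (- z)) * ennreal (exp z))"
      by (simp add: mult_ac)
    also have "ennreal (exp (- z)) * ennreal (exp z) = 1"
      by (simp add: ennreal_mult[symmetric] exp_minus)
    finally show "(\<integral>\<^sup>+u. ?f (fst v + z / lam, (s + u) / m) \<partial>unif) * ennreal (exp z) =
      c * (\<integral>\<^sup>+u. F (fst v + z / lam, (s + u) / m) \<partial>unif)" by simp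
  qed
  also have "\<dots> = c * (\<integral>\<^sup>+z. \<integral>\<^sup>+u. F (fst v + z / lam, (s + u) / m) \<partial>unif \<partial>expo)"
    by (rule nn_integral_cmult) measurable
  finally show ?thesis by (simp add: mult.assoc)
qed

text \<open>Separate arguments instead of a sequence suit iterated integration, which treats one
  point at a time.\<close>

definition cost5 :: "real \<Rightarrow> point \<Rightarrow> point \<Rightarrow> point \<Rightarrow> point \<Rightarrow> point \<Rightarrow> ennreal" where
  "cost5 \<alpha> v0 v1 v2 v3 v4 = ennreal (window_cost \<alpha> (\<lambda>k. if k = 0 then v0 else if k = 1 then v1
     else if k = 2 then v2 else if k = 3 then v3 else v4))"

lemma borel_measurable_cost5 [measurable (raw)]:
  assumes [measurable]: "f0 \<in> borel_measurable N" "f1 \<in> borel_measurable N" "f2 \<in> borel_measurable N"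
    "f3 \<in> borel_measurable N" "f4 \<in> borel_measurable N"
  shows "(\<lambda>w. cost5 \<alpha> (f0 w) (f1 w) (f2 w) (f3 w) (f4 w)) \<in> borel_measurable N"
  unfolding cost5_def by measurable

definition block5 :: "real \<Rightarrow> real \<Rightarrow> real \<Rightarrow> real \<Rightarrow> real \<Rightarrow> real \<Rightarrow> real \<Rightarrow> real \<Rightarrow> real \<Rightarrow> real \<Rightarrow> real \<Rightarrow> ennreal" where
  "block5 \<alpha> h u0 z1 u1 z2 u2 z3 u3 z4 u4 = ennreal (block_min \<alpha> (L h
     (\<lambda>k. if k = 1 then z1 else if k = 2 then z2 else if k = 3 then z3 else z4)
     (\<lambda>k. if k = 0 then u0 else if k = 1 then u1 else if k = 2 then u2 else if k = 3 then u3 else u4)))"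

text \<open>The expectation of M, written as an iterated integral with values in
  \<open>ennreal\<close> so that it makes sense before integrability is known;
  \<open>nn_integral_block_min\<close> makes the identification.\<close>

definition block_integral :: "real \<Rightarrow> real \<Rightarrow> ennreal" where
  "block_integral \<alpha> h = (\<integral>\<^sup>+u0. \<integral>\<^sup>+z1. \<integral>\<^sup>+u1. \<integral>\<^sup>+z2. \<integral>\<^sup>+u2. \<integral>\<^sup>+z3. \<integral>\<^sup>+u3. \<integral>\<^sup>+z4. \<integral>\<^sup>+u4.
     block5 \<alpha> h u0 z1 u1 z2 u2 z3 u3 z4 u4
     \<partial>unif \<partial>expo \<partial>unif \<partial>expo \<partial>unif \<partial>expo \<partial>unif \<partial>expo \<partial>unif)"

lemma borel_measurable_W [measurable (raw)]:
  assumes "\<And>i. (\<lambda>w. z w i) \<in> borel_measurable N"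
  shows "(\<lambda>w. W (z w) k) \<in> borel_measurable N"
  unfolding W_def using assms by measurable

lemma borel_measurable_L [measurable (raw)]:
  assumes [measurable]: "\<And>i. (\<lambda>w. z w i) \<in> borel_measurable N" "\<And>i. (\<lambda>w. u w i) \<in> borel_measurable N"
  shows "(\<lambda>w. L h (z w) (u w) i j) \<in> borel_measurable N"
  unfolding L_def by measurable

lemma borel_measurable_block5 [measurable (raw)]:
  assumes [measurable]: "f0 \<in> borel_measurable N" "f1 \<in> borel_measurable N" "f2 \<in> borel_measurable N"
    "f3 \<in> borel_measurable N" "f4 \<in> borel_measurable N" "f5 \<in> borel_measurable N" "f6 \<in> borel_measurable N"
    "f7 \<in> borel_measurable N" "f8 \<in> borel_measurable N"
  shows "(\<lambda>w. block5 \<alpha> h (f0 w) (f1 w) (f2 w) (f3 w) (f4 w) (f5 w) (f6 w) (f7 w) (f8 w)) \<in> borel_measurable N"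
  unfolding block5_def by measurable

lemma cost5_le_block5:
  assumes lam: "lam > 0" "lam \<le> h\<^sup>2 * m" and m: "m \<ge> (1::nat)" and \<alpha>: "\<alpha> \<ge> 1"
  shows "cost5 \<alpha> (x, (s + u0) / m) (x + z1 / lam, (s + u1) / m) (x + z1 / lam + z2 / lam, (s + u2) / m)
      (x + z1 / lam + z2 / lam + z3 / lam, (s + u3) / m)
      (x + z1 / lam + z2 / lam + z3 / lam + z4 / lam, (s + u4) / m)
    \<le> ennreal (1 / lam) * block5 \<alpha> h u0 z1 u1 z2 u2 z3 u3 z4 u4"
proof -
  let ?z = "\<lambda>k::nat. if k = 1 then z1 else if k = 2 then z2 else if k = 3 then z3 else z4"
  let ?u = "\<lambda>k::nat. if k = 0 then u0 else if k = 1 then u1 else if k = 2 then u2 else if k = 3 then u3 else u4"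
  have W: "W ?z 0 = 0" "W ?z 1 = z1" "W ?z 2 = z1 + z2" "W ?z 3 = z1 + z2 + z3" "W ?z 4 = z1 + z2 + z3 + z4"
    by (simp_all add: W_def numeral_eq_Suc)
  have "cost5 \<alpha> (x, (s + u0) / m) (x + z1 / lam, (s + u1) / m) (x + z1 / lam + z2 / lam, (s + u2) / m)
      (x + z1 / lam + z2 / lam + z3 / lam, (s + u3) / m)
      (x + z1 / lam + z2 / lam + z3 / lam + z4 / lam, (s + u4) / m) =
      ennreal (window_cost \<alpha> (\<lambda>k. (x + W ?z k / lam, (s + ?u k) / m)))"
    unfolding cost5_def
  proof (intro arg_cong[where f = ennreal] window_cost_cong)
    fix i :: nat assume "i \<le> 4"
    then consider "i = 0" | "i = 1" | "i = 2" | "i = 3" | "i = 4" by linarith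
    then show "(if i = 0 then (x, (s + u0) / m) else if i = 1 then (x + z1 / lam, (s + u1) / m)
      else if i = 2 then (x + z1 / lam + z2 / lam, (s + u2) / m)
      else if i = 3 then (x + z1 / lam + z2 / lam + z3 / lam, (s + u3) / m)
      else (x + z1 / lam + z2 / lam + z3 / lam + z4 / lam, (s + u4) / m)) =
      (x + W ?z i / lam, (s + ?u i) / m)"
      using W by cases (simp_all add: add_divide_distrib)
  qed
  also have "\<dots> \<le> ennreal (1 / lam * block_min \<alpha> (L h ?z ?u))"
    by (intro ennreal_leI window_cost_le_block_min lam m \<alpha>)
  also have "\<dots> = ennreal (1 / lam) * block5 \<alpha> h u0 z1 u1 z2 u2 z3 u3 z4 u4"
    unfolding block5_def using lam by (intro ennreal_mult block_min_nonneg) (auto simp: L_def)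
  finally show ?thesis .
qed

text \<open>The four kernels give \<open>(1 / (lam * m)) ^ 4\<close>. The fifth factor is composed
  of 1 / m, the height of the strip that holds the first point, and of 1 / lam, the scale of the
  cost.\<close>

lemma nested_strip_integral_le:
  fixes s :: nat
  assumes lam: "lam > 0" "lam \<le> h\<^sup>2 * m" and m: "m \<ge> (1::nat)" and \<alpha>: "\<alpha> \<ge> 1"
  defines "K \<equiv> step_kernel m s lam"
  shows "(\<integral>\<^sup>+v0. (\<integral>\<^sup>+v1. (\<integral>\<^sup>+v2. (\<integral>\<^sup>+v3. (\<integral>\<^sup>+v4. cost5 \<alpha> v0 v1 v2 v3 v4 * K v3 v4
      \<partial>unif_square) * K v2 v3 \<partial>unif_square) * K v1 v2 \<partial>unif_square) * K v0 v1 \<partial>unif_square)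
      * indicator {p. strip m p = int s} v0 \<partial>unif_square)
    \<le> ennreal (1 / (lam * m) ^ 5) * block_integral \<alpha> h"
proof -
  let ?c = "ennreal (1 / (lam * m))"
  let ?P = "\<lambda>v z u. (fst v + z / lam, (real s + u) / real m) :: point"
  define S4 where "S4 = (\<lambda>v0 v1 v2 v3. \<integral>\<^sup>+z4. \<integral>\<^sup>+u4. cost5 \<alpha> v0 v1 v2 v3 (?P v3 z4 u4) \<partial>unif \<partial>expo)"
  define S3 where "S3 = (\<lambda>v0 v1 v2. \<integral>\<^sup>+z3. \<integral>\<^sup>+u3. S4 v0 v1 v2 (?P v2 z3 u3) \<partial>unif \<partial>expo)"
  define S2 where "S2 = (\<lambda>v0 v1. \<integral>\<^sup>+z2. \<integral>\<^sup>+u2. S3 v0 v1 (?P v1 z2 u2) \<partial>unif \<partial>expo)"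
  define S1 where "S1 = (\<lambda>v0. \<integral>\<^sup>+z1. \<integral>\<^sup>+u1. S2 v0 (?P v0 z1 u1) \<partial>unif \<partial>expo)"
  \<comment> \<open>The layers are peeled from the inside. Each replaces a point by its predecessor
    shifted by a scaled exponential gap, at a uniform height, and contributes one factor
    \<open>?c\<close>.\<close>
  have L4: "(\<integral>\<^sup>+v4. cost5 \<alpha> v0 v1 v2 v3 v4 * K v3 v4 \<partial>unif_square) \<le> ?c * 1 * S4 v0 v1 v2 v3" for v0 v1 v2 v3
    unfolding K_def S4_def by (intro nn_integral_step_kernel m lam) simp_all
  have L3: "(\<integral>\<^sup>+v3. (\<integral>\<^sup>+v4. cost5 \<alpha> v0 v1 v2 v3 v4 * K v3 v4 \<partial>unif_square) * K v2 v3 \<partial>unif_square)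
      \<le> ?c * (?c * 1) * S3 v0 v1 v2" for v0 v1 v2
    unfolding S3_def K_def
    by (intro nn_integral_step_kernel m lam L4[unfolded K_def]) (unfold S4_def, measurable)
  have L2: "(\<integral>\<^sup>+v2. (\<integral>\<^sup>+v3. (\<integral>\<^sup>+v4. cost5 \<alpha> v0 v1 v2 v3 v4 * K v3 v4 \<partial>unif_square) * K v2 v3 \<partial>unif_square)
      * K v1 v2 \<partial>unif_square) \<le> ?c * (?c * (?c * 1)) * S2 v0 v1" for v0 v1
    unfolding S2_def K_def
    by (intro nn_integral_step_kernel m lam L3[unfolded K_def]) (unfold S4_def S3_def, measurable)
  have L1: "(\<integral>\<^sup>+v1. (\<integral>\<^sup>+v2. (\<integral>\<^sup>+v3. (\<integral>\<^sup>+v4. cost5 \<alpha> v0 v1 v2 v3 v4 * K v3 v4 \<partial>unif_square) * K v2 v3 \<partial>unif_square)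
      * K v1 v2 \<partial>unif_square) * K v0 v1 \<partial>unif_square) \<le> ?c * (?c * (?c * (?c * 1))) * S1 v0" for v0
    unfolding S1_def K_def
    by (intro nn_integral_step_kernel m lam L2[unfolded K_def]) (unfold S4_def S3_def S2_def, measurable)
  let ?c4 = "?c * (?c * (?c * (?c * 1)))"
  have [measurable]: "S1 \<in> borel_measurable borel"
    unfolding S1_def S2_def S3_def S4_def by measurable
  have "(\<integral>\<^sup>+v0. (\<integral>\<^sup>+v1. (\<integral>\<^sup>+v2. (\<integral>\<^sup>+v3. (\<integral>\<^sup>+v4. cost5 \<alpha> v0 v1 v2 v3 v4 * K v3 v4
      \<partial>unif_square) * K v2 v3 \<partial>unif_square) * K v1 v2 \<partial>unif_square) * K v0 v1 \<partial>unif_square)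
      * indicator {p. strip m p = int s} v0 \<partial>unif_square) \<le>
      (\<integral>\<^sup>+v0. ?c4 * S1 v0 * indicator {p. strip m p = int s} v0 \<partial>unif_square)"
    by (intro nn_integral_mono mult_right_mono L1) simp
  also have "\<dots> \<le> ennreal (1 / m) * (\<integral>\<^sup>+x. \<integral>\<^sup>+u. ?c4 * S1 (x, (s + u) / m) \<partial>unif \<partial>unif)"
    by (intro nn_integral_strip_first m) measurable
  also have "\<dots> \<le> ennreal (1 / m) * (\<integral>\<^sup>+x. ?c4 * (ennreal (1 / lam) * block_integral \<alpha> h) \<partial>unif)"
  proof (intro mult_left_mono nn_integral_mono zero_le)
    fix x :: real
    have "(\<integral>\<^sup>+u. ?c4 * S1 (x, (s + u) / m) \<partial>unif) = ?c4 * (\<integral>\<^sup>+u. S1 (x, (s + u) / m) \<partial>unif)"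
      by (rule nn_integral_cmult) measurable
    moreover have "(\<integral>\<^sup>+u. S1 (x, (s + u) / m) \<partial>unif) \<le> ennreal (1 / lam) * block_integral \<alpha> h"
    proof -
      have "(\<integral>\<^sup>+u. S1 (x, (s + u) / m) \<partial>unif) \<le> 
        (\<integral>\<^sup>+u0. \<integral>\<^sup>+z1. \<integral>\<^sup>+u1. \<integral>\<^sup>+z2. \<integral>\<^sup>+u2. \<integral>\<^sup>+z3. \<integral>\<^sup>+u3. \<integral>\<^sup>+z4. \<integral>\<^sup>+u4.
           ennreal (1 / lam) * block5 \<alpha> h u0 z1 u1 z2 u2 z3 u3 z4 u4
           \<partial>unif \<partial>expo \<partial>unif \<partial>expo \<partial>unif \<partial>expo \<partial>unif \<partial>expo \<partial>unif)"
        unfolding S1_def S2_def S3_def S4_def fst_conv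
        by (intro nn_integral_mono cost5_le_block5 lam m \<alpha>)
      also have "\<dots> = ennreal (1 / lam) * block_integral \<alpha> h"
        unfolding block_integral_def by (simp add: nn_integral_cmult)
      finally show ?thesis .
    qed
    ultimately show "(\<integral>\<^sup>+u. ?c4 * S1 (x, (s + u) / m) \<partial>unif) \<le> ?c4 * (ennreal (1 / lam) * block_integral \<alpha> h)"
      by (simp add: mult_left_mono)
  qed
  also have "\<dots> = ennreal (1 / m) * (?c4 * (ennreal (1 / lam) * block_integral \<alpha> h))"
    using prob_space.emeasure_space_1[OF prob_space_unif] by simp
  also have "\<dots> = ennreal (1 / (lam * m) ^ 5) * block_integral \<alpha> h"
  proof -
    have "ennreal (1 / m) * (?c4 * ennreal (1 / lam)) = ennreal (1 / (lam * m) ^ 5)"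
      using lam m by (simp add: ennreal_mult[symmetric] power_numeral_reduce mult_ac numeral_eq_Suc)
    then show ?thesis by (metis mult.assoc)
  qed
  finally show ?thesis .
qed

section \<open>The expected sum over the windows inside a strip\<close>

text \<open>On points of increasing abscissa the kernels multiply to \<open>exp (- lam * d)\<close>,
  where d is the horizontal extent of the tuple. Split into gaps, each factor depends on two
  neighbours only.\<close>

definition strip5 :: "real \<Rightarrow> nat \<Rightarrow> nat \<Rightarrow> real \<Rightarrow> point \<Rightarrow> point \<Rightarrow> point \<Rightarrow> point \<Rightarrow> point \<Rightarrow> ennreal" where
  "strip5 \<alpha> m s lam v0 v1 v2 v3 v4 = cost5 \<alpha> v0 v1 v2 v3 v4 * step_kernel m s lam v3 v4 *
     step_kernel m s lam v2 v3 * step_kernel m s lam v1 v2 * step_kernel m s lam v0 v1 *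
     indicator {p. strip m p = int s} v0"

lemma borel_measurable_indicator_strip [measurable (raw)]:
  assumes [measurable]: "f \<in> N \<rightarrow>\<^sub>M (borel :: point measure)"
  shows "(\<lambda>w. indicator {p. strip m p = int s} (f w) :: ennreal) \<in> borel_measurable N"
proof -
  have "{p. strip m p = int s} \<in> sets (borel :: point measure)" by measurable
  then show ?thesis by (intro measurable_compose[OF assms borel_measurable_indicator])
qed

lemma borel_measurable_step_kernel [measurable (raw)]:
  assumes [measurable]: "f \<in> N \<rightarrow>\<^sub>M (borel :: point measure)" "g \<in> N \<rightarrow>\<^sub>M (borel :: point measure)"
  shows "(\<lambda>w. step_kernel m s lam (f w) (g w)) \<in> borel_measurable N"
proof -
  have "step_kernel m s lam (f w) (g w) = ennreal (exp (- (lam * (fst (g w) - fst (f w))))) *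
      indicator {p. strip m p = int s} (g w) * (if fst (f w) < fst (g w) then 1 else 0)" for w
    by (simp add: step_kernel_def indicator_def)
  then show ?thesis by simp
qed

lemma borel_measurable_strip5 [measurable (raw)]:
  assumes [measurable]: "f0 \<in> borel_measurable N" "f1 \<in> borel_measurable N" "f2 \<in> borel_measurable N"
    "f3 \<in> borel_measurable N" "f4 \<in> borel_measurable N"
  shows "(\<lambda>w. strip5 \<alpha> m s lam (f0 w) (f1 w) (f2 w) (f3 w) (f4 w)) \<in> borel_measurable N"
  unfolding strip5_def by measurable

lemma measurable_component_unif_square [measurable (raw)]:
  "i \<in> I \<Longrightarrow> (\<lambda>x. x i) \<in> PiM I (\<lambda>_. unif_square) \<rightarrow>\<^sub>M borel"
  using measurable_component_singleton[of i I "\<lambda>_. unif_square"] by (simp cong: measurable_cong_sets)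

lemma borel_measurable_nn_integral_unif_square [measurable (raw)]:
  assumes "case_prod f \<in> borel_measurable (N \<Otimes>\<^sub>M borel)"
  shows "(\<lambda>x. \<integral>\<^sup>+y. f x y \<partial>unif_square) \<in> borel_measurable N"
proof -
  interpret prob_space unif_square by (rule prob_space_unif_square)
  have "sets (N \<Otimes>\<^sub>M unif_square) = sets (N \<Otimes>\<^sub>M borel)" by (intro sets_pair_measure_cong) auto
  then show ?thesis
    using assms by (intro borel_measurable_nn_integral) (simp cong: measurable_cong_sets)
qed

lemma nn_integral_strip5_le:
  assumes lam: "lam > 0" "lam \<le> h\<^sup>2 * m" and m: "m \<ge> (1::nat)" and \<alpha>: "\<alpha> \<ge> 1"
    and d: "distinct [i0, i1, i2, i3, i4]"
  shows "(\<integral>\<^sup>+x. strip5 \<alpha> m s lam (x i0) (x i1) (x i2) (x i3) (x i4)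
      \<partial>PiM {i4, i3, i2, i1, i0} (\<lambda>_. unif_square))
    \<le> ennreal (1 / (lam * m) ^ 5) * block_integral \<alpha> h"
proof -
  interpret product_prob_space "\<lambda>_. unif_square"
    by (intro product_prob_spaceI prob_space_unif_square)
  have d: "i4 \<notin> {i3, i2, i1, i0}" "i3 \<notin> {i2, i1, i0}" "i2 \<notin> {i1, i0}" "i1 \<notin> {i0}"
    "i0 \<noteq> i1" "i0 \<noteq> i2" "i0 \<noteq> i3" "i0 \<noteq> i4" "i1 \<noteq> i2" "i1 \<noteq> i3" "i1 \<noteq> i4"
    "i2 \<noteq> i3" "i2 \<noteq> i4" "i3 \<noteq> i4"
    using d by auto
  let ?H = "strip5 \<alpha> m s lam" and ?M = "\<lambda>_. unif_square"
  have "(\<integral>\<^sup>+x. ?H (x i0) (x i1) (x i2) (x i3) (x i4) \<partial>PiM {i4, i3, i2, i1, i0} ?M) =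
    (\<integral>\<^sup>+x. \<integral>\<^sup>+v4. ?H (x i0) (x i1) (x i2) (x i3) v4 \<partial>unif_square \<partial>PiM {i3, i2, i1, i0} ?M)"
    using d by (subst product_nn_integral_insert) (simp_all, measurable?)
  also have "\<dots> = (\<integral>\<^sup>+x. \<integral>\<^sup>+v3. \<integral>\<^sup>+v4. ?H (x i0) (x i1) (x i2) v3 v4
      \<partial>unif_square \<partial>unif_square \<partial>PiM {i2, i1, i0} ?M)"
    using d by (subst product_nn_integral_insert) (simp_all, measurable?)
  also have "\<dots> = (\<integral>\<^sup>+x. \<integral>\<^sup>+v2. \<integral>\<^sup>+v3. \<integral>\<^sup>+v4. ?H (x i0) (x i1) v2 v3 v4
      \<partial>unif_square \<partial>unif_square \<partial>unif_square \<partial>PiM {i1, i0} ?M)"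
    using d by (subst product_nn_integral_insert) (simp_all, measurable?)
  also have "\<dots> = (\<integral>\<^sup>+x. \<integral>\<^sup>+v1. \<integral>\<^sup>+v2. \<integral>\<^sup>+v3. \<integral>\<^sup>+v4. ?H (x i0) v1 v2 v3 v4
      \<partial>unif_square \<partial>unif_square \<partial>unif_square \<partial>unif_square \<partial>PiM {i0} ?M)"
    using d by (subst product_nn_integral_insert) (simp_all, measurable?)
  also have "\<dots> = (\<integral>\<^sup>+v0. \<integral>\<^sup>+v1. \<integral>\<^sup>+v2. \<integral>\<^sup>+v3. \<integral>\<^sup>+v4. ?H v0 v1 v2 v3 v4
      \<partial>unif_square \<partial>unif_square \<partial>unif_square \<partial>unif_square \<partial>unif_square)"
    by (rule product_nn_integral_singleton) simp
  also have "\<dots> = (\<integral>\<^sup>+v0. (\<integral>\<^sup>+v1. (\<integral>\<^sup>+v2. (\<integral>\<^sup>+v3. (\<integral>\<^sup>+v4. cost5 \<alpha> v0 v1 v2 v3 v4 *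
      step_kernel m s lam v3 v4
      \<partial>unif_square) * step_kernel m s lam v2 v3 \<partial>unif_square) * step_kernel m s lam v1 v2
      \<partial>unif_square) * step_kernel m s lam v0 v1 \<partial>unif_square)
      * indicator {p. strip m p = int s} v0 \<partial>unif_square)"
    \<comment> \<open>Factors that do not involve an inner point move out of the integral over
      it.\<close>
    unfolding strip5_def by (simp add: nn_integral_multc)
  also have "\<dots> \<le> ennreal (1 / (lam * m) ^ 5) * block_integral \<alpha> h"
    by (intro nested_strip_integral_le lam m \<alpha>)
  finally show ?thesis .
qed

text \<open>The excluded box has area (b - a) / m, and 1 - p \<le> exp (- p).\<close>

lemma nn_integral_outside_le:
  assumes m: "m \<ge> (1::nat)" and s: "s < m" and ab: "0 \<le> a" "a \<le> b" "b \<le> 1"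
  shows "(\<integral>\<^sup>+q. indicator {q. \<not> (strip m q = int s \<and> a < fst q \<and> fst q < b)} q \<partial>unif_square)
    \<le> ennreal (exp (- ((b - a) / m)))"
proof -
  interpret prob_space unif_square by (rule prob_space_unif_square)
  have eq: "{q. \<not> (strip m q = int s \<and> a < fst q \<and> fst q < b)} =
      space unif_square - {p. strip m p = int s \<and> fst p \<in> {a<..<b}}"
    by auto
  have [measurable]: "{p. strip m p = int s \<and> fst p \<in> {a<..<b}} \<in> sets unif_square"
    by simp
  have em: "emeasure unif_square {p. strip m p = int s \<and> fst p \<in> {a<..<b}} = ennreal ((b - a) / m)"
    by (rule emeasure_strip_box[OF m s ab]) simp
  have "(\<integral>\<^sup>+q. indicator {q. \<not> (strip m q = int s \<and> a < fst q \<and> fst q < b)} q \<partial>unif_square) =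
      emeasure unif_square (space unif_square - {p. strip m p = int s \<and> fst p \<in> {a<..<b}})"
    unfolding eq by (rule nn_integral_indicator) measurable
  also have "\<dots> = 1 - ennreal ((b - a) / m)"
    unfolding em[symmetric] emeasure_space_1[symmetric] by (rule emeasure_compl) (simp_all add: em)
  also have "\<dots> = ennreal (1 - (b - a) / m)"
    using ab by (simp add: ennreal_minus flip: ennreal_1)
  also have "\<dots> \<le> ennreal (exp (- ((b - a) / m)))"
    using exp_ge_add_one_self[of "- ((b - a) / m)"] by (intro ennreal_leI) simp
  finally show ?thesis .
qed

section \<open>Null sets: the top edge and vertical lines\<close>

lemma AE_unif_square_unit_square: "AE p in unif_square. p \<in> unit_square"
proof -
  have "emeasure (lborel :: point measure) (UNIV \<times> {1}) = 0"
    by (subst emeasure_lborel_Times) auto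
  then have "UNIV \<times> {1} \<in> null_sets (lborel :: point measure)"
    by (intro null_setsI) (auto intro: borel_Times)
  then have "AE p in (lborel :: point measure). p \<notin> UNIV \<times> {1}"
    by (rule AE_not_in)
  then have "AE p in (lborel :: point measure). p \<in> {0..1} \<times> {0..1} \<longrightarrow> p \<in> unit_square"
    by eventually_elim (auto simp: unit_square_def)
  then show ?thesis
    by (intro AE_uniform_measureI) (auto intro: borel_Times)
qed

lemma emeasure_unif_square_line: "emeasure unif_square {p. fst p = c} = 0"
proof -
  have line: "{p :: point. fst p = c} = {c} \<times> UNIV" by auto
  have sets: "({c} \<times> UNIV :: point set) \<in> sets borel" "({0..1} \<times> {0..1} :: point set) \<in> sets borel"
    by (intro borel_Times; simp)+
  have "emeasure (lborel :: point measure) ({c} \<times> UNIV) = emeasure lborel {c} * emeasure lborel (UNIV :: real set)"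
    by (rule emeasure_lborel_Times) simp_all
  then have "emeasure (lborel :: point measure) ({c} \<times> UNIV) = 0"
    by simp
  then have "emeasure (lborel :: point measure) (({0..1} \<times> {0..1}) \<inter> ({c} \<times> UNIV)) = 0"
    by (rule emeasure_eq_0[rotated]) (use sets in simp_all)
  then show ?thesis
    unfolding line using sets by (subst emeasure_uniform_measure) simp_all
qed

context prob_space
begin

text \<open>With the tuple fixed, the n - 5 other points are integrated first. They are independent
  and each contributes the same factor, and the resulting power is absorbed by the kernels of
  \<open>strip5\<close>.\<close>

lemma consecutive_expectation_le:
  fixes X :: "nat \<Rightarrow> 'a \<Rightarrow> point"
  assumes ind: "indep_vars (\<lambda>_. borel) X UNIV"
    and unif: "\<And>i. distr M borel (X i) = unif_square"
    and t: "t \<in> tuples n" and s: "s < m" and n: "n > 5" and m: "m \<ge> 1" and \<alpha>: "\<alpha> \<ge> 1"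
    and h: "real n - 5 \<le> h\<^sup>2 * (real m)\<^sup>2"
  shows "(\<integral>\<^sup>+\<omega>. ennreal (of_bool (consecutive m n s (\<lambda>i. X i \<omega>) t) * window_cost \<alpha> (\<lambda>k. X (t k) \<omega>)) \<partial>M)
    \<le> ennreal (1 / (real n - 5) ^ 5) * block_integral \<alpha> h"
proof -
  define lam where "lam = (real n - 5) / m"
  have lam: "lam > 0" "lam \<le> h\<^sup>2 * m"
    using n m h by (auto simp: lam_def field_simps power2_eq_square)
  interpret U: product_prob_space "\<lambda>_. unif_square"
    by (intro product_prob_spaceI prob_space_unif_square)
  define I where "I = t ` {..4}"
  define J where "J = {..<n} - I"
  have tI: "t k \<in> I" if "k \<le> 4" for k using that by (auto simp: I_def)
  have tn: "t k < n" if "k \<le> 4" for k using t that by (auto simp: tuples_def)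
  have IJ: "I \<inter> J = {}" "finite I" "finite J" "I \<union> J = {..<n}"
    using tn by (auto simp: I_def J_def)
  have "card I = 5" using t by (simp add: I_def tuples_def card_image)
  then have cardJ: "card J = n - 5"
    using IJ tn by (simp add: J_def card_Diff_subset I_def image_subset_iff)
  have "{..4::nat} = {4, 3, 2, 1, 0}" by auto
  then have I_eq: "I = {t 4, t 3, t 2, t 1, t 0}" unfolding I_def by (simp only: image_insert image_empty)
  have dist: "distinct [t 0, t 1, t 2, t 3, t 4]"
    using t by (auto simp: tuples_def inj_on_eq_iff)
  \<comment> \<open>Having both end points in \<open>unit_square\<close> places the gap inside
    [0, 1], as \<open>nn_integral_outside_le\<close> requires.\<close>
  define Ch where "Ch = (\<lambda>v0 v1 v2 v3 v4 :: point. v0 \<in> unit_square \<and> v4 \<in> unit_square \<and>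
    strip m v0 = int s \<and> strip m v1 = int s \<and> strip m v2 = int s \<and> strip m v3 = int s \<and> strip m v4 = int s \<and>
    fst v0 < fst v1 \<and> fst v1 < fst v2 \<and> fst v2 < fst v3 \<and> fst v3 < fst v4)"
  define A where "A = (\<lambda>x :: nat \<Rightarrow> point. if Ch (x (t 0)) (x (t 1)) (x (t 2)) (x (t 3)) (x (t 4))
    then cost5 \<alpha> (x (t 0)) (x (t 1)) (x (t 2)) (x (t 3)) (x (t 4)) else 0)"
  define B where "B = (\<lambda>(x :: nat \<Rightarrow> point) q. 
    indicator {q. \<not> (strip m q = int s \<and> fst (x (t 0)) < fst q \<and> fst q < fst (x (t 4)))} q :: ennreal)"
  define G where "G = (\<lambda>x. A x * (\<Prod>j\<in>J. B x (x j)))"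
  have rv: "random_variable borel (X i)" for i
    using ind by (simp add: indep_vars_def)
  have dX: "distr M (PiM {..<n} (\<lambda>_. borel)) (\<lambda>\<omega>. \<lambda>i\<in>{..<n}. X i \<omega>) = PiM {..<n} (\<lambda>_. unif_square)"
  proof -
    have "indep_vars (\<lambda>_. borel) X {..<n}" using ind by (rule indep_vars_subset) simp
    then show ?thesis
      using n by (subst (asm) indep_vars_iff_distr_eq_PiM) (auto simp: rv unif lessThan_empty_iff)
  qed
  have Gm: "G \<in> borel_measurable (PiM {..<n} (\<lambda>_. borel))"
  proof -
    have comp [measurable]: "(\<lambda>x. x i) \<in> PiM {..<n} (\<lambda>_. borel) \<rightarrow>\<^sub>M (borel :: point measure)" if "i < n" for i
      using measurable_component_singleton[of i "{..<n}" "\<lambda>_. borel :: point measure"] that by simp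
    have [simp]: "t 0 < n" "t 1 < n" "t (Suc 0) < n" "t 2 < n" "t 3 < n" "t 4 < n"
      using tn[of 0] tn[of 1] tn[of 2] tn[of 3] tn[of 4] by simp_all
    have "A \<in> borel_measurable (PiM {..<n} (\<lambda>_. borel))"
      unfolding A_def Ch_def by measurable
    moreover have "(\<lambda>x. B x (x j)) \<in> borel_measurable (PiM {..<n} (\<lambda>_. borel))" if "j \<in> J" for j
    proof -
      have [simp]: "j < n" using that by (simp add: J_def)
      have "B x (x j) = (if strip m (x j) = int s \<and> fst (x (t 0)) < fst (x j) \<and> fst (x j) < fst (x (t 4))
        then 0 else 1)" for x
        by (simp add: B_def indicator_def)
      then show ?thesis by simp
    qed
    ultimately show ?thesis
      unfolding G_def by (intro borel_measurable_times_ennreal borel_measurable_prod_ennreal)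
  qed
  have "(\<integral>\<^sup>+\<omega>. ennreal (of_bool (consecutive m n s (\<lambda>i. X i \<omega>) t) * window_cost \<alpha> (\<lambda>k. X (t k) \<omega>)) \<partial>M)
    \<le> (\<integral>\<^sup>+\<omega>. G (\<lambda>i\<in>{..<n}. X i \<omega>) \<partial>M)"
  proof (intro nn_integral_mono)
    fix \<omega>
    let ?x = "\<lambda>i\<in>{..<n}. X i \<omega>"
    have xt: "?x (t k) = X (t k) \<omega>" if "k \<le> 4" for k using tn[OF that] by simp
    show "ennreal (of_bool (consecutive m n s (\<lambda>i. X i \<omega>) t) * window_cost \<alpha> (\<lambda>k. X (t k) \<omega>))
      \<le> G (\<lambda>i\<in>{..<n}. X i \<omega>)"
    proof (cases "consecutive m n s (\<lambda>i. X i \<omega>) t")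
      case True
      note c = True[unfolded consecutive_def]
      have "Ch (?x (t 0)) (?x (t 1)) (?x (t 2)) (?x (t 3)) (?x (t 4))"
        unfolding Ch_def
        using c[THEN conjunct1, rule_format, of 0] c[THEN conjunct1, rule_format, of 1]
          c[THEN conjunct1, rule_format, of 2] c[THEN conjunct1, rule_format, of 3]
          c[THEN conjunct1, rule_format, of 4]
          c[THEN conjunct2, THEN conjunct1, rule_format, of 0]
          c[THEN conjunct2, THEN conjunct1, rule_format, of 1]
          c[THEN conjunct2, THEN conjunct1, rule_format, of 2]
          c[THEN conjunct2, THEN conjunct1, rule_format, of 3] xt[of 0] xt[of 1] xt[of 2] xt[of 3] xt[of 4]
        by (simp add: numeral_eq_Suc)
      then have "A ?x = cost5 \<alpha> (X (t 0) \<omega>) (X (t 1) \<omega>) (X (t 2) \<omega>) (X (t 3) \<omega>) (X (t 4) \<omega>)"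
        using xt by (simp add: A_def)
      also have "\<dots> = ennreal (window_cost \<alpha> (\<lambda>k. X (t k) \<omega>))"
        unfolding cost5_def
      proof (intro arg_cong[where f = ennreal] window_cost_cong)
        fix i :: nat assume "i \<le> 4"
        then consider "i = 0" | "i = 1" | "i = 2" | "i = 3" | "i = 4" by linarith
        then show "(if i = 0 then X (t 0) \<omega> else if i = 1 then X (t 1) \<omega> else if i = 2 then X (t 2) \<omega>
          else if i = 3 then X (t 3) \<omega> else X (t 4) \<omega>) = X (t i) \<omega>" by cases simp_all
      qed
      finally have "A ?x = ennreal (window_cost \<alpha> (\<lambda>k. X (t k) \<omega>))" .
      moreover have "B ?x (?x j) = 1" if "j \<in> J" for j
        using c[THEN conjunct2, THEN conjunct2] that xt[of 0] xt[of 4] by (auto simp: B_def J_def I_def)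
      ultimately show ?thesis using True by (simp add: G_def)
    qed simp
  qed
  also have "\<dots> = (\<integral>\<^sup>+x. G x \<partial>distr M (PiM {..<n} (\<lambda>_. borel)) (\<lambda>\<omega>. \<lambda>i\<in>{..<n}. X i \<omega>))"
    by (rule nn_integral_distr[symmetric]) (intro measurable_restrict rv, simp add: Gm)
  also have "\<dots> = (\<integral>\<^sup>+x. G x \<partial>PiM (I \<union> J) (\<lambda>_. unif_square))"
    unfolding dX IJ(4) ..
  also have "\<dots> = (\<integral>\<^sup>+x. (\<integral>\<^sup>+y. G (merge I J (x, y)) \<partial>PiM J (\<lambda>_. unif_square)) \<partial>PiM I (\<lambda>_. unif_square))"
  proof (rule U.product_nn_integral_fold)
    have "sets (PiM {..<n} (\<lambda>_. unif_square)) = sets (PiM {..<n} (\<lambda>_. borel :: point measure))"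
      by (intro sets_PiM_cong) auto
    then show "G \<in> borel_measurable (PiM (I \<union> J) (\<lambda>_. unif_square))"
      unfolding IJ(4) using Gm by (simp cong: measurable_cong_sets)
  qed (use IJ in auto)
  also have "\<dots> = (\<integral>\<^sup>+x. (\<integral>\<^sup>+y. A x * (\<Prod>j\<in>J. B x (y j)) \<partial>PiM J (\<lambda>_. unif_square)) \<partial>PiM I (\<lambda>_. unif_square))"
  proof (intro nn_integral_cong)
    fix x y :: "nat \<Rightarrow> point"
    have mt: "merge I J (x, y) (t k) = x (t k)" if "k \<le> 4" for k
      using tI[OF that] by (simp add: merge_def)
    have "merge I J (x, y) j = y j" if "j \<in> J" for j
      using that IJ(1) by (auto simp: merge_def)
    then show "G (merge I J (x, y)) = A x * (\<Prod>j\<in>J. B x (y j))"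
      unfolding G_def A_def B_def using mt by simp
  qed
  also have "\<dots> \<le> (\<integral>\<^sup>+x. strip5 \<alpha> m s lam (x (t 0)) (x (t 1)) (x (t 2)) (x (t 3)) (x (t 4))
      \<partial>PiM I (\<lambda>_. unif_square))"
  proof (intro nn_integral_mono)
    fix x :: "nat \<Rightarrow> point"
    let ?v = "\<lambda>k. x (t k)"
    have Bm: "B x \<in> borel_measurable unif_square" unfolding B_def by simp
    have "(\<integral>\<^sup>+y. A x * (\<Prod>j\<in>J. B x (y j)) \<partial>PiM J (\<lambda>_. unif_square)) =
      A x * (\<integral>\<^sup>+y. (\<Prod>j\<in>J. B x (y j)) \<partial>PiM J (\<lambda>_. unif_square))"
      using Bm by (intro nn_integral_cmult borel_measurable_prod_ennreal
        measurable_compose[OF measurable_component_singleton]) auto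
    also have "(\<integral>\<^sup>+y. (\<Prod>j\<in>J. B x (y j)) \<partial>PiM J (\<lambda>_. unif_square)) = (\<Prod>j\<in>J. \<integral>\<^sup>+q. B x q \<partial>unif_square)"
      using IJ Bm by (intro U.product_nn_integral_prod) auto
    also have "\<dots> = (\<integral>\<^sup>+q. B x q \<partial>unif_square) ^ (n - 5)" by (simp add: cardJ)
    also have "A x * \<dots> \<le> strip5 \<alpha> m s lam (?v 0) (?v 1) (?v 2) (?v 3) (?v 4)"
    proof (cases "Ch (?v 0) (?v 1) (?v 2) (?v 3) (?v 4)")
      case True
      then have ch: "fst (?v 0) < fst (?v 1)" "fst (?v 1) < fst (?v 2)" "fst (?v 2) < fst (?v 3)"
        "fst (?v 3) < fst (?v 4)" "0 \<le> fst (?v 0)" "fst (?v 4) \<le> 1" 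
        "strip m (?v 0) = int s" "strip m (?v 1) = int s" "strip m (?v 2) = int s"
        "strip m (?v 3) = int s" "strip m (?v 4) = int s"
        by (auto simp: Ch_def unit_square_def)
      have "(\<integral>\<^sup>+q. B x q \<partial>unif_square) \<le> ennreal (exp (- ((fst (?v 4) - fst (?v 0)) / m)))"
        unfolding B_def using ch by (intro nn_integral_outside_le m s) auto
      then have "(\<integral>\<^sup>+q. B x q \<partial>unif_square) ^ (n - 5) \<le>
        ennreal (exp (- ((fst (?v 4) - fst (?v 0)) / m))) ^ (n - 5)"
        by (intro power_mono) auto
      also have "\<dots> = ennreal (exp (- (lam * (fst (?v 4) - fst (?v 0)))))"
        using n by (simp add: ennreal_power exp_of_nat_mult[symmetric] lam_def of_nat_diff)
      \<comment> \<open>The extent of the tuple is the sum of its four gaps, which gives each kernel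
        its own exponential factor.\<close>
      also have "- (lam * (fst (?v 4) - fst (?v 0))) = - (lam * (fst (?v 4) - fst (?v 3))) +
        - (lam * (fst (?v 3) - fst (?v 2))) + - (lam * (fst (?v 2) - fst (?v 1))) + - (lam * (fst (?v 1) - fst (?v 0)))"
        by (simp add: algebra_simps)
      also have "ennreal (exp \<dots>) = ennreal (exp (- (lam * (fst (?v 4) - fst (?v 3))))) *
        ennreal (exp (- (lam * (fst (?v 3) - fst (?v 2))))) * ennreal (exp (- (lam * (fst (?v 2) - fst (?v 1))))) *
        ennreal (exp (- (lam * (fst (?v 1) - fst (?v 0)))))"
        by (simp only: exp_add) (simp add: ennreal_mult)
      also have "A x * \<dots> = strip5 \<alpha> m s lam (?v 0) (?v 1) (?v 2) (?v 3) (?v 4)"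
        using True ch by (simp add: strip5_def step_kernel_def A_def mult_ac)
      finally show ?thesis by (simp add: mult_left_mono)
    next
      case False
      then show ?thesis by (simp add: A_def)
    qed
    finally show "(\<integral>\<^sup>+y. A x * (\<Prod>j\<in>J. B x (y j)) \<partial>PiM J (\<lambda>_. unif_square))
      \<le> strip5 \<alpha> m s lam (?v 0) (?v 1) (?v 2) (?v 3) (?v 4)" .
  qed
  also have "\<dots> \<le> ennreal (1 / (lam * m) ^ 5) * block_integral \<alpha> h"
    unfolding I_eq by (intro nn_integral_strip5_le lam m \<alpha> dist)
  also have "lam * m = real n - 5" using m by (simp add: lam_def)
  finally show ?thesis .
qed

text \<open>By Fubini: once the point with index i is fixed, the other one would have to lie on the
  vertical line through it, a null set.\<close>

lemma AE_fst_distinct: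
  fixes X :: "nat \<Rightarrow> 'a \<Rightarrow> point"
  assumes ind: "indep_vars (\<lambda>_. borel) X UNIV"
    and unif: "\<And>i. distr M borel (X i) = unif_square" and "i \<noteq> j"
  shows "AE \<omega> in M. fst (X i \<omega>) \<noteq> fst (X j \<omega>)"
proof -
  interpret U: product_prob_space "\<lambda>_. unif_square"
    by (intro product_prob_spaceI prob_space_unif_square)
  have rv: "random_variable borel (X i)" for i
    using ind by (simp add: indep_vars_def)
  have dX: "distr M (PiM {j, i} (\<lambda>_. borel)) (\<lambda>\<omega>. \<lambda>k\<in>{j, i}. X k \<omega>) = PiM {j, i} (\<lambda>_. unif_square)"
  proof -
    have "indep_vars (\<lambda>_. borel) X {j, i}" using ind by (rule indep_vars_subset) simp
    then show ?thesis
      by (subst (asm) indep_vars_iff_distr_eq_PiM) (auto simp: rv unif)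
  qed
  let ?f = "\<lambda>x :: nat \<Rightarrow> point. if fst (x i) = fst (x j) then 1 else 0 :: ennreal"
  have f: "?f \<in> borel_measurable (PiM {j, i} (\<lambda>_. borel))"
    by measurable
  have [measurable]: "?f \<in> borel_measurable (PiM {j, i} (\<lambda>_. unif_square))"
    by measurable
  have [measurable]: "random_variable borel (X i)" "random_variable borel (X j)" by (rule rv)+
  have "(\<integral>\<^sup>+\<omega>. (if fst (X i \<omega>) = fst (X j \<omega>) then 1 else 0) \<partial>M) =
      (\<integral>\<^sup>+\<omega>. ?f (\<lambda>k\<in>{j, i}. X k \<omega>) \<partial>M)"
    by simp
  also have "\<dots> = (\<integral>\<^sup>+x. ?f x \<partial>distr M (PiM {j, i} (\<lambda>_. borel)) (\<lambda>\<omega>. \<lambda>k\<in>{j, i}. X k \<omega>))"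
    by (rule nn_integral_distr[symmetric]) (intro measurable_restrict rv, simp only: measurable_distr_eq1 f)
  also have "\<dots> = (\<integral>\<^sup>+x. (\<integral>\<^sup>+q. ?f (x(j := q)) \<partial>unif_square) \<partial>PiM {i} (\<lambda>_. unif_square))"
    unfolding dX using \<open>i \<noteq> j\<close> by (intro U.product_nn_integral_insert) auto
  also have "\<dots> = (\<integral>\<^sup>+x. 0 \<partial>PiM {i} (\<lambda>_. unif_square))"
  proof (intro nn_integral_cong)
    fix x :: "nat \<Rightarrow> point"
    have "(\<integral>\<^sup>+q. ?f (x(j := q)) \<partial>unif_square) = (\<integral>\<^sup>+q. indicator {p. fst p = fst (x i)} q \<partial>unif_square)"
      using \<open>i \<noteq> j\<close> by (intro nn_integral_cong) (auto simp: indicator_def)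
    then show "(\<integral>\<^sup>+q. ?f (x(j := q)) \<partial>unif_square) = 0"
      by (simp add: emeasure_unif_square_line)
  qed
  finally have "(\<integral>\<^sup>+\<omega>. (if fst (X i \<omega>) = fst (X j \<omega>) then 1 else 0) \<partial>M) = (0 :: ennreal)"
    by simp
  then have "AE \<omega> in M. (if fst (X i \<omega>) = fst (X j \<omega>) then 1 else 0) = (0 :: ennreal)"
    by (subst (asm) nn_integral_0_iff_AE) auto
  then show ?thesis by eventually_elim (simp split: if_splits)
qed

lemma AE_unit_square:
  fixes X :: "'a \<Rightarrow> point"
  assumes rv: "random_variable borel X" and unif: "distr M borel X = unif_square"
  shows "AE \<omega> in M. X \<omega> \<in> unit_square"
proof -
  have "AE p in distr M borel X. p \<in> unit_square"
    unfolding unif by (rule AE_unif_square_unit_square)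
  then show ?thesis using rv by (subst (asm) AE_distr_iff) auto
qed

lemma prob_all_outside_le:
  fixes X :: "nat \<Rightarrow> 'a \<Rightarrow> point"
  assumes ind: "indep_vars (\<lambda>_. borel) X UNIV"
    and unif: "\<And>i. distr M borel (X i) = unif_square"
    and A [measurable]: "A \<in> sets borel" "emeasure unif_square A = ennreal a" and a: "0 \<le> a"
    and J: "finite J" "J \<noteq> {}"
  shows "(\<integral>\<^sup>+\<omega>. of_bool (\<forall>i\<in>J. X i \<omega> \<notin> A) \<partial>M) \<le> ennreal (exp (- (a * card J)))"
    and "(\<lambda>\<omega>. of_bool (\<forall>i\<in>J. X i \<omega> \<notin> A) :: ennreal) \<in> borel_measurable M"
proof -
  have rv [measurable]: "random_variable borel (X i)" for i
    using ind by (simp add: indep_vars_def)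
  let ?E = "\<Inter>i\<in>J. X i -` (- A) \<inter> space M"
  have E: "?E \<in> sets M"
    using J by (intro sets.finite_INT measurable_sets[OF rv]) auto
  have eq: "of_bool (\<forall>i\<in>J. X i \<omega> \<notin> A) = (indicator ?E \<omega> :: ennreal)" if "\<omega> \<in> space M" for \<omega>
    using that by (auto simp: indicator_def)
  show "(\<lambda>\<omega>. of_bool (\<forall>i\<in>J. X i \<omega> \<notin> A) :: ennreal) \<in> borel_measurable M"
    using E by (subst measurable_cong[OF eq]) auto
  have "prob (X i -` (- A) \<inter> space M) = 1 - a" for i
  proof -
    interpret U: prob_space unif_square by (rule prob_space_unif_square)
    have "prob (X i -` (- A) \<inter> space M) = measure (distr M borel (X i)) (- A)"
      by (subst measure_distr) auto
    also have "\<dots> = 1 - measure unif_square A"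
      unfolding unif using U.prob_compl[of A] by (simp add: Compl_eq_Diff_UNIV)
    finally show ?thesis using A(2) a by (simp add: measure_def)
  qed
  then have "prob ?E = (1 - a) ^ card J"
    using indep_varsD[OF ind J(2,1), of "\<lambda>_. - A"] by simp
  also have "\<dots> \<le> exp (- a) ^ card J"
  proof (rule power_mono)
    show "1 - a \<le> exp (- a)" using exp_ge_add_one_self[of "- a"] by simp
    interpret U: prob_space unif_square by (rule prob_space_unif_square)
    have "measure unif_square A = a" using A(2) a by (simp add: measure_def)
    then show "0 \<le> 1 - a" using U.prob_le_1[of A] by simp
  qed
  also have "\<dots> = exp (- (a * card J))"
    by (simp add: exp_of_nat_mult[symmetric] mult.commute)
  finally have "prob ?E \<le> exp (- (a * card J))" .
  moreover have "(\<integral>\<^sup>+\<omega>. of_bool (\<forall>i\<in>J. X i \<omega> \<notin> A) \<partial>M) = emeasure M ?E"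
    using E by (subst nn_integral_cong[OF eq]) auto
  ultimately show "(\<integral>\<^sup>+\<omega>. of_bool (\<forall>i\<in>J. X i \<omega> \<notin> A) \<partial>M) \<le> ennreal (exp (- (a * card J)))"
    by (simp add: emeasure_eq_measure)
qed

end

section \<open>The expected block minimum\<close>

text \<open>\<open>L\<close> is the Euclidean distance between points of a strip of height
  \<open>h\<^sup>2\<close>, so the random block minimum is itself a window cost and inherits its
  bounds.\<close>

lemma L_eq_norm: "L h z u i j = norm ((W z i, h\<^sup>2 * u i) - (W z j, h\<^sup>2 * u j))"
proof -
  have "(h\<^sup>2 * u i - h\<^sup>2 * u j)\<^sup>2 = h ^ 4 * (u i - u j)\<^sup>2"
    by (simp add: power_mult_distrib flip: right_diff_distrib power_mult)
  then show ?thesis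
    by (simp add: L_def norm_prod_def power2_commute)
qed

lemma block_min_L_eq_window_cost:
  "block_min \<alpha> (L h z u) = window_cost \<alpha> (\<lambda>k. (W z k, h\<^sup>2 * u k))"
  unfolding window_cost_def by (intro arg_cong[where f = "block_min \<alpha>"] ext L_eq_norm)

text \<open>Triangle inequality along the plain path, in which each inner height takes part in two
  steps. The bound is linear in the variables, hence integrable.\<close>

lemma block_min_L_le:
  assumes "\<alpha> \<ge> 1"
  shows "block_min \<alpha> (L h z u) \<le> (\<bar>z 1\<bar> + \<bar>z 2\<bar> + \<bar>z 3\<bar> + \<bar>z 4\<bar>) +
    h\<^sup>2 * (\<bar>u 0\<bar> + 2 * \<bar>u 1\<bar> + 2 * \<bar>u 2\<bar> + 2 * \<bar>u 3\<bar> + \<bar>u 4\<bar>)"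
proof -
  define p where "p = (\<lambda>k. (W z k, h\<^sup>2 * u k))"
  have W: "W z (Suc k) = W z k + z (Suc k)" for k by (simp add: W_def)
  have "norm (p k - p (Suc k)) \<le> \<bar>z (Suc k)\<bar> + h\<^sup>2 * (\<bar>u k\<bar> + \<bar>u (Suc k)\<bar>)" for k
  proof -
    have "norm (p k - p (Suc k)) \<le> \<bar>W z k - W z (Suc k)\<bar> + \<bar>h\<^sup>2 * u k - h\<^sup>2 * u (Suc k)\<bar>"
      by (simp add: p_def norm_prod_def sqrt_sum_squares_le_sum_abs)
    also have "\<bar>h\<^sup>2 * u k - h\<^sup>2 * u (Suc k)\<bar> \<le> h\<^sup>2 * (\<bar>u k\<bar> + \<bar>u (Suc k)\<bar>)"
      unfolding right_diff_distrib[symmetric] abs_mult by (simp add: mult_left_mono)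
    finally show ?thesis by (simp add: W)
  qed
  from this[of 0] this[of 1] this[of 2] this[of 3] show ?thesis
    using window_cost_le_path[OF assms, of p]
    unfolding block_min_L_eq_window_cost p_def[symmetric]
    by (simp add: algebra_simps numeral_eq_Suc)
qed

text \<open>The sum type matches the family \<open>case_sum Z U\<close>, whose joint independence is
  assumed: \<open>Inl\<close> for the gaps, \<open>Inr\<close> for the heights.\<close>

definition block_law :: "nat + nat \<Rightarrow> real measure" where
  "block_law = case_sum (\<lambda>_. expo) (\<lambda>_. unif)"

lemma block_law_simps [simp]: "block_law (Inl i) = expo" "block_law (Inr i) = unif"
  by (simp_all add: block_law_def)

lemma measurable_component_block_law [measurable (raw)]:
  assumes "f \<in> N \<rightarrow>\<^sub>M PiM I block_law" "i \<in> I"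
  shows "(\<lambda>w. f w i) \<in> borel_measurable N"
proof -
  have "sets (block_law i) = sets borel" by (cases i) simp_all
  then have "(\<lambda>x. x i) \<in> PiM I block_law \<rightarrow>\<^sub>M borel"
    using measurable_component_singleton[of i I block_law] assms(2) by (simp cong: measurable_cong_sets)
  then show ?thesis by (rule measurable_compose[OF assms(1)])
qed

context prob_space
begin

lemma nn_integral_block_min:
  fixes Z U :: "nat \<Rightarrow> 'a \<Rightarrow> real"
  assumes Z: "\<And>i. i \<in> {1..4} \<Longrightarrow> distributed M lborel (Z i) (exponential_density 1)"
    and U: "\<And>i. i \<in> {0..4} \<Longrightarrow> distr M borel (U i) = unif"
    and ind: "indep_vars (\<lambda>_. borel) (case_sum Z U) ({1..4} <+> {0..4})"
  shows "(\<integral>\<^sup>+\<omega>. ennreal (block_min \<alpha> (L h (\<lambda>i. Z i \<omega>) (\<lambda>i. U i \<omega>))) \<partial>M) = block_integral \<alpha> h"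
proof -
  \<comment> \<open>Coordinates are split off in the order listed, so the last height goes first and
    ends up innermost, as in \<open>block_integral\<close>.\<close>
  let ?I = "{Inr 4, Inl 4, Inr 3, Inl 3, Inr 2, Inl 2, Inr 1, Inl 1, Inr 0} :: (nat + nat) set"
  let ?N = block_law
  have I: "{1..4} <+> {0..4} = ?I"
  proof -
    have "{1..4::nat} = {4, 3, 2, 1}" "{0..4::nat} = {4, 3, 2, 1, 0}" by auto
    then show ?thesis by (simp only: Plus_def image_insert image_empty) auto
  qed
  have rv: "random_variable borel (case_sum Z U i)" if "i \<in> ?I" for i
    using ind that unfolding I indep_vars_def by blast
  interpret N: product_prob_space ?N
    by (intro product_prob_spaceI) (metis block_law_simps prob_space_unif prob_space_expo sum.exhaust)
  have dN: "distr M borel (case_sum Z U i) = ?N i" if "i \<in> ?I" for i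
  proof (cases i)
    case (Inl k)
    then have "k \<in> {1..4}" using that by auto
    from distributed_distr_eq_density[OF Z[OF this]] Inl show ?thesis
      by (simp cong: distr_cong)
  next
    case (Inr k)
    then have "k \<in> {0..4}" using that by auto
    from U[OF this] Inr show ?thesis by simp
  qed
  have dist: "distr M (PiM ?I (\<lambda>_. borel)) (\<lambda>\<omega>. \<lambda>i\<in>?I. case_sum Z U i \<omega>) = PiM ?I ?N"
  proof -
    have "distr M (PiM ?I (\<lambda>_. borel)) (\<lambda>\<omega>. \<lambda>i\<in>?I. case_sum Z U i \<omega>) =
      PiM ?I (\<lambda>i. distr M borel (case_sum Z U i))"
      using ind unfolding I by (subst (asm) indep_vars_iff_distr_eq_PiM') (use rv in auto)
    also have "\<dots> = PiM ?I ?N" by (intro PiM_cong refl dN)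
    finally show ?thesis .
  qed
  let ?F = "\<lambda>x. block5 \<alpha> h (x (Inr 0)) (x (Inl 1)) (x (Inr 1)) (x (Inl 2)) (x (Inr 2)) (x (Inl 3)) (x (Inr 3))
    (x (Inl 4)) (x (Inr 4))"
  have Fm: "?F \<in> borel_measurable (PiM ?I (\<lambda>_. borel))"
    by measurable
  have "ennreal (block_min \<alpha> (L h (\<lambda>i. Z i \<omega>) (\<lambda>i. U i \<omega>))) = ?F (\<lambda>i\<in>?I. case_sum Z U i \<omega>)" for \<omega>
    unfolding block5_def block_min_L_eq_window_cost
  proof (intro arg_cong[where f = ennreal] window_cost_cong)
    fix i :: nat assume "i \<le> 4"
    then consider "i = 0" | "i = 1" | "i = 2" | "i = 3" | "i = 4" by linarith
    then show "(W (\<lambda>i. Z i \<omega>) i, h\<^sup>2 * U i \<omega>) =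
      (W (\<lambda>k. if k = 1 then (\<lambda>i\<in>?I. case_sum Z U i \<omega>) (Inl 1) else if k = 2 then (\<lambda>i\<in>?I. case_sum Z U i \<omega>) (Inl 2)
          else if k = 3 then (\<lambda>i\<in>?I. case_sum Z U i \<omega>) (Inl 3) else (\<lambda>i\<in>?I. case_sum Z U i \<omega>) (Inl 4)) i,
       h\<^sup>2 * (if i = 0 then (\<lambda>i\<in>?I. case_sum Z U i \<omega>) (Inr 0) else if i = 1 then (\<lambda>i\<in>?I. case_sum Z U i \<omega>) (Inr 1)
          else if i = 2 then (\<lambda>i\<in>?I. case_sum Z U i \<omega>) (Inr 2) else if i = 3 then (\<lambda>i\<in>?I. case_sum Z U i \<omega>) (Inr 3)
          else (\<lambda>i\<in>?I. case_sum Z U i \<omega>) (Inr 4)))"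
      by cases (simp_all add: W_def numeral_eq_Suc)
  qed
  then have "(\<integral>\<^sup>+\<omega>. ennreal (block_min \<alpha> (L h (\<lambda>i. Z i \<omega>) (\<lambda>i. U i \<omega>))) \<partial>M) =
      (\<integral>\<^sup>+\<omega>. ?F (\<lambda>i\<in>?I. case_sum Z U i \<omega>) \<partial>M)" by simp
  also have "\<dots> = (\<integral>\<^sup>+x. ?F x \<partial>distr M (PiM ?I (\<lambda>_. borel)) (\<lambda>\<omega>. \<lambda>i\<in>?I. case_sum Z U i \<omega>))"
    by (rule nn_integral_distr[symmetric]) (intro measurable_restrict rv, assumption, simp only: measurable_distr_eq1 Fm)
  also have "\<dots> = (\<integral>\<^sup>+x. ?F x \<partial>PiM ?I ?N)" unfolding dist ..
  also have "\<dots> = (\<integral>\<^sup>+x. \<integral>\<^sup>+u4. block5 \<alpha> h (x (Inr 0)) (x (Inl 1)) (x (Inr 1)) (x (Inl 2)) (x (Inr 2)) (x (Inl 3)) (x (Inr 3))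
    (x (Inl 4)) u4 \<partial>unif \<partial>PiM {Inl 4, Inr 3, Inl 3, Inr 2, Inl 2, Inr 1, Inl 1, Inr 0} ?N)"
    by (subst N.product_nn_integral_insert) (simp_all, measurable?)
  also have "\<dots> = (\<integral>\<^sup>+x. \<integral>\<^sup>+z4. \<integral>\<^sup>+u4. block5 \<alpha> h (x (Inr 0)) (x (Inl 1)) (x (Inr 1)) (x (Inl 2)) (x (Inr 2)) (x (Inl 3)) (x (Inr 3))
    z4 u4 \<partial>unif \<partial>expo \<partial>PiM {Inr 3, Inl 3, Inr 2, Inl 2, Inr 1, Inl 1, Inr 0} ?N)"
    by (subst N.product_nn_integral_insert) (simp_all, measurable?)
  also have "\<dots> = (\<integral>\<^sup>+x. \<integral>\<^sup>+u3. \<integral>\<^sup>+z4. \<integral>\<^sup>+u4. block5 \<alpha> h (x (Inr 0)) (x (Inl 1)) (x (Inr 1)) (x (Inl 2)) (x (Inr 2)) (x (Inl 3)) u3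
    z4 u4 \<partial>unif \<partial>expo \<partial>unif \<partial>PiM {Inl 3, Inr 2, Inl 2, Inr 1, Inl 1, Inr 0} ?N)"
    by (subst N.product_nn_integral_insert) (simp_all, measurable?)
  also have "\<dots> = (\<integral>\<^sup>+x. \<integral>\<^sup>+z3. \<integral>\<^sup>+u3. \<integral>\<^sup>+z4. \<integral>\<^sup>+u4. block5 \<alpha> h (x (Inr 0)) (x (Inl 1)) (x (Inr 1)) (x (Inl 2)) (x (Inr 2)) z3 u3
    z4 u4 \<partial>unif \<partial>expo \<partial>unif \<partial>expo \<partial>PiM {Inr 2, Inl 2, Inr 1, Inl 1, Inr 0} ?N)"
    by (subst N.product_nn_integral_insert) (simp_all, measurable?)
  also have "\<dots> = (\<integral>\<^sup>+x. \<integral>\<^sup>+u2. \<integral>\<^sup>+z3. \<integral>\<^sup>+u3. \<integral>\<^sup>+z4. \<integral>\<^sup>+u4. block5 \<alpha> h (x (Inr 0)) (x (Inl 1)) (x (Inr 1)) (x (Inl 2)) u2 z3 u3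
    z4 u4 \<partial>unif \<partial>expo \<partial>unif \<partial>expo \<partial>unif \<partial>PiM {Inl 2, Inr 1, Inl 1, Inr 0} ?N)"
    by (subst N.product_nn_integral_insert) (simp_all, measurable?)
  also have "\<dots> = (\<integral>\<^sup>+x. \<integral>\<^sup>+z2. \<integral>\<^sup>+u2. \<integral>\<^sup>+z3. \<integral>\<^sup>+u3. \<integral>\<^sup>+z4. \<integral>\<^sup>+u4. block5 \<alpha> h (x (Inr 0)) (x (Inl 1)) (x (Inr 1)) z2 u2 z3 u3
    z4 u4 \<partial>unif \<partial>expo \<partial>unif \<partial>expo \<partial>unif \<partial>expo \<partial>PiM {Inr 1, Inl 1, Inr 0} ?N)"
    by (subst N.product_nn_integral_insert) (simp_all, measurable?)
  also have "\<dots> = (\<integral>\<^sup>+x. \<integral>\<^sup>+u1. \<integral>\<^sup>+z2. \<integral>\<^sup>+u2. \<integral>\<^sup>+z3. \<integral>\<^sup>+u3. \<integral>\<^sup>+z4. \<integral>\<^sup>+u4. block5 \<alpha> h (x (Inr 0)) (x (Inl 1)) u1 z2 u2 z3 u3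
    z4 u4 \<partial>unif \<partial>expo \<partial>unif \<partial>expo \<partial>unif \<partial>expo \<partial>unif \<partial>PiM {Inl 1, Inr 0} ?N)"
    by (subst N.product_nn_integral_insert) (simp_all, measurable?)
  also have "\<dots> = (\<integral>\<^sup>+x. \<integral>\<^sup>+z1. \<integral>\<^sup>+u1. \<integral>\<^sup>+z2. \<integral>\<^sup>+u2. \<integral>\<^sup>+z3. \<integral>\<^sup>+u3. \<integral>\<^sup>+z4. \<integral>\<^sup>+u4. block5 \<alpha> h (x (Inr 0)) z1 u1 z2 u2 z3 u3
    z4 u4 \<partial>unif \<partial>expo \<partial>unif \<partial>expo \<partial>unif \<partial>expo \<partial>unif \<partial>expo \<partial>PiM {Inr 0} ?N)"
    by (subst N.product_nn_integral_insert) (simp_all, measurable?)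
  also have "\<dots> = block_integral \<alpha> h"
    unfolding block_integral_def by (subst N.product_nn_integral_singleton) simp_all
  finally show ?thesis .
qed

text \<open>Integrability identifies the Bochner integral in the theorem with the nonnegative
  integral; without it the former would be 0 by convention.\<close>

lemma integrable_block_min:
  fixes Z U :: "nat \<Rightarrow> 'a \<Rightarrow> real"
  assumes \<alpha>: "\<alpha> \<ge> 1"
    and Z: "\<And>i. i \<in> {1..4} \<Longrightarrow> distributed M lborel (Z i) (exponential_density 1)"
    and U: "\<And>i. i \<in> {0..4} \<Longrightarrow> distr M borel (U i) = unif"
    and rvU: "\<And>i. i \<in> {0..4} \<Longrightarrow> random_variable borel (U i)"
  shows "integrable M (\<lambda>\<omega>. block_min \<alpha> (L h (\<lambda>i. Z i \<omega>) (\<lambda>i. U i \<omega>)))"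
proof -
  have Zi: "integrable M (Z i)" if "i \<in> {1..4}" for i
    \<comment> \<open>A function that is not integrable has Bochner integral 0, whereas this
      expectation is 1.\<close>
    using exponential_distributed_expectation[OF _ Z[OF that]] not_integrable_integral_eq[of M "Z i"] by auto
  have Ui: "integrable M (U i)" if "i \<in> {0..4}" for i
  proof -
    have "AE x in unif. x \<in> {0..1}"
      by (intro AE_uniform_measureI) auto
    then have "AE x in distr M borel (U i). \<bar>x\<bar> \<le> 1"
      unfolding U[OF that] by eventually_elim auto
    then have "AE \<omega> in M. norm (U i \<omega>) \<le> 1"
      using rvU[OF that] by (subst (asm) AE_distr_iff) auto
    then show ?thesis by (rule integrable_const_bound[OF _ rvU[OF that]])
  qed
  have [measurable]: "random_variable borel (\<lambda>\<omega>. W (\<lambda>i. Z i \<omega>) k)" if "k \<le> 4" for k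
    unfolding W_def using that Zi by (intro borel_measurable_sum borel_measurable_integrable) auto
  have meas: "random_variable borel (\<lambda>\<omega>. block_min \<alpha> (L h (\<lambda>i. Z i \<omega>) (\<lambda>i. U i \<omega>)))"
  proof -
    \<comment> \<open>Nothing is known about \<open>Z\<close> and \<open>U\<close> beyond index 4,
      so the window is padded with 0 to make every component measurable.\<close>
    have "block_min \<alpha> (L h (\<lambda>i. Z i \<omega>) (\<lambda>i. U i \<omega>)) = window_cost \<alpha> (\<lambda>k. if k \<le> 4 then (W (\<lambda>i. Z i \<omega>) k, h\<^sup>2 * U k \<omega>) else 0)" for \<omega>
      unfolding block_min_L_eq_window_cost by (rule window_cost_cong) simp
    moreover have "random_variable borel (\<lambda>\<omega>. if k \<le> 4 then (W (\<lambda>i. Z i \<omega>) k, h\<^sup>2 * U k \<omega>) else 0)" for k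
      using rvU[of k] by (cases "k \<le> 4") simp_all
    ultimately show ?thesis by simp
  qed
  have int: "integrable M (\<lambda>\<omega>. (\<bar>Z 1 \<omega>\<bar> + \<bar>Z 2 \<omega>\<bar> + \<bar>Z 3 \<omega>\<bar> + \<bar>Z 4 \<omega>\<bar>) +
    h\<^sup>2 * (\<bar>U 0 \<omega>\<bar> + 2 * \<bar>U 1 \<omega>\<bar> + 2 * \<bar>U 2 \<omega>\<bar> + 2 * \<bar>U 3 \<omega>\<bar> + \<bar>U 4 \<omega>\<bar>))"
    using Zi Ui by (intro Bochner_Integration.integrable_add integrable_mult_right integrable_abs) auto
  show ?thesis
  proof (rule Bochner_Integration.integrable_bound[OF int meas], rule AE_I2)
    fix \<omega>
    have "0 \<le> block_min \<alpha> (L h (\<lambda>i. Z i \<omega>) (\<lambda>i. U i \<omega>))"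
      unfolding block_min_L_eq_window_cost by (rule window_cost_nonneg)
    then show "norm (block_min \<alpha> (L h (\<lambda>i. Z i \<omega>) (\<lambda>i. U i \<omega>))) \<le>
      norm ((\<bar>Z 1 \<omega>\<bar> + \<bar>Z 2 \<omega>\<bar> + \<bar>Z 3 \<omega>\<bar> + \<bar>Z 4 \<omega>\<bar>) +
      h\<^sup>2 * (\<bar>U 0 \<omega>\<bar> + 2 * \<bar>U 1 \<omega>\<bar> + 2 * \<bar>U 2 \<omega>\<bar> + 2 * \<bar>U 3 \<omega>\<bar> + \<bar>U 4 \<omega>\<bar>))"
      using block_min_L_le[OF \<alpha>, of h "\<lambda>i. Z i \<omega>" "\<lambda>i. U i \<omega>"] unfolding real_norm_def by linarith
  qed
qed

end

section \<open>The expected makespan and its limit\<close>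

definition margin :: "nat \<Rightarrow> real \<Rightarrow> bool \<Rightarrow> nat \<Rightarrow> point set" where
  "margin m \<epsilon> left s = {p. strip m p = int s \<and> fst p \<in> (if left then {0..\<epsilon>} else {1 - \<epsilon>..1})}"

text \<open>Witnesses from the four index groups are distinct, since division by \<open>K\<close>
  recovers the group from the index.\<close>

lemma card_margin_ge_four:
  fixes x :: "nat \<Rightarrow> 'p" and K :: nat
  assumes "\<And>g. g < 4 \<Longrightarrow> \<exists>i\<in>{g * K..<g * K + K}. Q (x i)"
  shows "card {j\<in>{..<4 * K}. Q (x j)} \<ge> 4"
proof -
  obtain f where f: "\<And>g. g < 4 \<Longrightarrow> f g \<in> {g * K..<g * K + K}" "\<And>g. g < (4::nat) \<Longrightarrow> Q (x (f g))"
    using assms by metis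
  have "f g div K = g" if "g < 4" for g
    using f(1)[OF that] by (intro div_nat_eqI) (auto simp: mult.commute)
  then have "inj_on f {..<4}" by (metis inj_onI lessThan_iff)
  moreover have "f ` {..<4} \<subseteq> {j\<in>{..<4 * K}. Q (x j)}"
  proof
    fix j assume "j \<in> f ` {..<4}"
    then obtain g where g: "g < 4" "j = f g" by auto
    have "(g + 1) * K \<le> 4 * K" using g by (intro mult_le_mono1) simp
    moreover have "f g < (g + 1) * K" using f(1)[OF g(1)] by simp
    ultimately have "f g < 4 * K" by (rule less_le_trans[rotated])
    then show "j \<in> {j\<in>{..<4 * K}. Q (x j)}" using f(2)[OF g(1)] g(2) by simp
  qed
  ultimately have "card {..<4::nat} \<le> card {j\<in>{..<4 * K}. Q (x j)}"
    by (intro card_inj_on_le) auto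
  then show ?thesis by simp
qed

text \<open>If each of the four groups of \<open>K\<close> points has a member in a margin, the margin has at least
  four points. Asking this of the groups separately makes the probability a plain product.\<close>

definition missed_margins :: "nat \<Rightarrow> nat \<Rightarrow> real \<Rightarrow> (nat \<Rightarrow> point) \<Rightarrow> real" where
  "missed_margins m K \<epsilon> x = (\<Sum>(s, left, g)\<in>{..<m} \<times> UNIV \<times> {..<4}.
     of_bool (\<forall>i\<in>{g * K..<g * K + K}. x i \<notin> margin m \<epsilon> left s))"

text \<open>\<open>missed_margins\<close> is nonnegative and is at least 1 as soon as some group
  misses a margin. It thus acts as an indicator of the bad samples, where the linear bound 32 K
  takes over.\<close>

lemma four_TSPD_le_window_sum_plus_missed:
  fixes x :: "nat \<Rightarrow> point" and m K :: nat
  assumes \<alpha>: "\<alpha> \<ge> 1" and \<epsilon>: "\<epsilon> \<ge> 0" and m: "m \<ge> 1" and K: "K \<ge> 2"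
    and sq: "\<And>i. i < 4 * K \<Longrightarrow> x i \<in> unit_square" and inj: "inj_on (\<lambda>i. fst (x i)) {..<4 * K}"
  shows "4 * TSPD_speed \<alpha> (x ` {..<4 * K}) \<le>
    window_sum \<alpha> m (4 * K) x + (16 * real m * \<epsilon> + 64) + 32 * real K * missed_margins m K \<epsilon> x"
proof -
  have ws: "window_sum \<alpha> m (4 * K) x \<ge> 0"
    unfolding window_sum_def by (intro sum_nonneg) (auto simp: window_cost_nonneg)
  show ?thesis
  proof (cases "\<exists>s<m. \<exists>left. \<exists>g<4. \<forall>i\<in>{g * K..<g * K + K}. x i \<notin> margin m \<epsilon> left s")
    case True
    then obtain s left g where b: "s < m" "g < 4" "\<forall>i\<in>{g * K..<g * K + K}. x i \<notin> margin m \<epsilon> left s"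
      by blast
    have "1 \<le> missed_margins m K \<epsilon> x"
      unfolding missed_margins_def
      by (rule order_trans[OF _ member_le_sum[of "(s, left, g)"]]) (use b in auto)
    then have "32 * real K * 1 \<le> 32 * real K * missed_margins m K \<epsilon> x"
      by (intro mult_left_mono) auto
    moreover have "0 \<le> 16 * real m * \<epsilon>" using \<epsilon> by simp
    ultimately show ?thesis
      using four_TSPD_le_linear[OF \<alpha> K sq inj] ws by linarith
  next
    case False
    have "missed_margins m K \<epsilon> x \<ge> 0"
      unfolding missed_margins_def by (intro sum_nonneg) auto
    moreover have "4 * TSPD_speed \<alpha> (x ` {..<4 * K}) \<le> window_sum \<alpha> m (4 * K) x + (16 * real m * \<epsilon> + 64)"
    proof (rule four_TSPD_le_window_sum[OF \<alpha> \<epsilon> m K sq inj])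
      have hit: "\<exists>i\<in>{g * K..<g * K + K}. x i \<in> margin m \<epsilon> left s" if "s < m" "g < 4" for s g left
        using False that by blast
      have sub: "(\<exists>i\<in>{g * K..<g * K + K}. strip m (x i) = int s \<and> fst (x i) \<ge> 1 - \<epsilon>) \<and>
        (\<exists>i\<in>{g * K..<g * K + K}. strip m (x i) = int s \<and> fst (x i) \<le> \<epsilon>)" if "s < m" "g < 4" for s g
        using hit[OF that, of True] hit[OF that, of False] by (auto simp: margin_def)
      show "card {j\<in>{..<4 * K}. strip m (x j) = int s \<and> fst (x j) \<ge> 1 - \<epsilon>} \<ge> 4" if "s < m" for s
        using sub[OF that] by (intro card_margin_ge_four) blast
      show "card {j\<in>{..<4 * K}. strip m (x j) = int s \<and> fst (x j) \<le> \<epsilon>} \<ge> 4" if "s < m" for s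
        using sub[OF that] by (intro card_margin_ge_four) blast
    qed
    ultimately show ?thesis by (smt (verit) mult_nonneg_nonneg of_nat_0_le_iff)
  qed
qed

context prob_space
begin

lemma borel_measurable_consecutive:
  fixes X :: "nat \<Rightarrow> 'a \<Rightarrow> point"
  assumes [measurable]: "\<And>i. random_variable borel (X i)"
  shows "(\<lambda>\<omega>. ennreal (of_bool (consecutive m n s (\<lambda>i. X i \<omega>) t) * window_cost \<alpha> (\<lambda>k. X (t k) \<omega>)))
    \<in> borel_measurable M"
proof -
  have "Measurable.pred M (\<lambda>\<omega>. consecutive m n s (\<lambda>i. X i \<omega>) t)"
    unfolding consecutive_def by measurable
  then show ?thesis by measurable
qed

text \<open>There are at most \<open>n ^ 5 * m\<close> summands, and
  \<open>consecutive_expectation_le\<close> bounds each of them by the same constant.\<close>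

lemma nn_integral_window_sum_le:
  fixes X :: "nat \<Rightarrow> 'a \<Rightarrow> point" and m K n :: nat
  assumes ind: "indep_vars (\<lambda>_. borel) X UNIV"
    and unif: "\<And>i. distr M borel (X i) = unif_square"
    and n: "n > 5" and m: "m \<ge> 1" and \<alpha>: "\<alpha> \<ge> 1" and h: "real n - 5 \<le> h\<^sup>2 * (real m)\<^sup>2"
  shows "(\<lambda>\<omega>. ennreal (window_sum \<alpha> m n (\<lambda>i. X i \<omega>))) \<in> borel_measurable M"
    and "(\<integral>\<^sup>+\<omega>. ennreal (window_sum \<alpha> m n (\<lambda>i. X i \<omega>)) \<partial>M)
    \<le> ennreal (real n ^ 5 * real m / (real n - 5) ^ 5) * block_integral \<alpha> h"
proof -
  have rv: "random_variable borel (X i)" for i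
    using ind by (simp add: indep_vars_def)
  let ?f = "\<lambda>(t, s) \<omega>. ennreal (of_bool (consecutive m n s (\<lambda>i. X i \<omega>) t) * window_cost \<alpha> (\<lambda>k. X (t k) \<omega>))"
  let ?c = "ennreal (1 / (real n - 5) ^ 5) * block_integral \<alpha> h"
  have eq: "ennreal (window_sum \<alpha> m n (\<lambda>i. X i \<omega>)) = (\<Sum>ts\<in>tuples n \<times> {..<m}. ?f ts \<omega>)" for \<omega>
    unfolding window_sum_def
    by (subst sum_ennreal[symmetric]) (auto simp: window_cost_nonneg intro!: sum.cong)
  have meas: "?f ts \<in> borel_measurable M" for ts
  proof (cases ts)
    case (Pair t s)
    show ?thesis
      unfolding Pair prod.case by (rule borel_measurable_consecutive[OF rv])
  qed
  show "(\<lambda>\<omega>. ennreal (window_sum \<alpha> m n (\<lambda>i. X i \<omega>))) \<in> borel_measurable M"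
    unfolding eq by (intro borel_measurable_sum meas)
  have "(\<integral>\<^sup>+\<omega>. ennreal (window_sum \<alpha> m n (\<lambda>i. X i \<omega>)) \<partial>M) = (\<Sum>ts\<in>tuples n \<times> {..<m}. \<integral>\<^sup>+\<omega>. ?f ts \<omega> \<partial>M)"
    unfolding eq by (intro nn_integral_sum meas)
  also have "\<dots> \<le> (\<Sum>ts\<in>tuples n \<times> {..<m}. ?c)"
  proof (intro sum_mono)
    fix ts assume "ts \<in> tuples n \<times> {..<m}"
    then obtain t s where ts: "ts = (t, s)" "t \<in> tuples n" "s < m" by auto
    show "(\<integral>\<^sup>+\<omega>. ?f ts \<omega> \<partial>M) \<le> ?c"
      unfolding ts(1) prod.case by (rule consecutive_expectation_le[OF ind unif ts(2,3) n m \<alpha> h])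
  qed
  also have "\<dots> = ennreal (real (card (tuples n) * m)) * ?c"
    by (simp add: card_cartesian_product ennreal_of_nat_eq_real_of_nat)
  also have "\<dots> \<le> ennreal (real (n ^ 5 * m)) * ?c"
    using card_tuples_le[of n] by (intro mult_right_mono ennreal_leI) (simp_all only: of_nat_le_iff mult_le_mono1 zero_le)
  also have "\<dots> = ennreal (real n ^ 5 * real m / (real n - 5) ^ 5) * block_integral \<alpha> h"
    using n by (simp add: mult.assoc[symmetric] ennreal_mult[symmetric])
  finally show "(\<integral>\<^sup>+\<omega>. ennreal (window_sum \<alpha> m n (\<lambda>i. X i \<omega>)) \<partial>M)
    \<le> ennreal (real n ^ 5 * real m / (real n - 5) ^ 5) * block_integral \<alpha> h" .
qed

text \<open>The factor 8 m counts m strips, two ends and four groups. A margin has area \<epsilon> /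
  m, so K independent points all miss it with probability at most exp (- \<epsilon> K / m).\<close>

lemma nn_integral_missed_margins_le:
  fixes X :: "nat \<Rightarrow> 'a \<Rightarrow> point" and m K n :: nat
  assumes ind: "indep_vars (\<lambda>_. borel) X UNIV"
    and unif: "\<And>i. distr M borel (X i) = unif_square"
    and m: "m \<ge> 1" and \<epsilon>: "0 < \<epsilon>" "\<epsilon> \<le> 1" and K: "K \<ge> 1"
  shows "(\<lambda>\<omega>. ennreal (missed_margins m K \<epsilon> (\<lambda>i. X i \<omega>))) \<in> borel_measurable M"
    and "(\<integral>\<^sup>+\<omega>. ennreal (missed_margins m K \<epsilon> (\<lambda>i. X i \<omega>)) \<partial>M) \<le> ennreal (8 * real m * exp (- (\<epsilon> / real m * real K)))"
proof -
  let ?I = "{..<m} \<times> (UNIV :: bool set) \<times> {..<4::nat}"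
  let ?f = "\<lambda>(s, left, g) \<omega>. of_bool (\<forall>i\<in>{g * K..<g * K + K}. X i \<omega> \<notin> margin m \<epsilon> left s) :: ennreal"
  have eq: "ennreal (missed_margins m K \<epsilon> (\<lambda>i. X i \<omega>)) = (\<Sum>c\<in>?I. ?f c \<omega>)" for \<omega>
    unfolding missed_margins_def
    by (subst sum_ennreal[symmetric]) (auto intro!: sum.cong)
  have bound: "?f c \<in> borel_measurable M \<and> (\<integral>\<^sup>+\<omega>. ?f c \<omega> \<partial>M) \<le> ennreal (exp (- (\<epsilon> / real m * real K)))"
    if "c \<in> ?I" for c
  proof -
    obtain s left g where c: "c = (s, left, g)" "s < m" using \<open>c \<in> ?I\<close> by auto
    have A: "margin m \<epsilon> left s \<in> sets borel" unfolding margin_def by (cases left) (simp_all, measurable?)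
    have em: "emeasure unif_square (margin m \<epsilon> left s) = ennreal (\<epsilon> / real m)"
    proof (cases left)
      case True
      then show ?thesis
        using emeasure_strip_box[OF m c(2), of 0 \<epsilon> "{0..\<epsilon>}"] \<epsilon> by (simp add: margin_def)
    next
      case False
      then show ?thesis
        using emeasure_strip_box[OF m c(2), of "1 - \<epsilon>" 1 "{1 - \<epsilon>..1}"] \<epsilon> by (simp add: margin_def)
    qed
    show ?thesis
      using prob_all_outside_le[OF ind unif A em, of "{g * K..<g * K + K}"] \<epsilon> K unfolding c(1) by simp
  qed
  show "(\<lambda>\<omega>. ennreal (missed_margins m K \<epsilon> (\<lambda>i. X i \<omega>))) \<in> borel_measurable M"
    unfolding eq using bound by (intro borel_measurable_sum) blast
  have "(\<integral>\<^sup>+\<omega>. ennreal (missed_margins m K \<epsilon> (\<lambda>i. X i \<omega>)) \<partial>M) = (\<Sum>c\<in>?I. \<integral>\<^sup>+\<omega>. ?f c \<omega> \<partial>M)"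
    unfolding eq using bound by (intro nn_integral_sum) blast
  also have "\<dots> \<le> (\<Sum>c\<in>?I. ennreal (exp (- (\<epsilon> / real m * real K))))"
    using bound by (intro sum_mono) blast
  also have "\<dots> = ennreal (real (card ?I)) * ennreal (exp (- (\<epsilon> / real m * real K)))"
    by (simp add: ennreal_of_nat_eq_real_of_nat)
  also have "\<dots> = ennreal (8 * real m * exp (- (\<epsilon> / real m * real K)))"
    by (simp add: ennreal_mult[symmetric] card_cartesian_product mult.commute)
  finally show "(\<integral>\<^sup>+\<omega>. ennreal (missed_margins m K \<epsilon> (\<lambda>i. X i \<omega>)) \<partial>M) \<le> ennreal (8 * real m * exp (- (\<epsilon> / real m * real K)))" .
qed

lemma expected_TSPD_le:
  fixes X :: "nat \<Rightarrow> 'a \<Rightarrow> point" and m K n :: nat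
  assumes ind: "indep_vars (\<lambda>_. borel) X UNIV"
    and unif: "\<And>i. distr M borel (X i) = unif_square"
    and \<alpha>: "\<alpha> \<ge> 1" and m: "m \<ge> 1" and \<epsilon>: "0 < \<epsilon>" "\<epsilon> \<le> 1" and K: "K \<ge> 2"
    and h: "4 * real K - 5 \<le> h\<^sup>2 * (real m)\<^sup>2" and B: "block_integral \<alpha> h = ennreal b" "b \<ge> 0"
  shows "(\<integral>\<omega>. 4 * TSPD_speed \<alpha> ((\<lambda>i. X i \<omega>) ` {..<4 * K}) \<partial>M) \<le>
    (4 * real K) ^ 5 * real m / (4 * real K - 5) ^ 5 * b + (16 * real m * \<epsilon> + 64) + 256 * real K * real m * exp (- (\<epsilon> / real m * real K))"
  \<comment> \<open>Measurability of the makespan is not known here: \<open>integral_real_bounded\<close> does not need it.\<close>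
proof (rule integral_real_bounded)
  have rv: "random_variable borel (X i)" for i
    using ind by (simp add: indep_vars_def)
  let ?W = "\<lambda>\<omega>. window_sum \<alpha> m (4 * K) (\<lambda>i. X i \<omega>)" and ?N = "\<lambda>\<omega>. missed_margins m K \<epsilon> (\<lambda>i. X i \<omega>)"
  have W0: "0 \<le> ?W \<omega>" and N0: "0 \<le> ?N \<omega>" for \<omega>
    unfolding window_sum_def missed_margins_def
    by (intro sum_nonneg; auto simp: window_cost_nonneg)+
  have pos: "4 * real K - 5 > 0" using K by linarith
  show "0 \<le> (4 * real K) ^ 5 * real m / (4 * real K - 5) ^ 5 * b + (16 * real m * \<epsilon> + 64) + 256 * real K * real m * exp (- (\<epsilon> / real m * real K))"
    using pos \<epsilon> B by (intro add_nonneg_nonneg mult_nonneg_nonneg divide_nonneg_nonneg) auto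
  \<comment> \<open>The deterministic bound asks for points below the top edge with distinct
    abscissas; both hold almost surely for all indices at once.\<close>
  have "AE \<omega> in M. \<forall>i. X i \<omega> \<in> unit_square"
    using AE_unit_square[OF rv unif] by (simp add: AE_all_countable)
  moreover have "AE \<omega> in M. \<forall>i j. i \<noteq> j \<longrightarrow> fst (X i \<omega>) \<noteq> fst (X j \<omega>)"
    using AE_fst_distinct[OF ind unif] by (simp add: AE_all_countable)
  ultimately have "AE \<omega> in M. 4 * TSPD_speed \<alpha> ((\<lambda>i. X i \<omega>) ` {..<4 * K}) \<le>
      ?W \<omega> + (16 * real m * \<epsilon> + 64) + 32 * real K * ?N \<omega>"
  proof eventually_elim
    case (elim \<omega>)
    then show ?case
      using \<epsilon> by (intro four_TSPD_le_window_sum_plus_missed \<alpha> m K) (auto simp: inj_on_def)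
  qed
  then have "(\<integral>\<^sup>+\<omega>. ennreal (4 * TSPD_speed \<alpha> ((\<lambda>i. X i \<omega>) ` {..<4 * K})) \<partial>M) \<le>
      (\<integral>\<^sup>+\<omega>. ennreal (?W \<omega>) + ennreal (16 * real m * \<epsilon> + 64) + ennreal (32 * real K) * ennreal (?N \<omega>) \<partial>M)"
  proof (intro nn_integral_mono_AE, eventually_elim)
    case (elim \<omega>)
    have "ennreal (?W \<omega>) + ennreal (16 * real m * \<epsilon> + 64) + ennreal (32 * real K) * ennreal (?N \<omega>) =
      ennreal (?W \<omega> + (16 * real m * \<epsilon> + 64) + 32 * real K * ?N \<omega>)"
      using W0[of \<omega>] N0[of \<omega>] \<epsilon>
      by (subst ennreal_mult[symmetric]) (simp_all add: ennreal_plus[symmetric] del: ennreal_plus)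
    then show ?case using elim by (simp add: ennreal_leI)
  qed
  also have "\<dots> = (\<integral>\<^sup>+\<omega>. ennreal (?W \<omega>) \<partial>M) + ennreal (16 * real m * \<epsilon> + 64) +
      ennreal (32 * real K) * (\<integral>\<^sup>+\<omega>. ennreal (?N \<omega>) \<partial>M)"
  proof -
    have n: "4 * K > 5" "real (4 * K) - 5 \<le> h\<^sup>2 * (real m)\<^sup>2" "K \<ge> 1" using K h by auto
    note [measurable] = nn_integral_window_sum_le(1)[OF ind unif n(1) m \<alpha> n(2)]
      nn_integral_missed_margins_le(1)[OF ind unif m \<epsilon> n(3)]
    show ?thesis
      by (simp add: nn_integral_add nn_integral_cmult emeasure_space_1)
  qed
  also have "\<dots> \<le> ennreal ((4 * real K) ^ 5 * real m / (4 * real K - 5) ^ 5) * ennreal b +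
      ennreal (16 * real m * \<epsilon> + 64) + ennreal (32 * real K) * ennreal (8 * real m * exp (- (\<epsilon> / real m * real K)))"
    using nn_integral_window_sum_le(2)[OF ind unif _ m \<alpha>, of "4 * K" h] K h B
      nn_integral_missed_margins_le(2)[OF ind unif m \<epsilon>, of K]
    by (intro add_mono mult_left_mono) auto
  also have "\<dots> = ennreal ((4 * real K) ^ 5 * real m / (4 * real K - 5) ^ 5 * b +
      (16 * real m * \<epsilon> + 64) + 256 * real K * real m * exp (- (\<epsilon> / real m * real K)))"
  proof -
    have "32 * real K * (8 * real m * exp (- (\<epsilon> / real m * real K))) = 256 * real K * real m * exp (- (\<epsilon> / real m * real K))" by simp
    moreover have "0 \<le> (4 * real K) ^ 5 * real m / (4 * real K - 5) ^ 5"
      using pos by (intro divide_nonneg_nonneg) auto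
    ultimately show ?thesis
      using \<epsilon> B(2) by (simp only: ennreal_mult[symmetric] ennreal_plus[symmetric] add_nonneg_nonneg
        mult_nonneg_nonneg of_nat_0_le_iff zero_le_numeral exp_ge_zero less_imp_le)
  qed
  finally show "(\<integral>\<^sup>+\<omega>. ennreal (4 * TSPD_speed \<alpha> ((\<lambda>i. X i \<omega>) ` {..<4 * K})) \<partial>M) \<le>
    ennreal ((4 * real K) ^ 5 * real m / (4 * real K - 5) ^ 5 * b + (16 * real m * \<epsilon> + 64) + 256 * real K * real m * exp (- (\<epsilon> / real m * real K)))" .
qed

end

text \<open>\<open>h\<^sup>2 * (real m)\<^sup>2\<close> stands for n, and 9 = 4 + 5 covers the
  rounding to a multiple of 4 and the five points of the tuple. Since sqrt n is about h m, the main
  term tends to b / (4 h) and the margins to 4 \<epsilon> / h; the exponent of the last term is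
  about - \<epsilon> h^2 m / 4.\<close>

lemma strip_count_bound_tendsto:
  fixes h \<epsilon> b :: real
  assumes h: "h > 0" and \<epsilon>: "\<epsilon> > 0"
  shows "(\<lambda>m. (h\<^sup>2 * (real m)\<^sup>2) ^ 5 * real m / (h\<^sup>2 * (real m)\<^sup>2 - 9) ^ 5 / (4 * sqrt (h\<^sup>2 * (real m)\<^sup>2 - 4)) * b +
    (16 * real m * \<epsilon> + 64) / (4 * sqrt (h\<^sup>2 * (real m)\<^sup>2 - 4)) +
    64 * (h\<^sup>2 * (real m)\<^sup>2) * real m * exp (- (\<epsilon> / real m * ((h\<^sup>2 * (real m)\<^sup>2 - 4) / 4))) /
      (4 * sqrt (h\<^sup>2 * (real m)\<^sup>2 - 4))) \<longlonglongrightarrow> 1 / (4 * h) * b + 4 * \<epsilon> / h + 0"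
proof (intro tendsto_add tendsto_mult_right)
  show "(\<lambda>m. (h\<^sup>2 * (real m)\<^sup>2) ^ 5 * real m / (h\<^sup>2 * (real m)\<^sup>2 - 9) ^ 5 / (4 * sqrt (h\<^sup>2 * (real m)\<^sup>2 - 4)))
    \<longlonglongrightarrow> 1 / (4 * h)"
    using h by real_asymp (simp add: field_simps)
  show "(\<lambda>m. (16 * real m * \<epsilon> + 64) / (4 * sqrt (h\<^sup>2 * (real m)\<^sup>2 - 4))) \<longlonglongrightarrow> 4 * \<epsilon> / h"
    using h \<epsilon> by real_asymp (simp add: field_simps)
  show "(\<lambda>m. 64 * (h\<^sup>2 * (real m)\<^sup>2) * real m * exp (- (\<epsilon> / real m * ((h\<^sup>2 * (real m)\<^sup>2 - 4) / 4))) /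
      (4 * sqrt (h\<^sup>2 * (real m)\<^sup>2 - 4))) \<longlonglongrightarrow> 0"
    using h \<epsilon> by real_asymp
qed

lemma four_floor_bounds:
  fixes r :: real
  assumes "r \<ge> 0"
  shows "4 * real (nat \<lfloor>r / 4\<rfloor>) \<le> r" "r - 4 \<le> 4 * real (nat \<lfloor>r / 4\<rfloor>)"
proof -
  have "real (nat \<lfloor>r / 4\<rfloor>) = of_int \<lfloor>r / 4\<rfloor>" using assms by simp
  then show "4 * real (nat \<lfloor>r / 4\<rfloor>) \<le> r" "r - 4 \<le> 4 * real (nat \<lfloor>r / 4\<rfloor>)" by linarith+
qed

lemma (in prob_space) limit_TSPD_le:
  fixes X :: "nat \<Rightarrow> 'a \<Rightarrow> point" and h b \<beta> \<epsilon> :: real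
  assumes ind: "indep_vars (\<lambda>_. borel) X UNIV"
    and unif: "\<And>i. distr M borel (X i) = unif_square"
    and \<alpha>: "\<alpha> \<ge> 1" and h: "h > 0" and \<epsilon>: "0 < \<epsilon>" "\<epsilon> \<le> 1"
    and B: "block_integral \<alpha> h = ennreal b" "b \<ge> 0"
    and lim: "(\<lambda>n. (\<integral>\<omega>. TSPD_speed \<alpha> ((\<lambda>i. X i \<omega>) ` {..<n}) / sqrt (real n) \<partial>M)) \<longlonglongrightarrow> \<beta>"
  shows "\<beta> \<le> 1 / (4 * h) * b + 4 * \<epsilon> / h"
proof -
  let ?a = "\<lambda>n. (\<integral>\<omega>. TSPD_speed \<alpha> ((\<lambda>i. X i \<omega>) ` {..<n}) / sqrt (real n) \<partial>M)"
  define r where "r = (\<lambda>m. h\<^sup>2 * (real m)\<^sup>2)"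
  \<comment> \<open>The largest multiple of four not above r: this meets the hypothesis on
    \<open>h\<close> in \<open>expected_TSPD_le\<close> and keeps sqrt (4 K) asymptotic to h
    m.\<close>
  define K where "K = (\<lambda>m. nat \<lfloor>r m / 4\<rfloor>)"
  have K: "4 * real (K m) \<le> r m" "r m - 4 \<le> 4 * real (K m)" for m
    unfolding K_def by (rule four_floor_bounds, simp add: r_def)+
  have r: "filterlim r at_top sequentially"
    unfolding r_def using h by real_asymp
  have "filterlim (\<lambda>m. 4 * K m) at_top sequentially"
    unfolding filterlim_at_top
  proof
    fix c :: nat
    have "eventually (\<lambda>m. real c + 4 \<le> r m) sequentially"
      using r unfolding filterlim_at_top by blast
    then show "eventually (\<lambda>m. c \<le> 4 * K m) sequentially"
    proof eventually_elim
      case (elim m)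
      then have "real c \<le> real (4 * K m)" using K(2)[of m] by simp
      then show ?case by (simp only: of_nat_le_iff)
    qed
  qed
  then have lim': "(\<lambda>m. ?a (4 * K m)) \<longlonglongrightarrow> \<beta>"
    by (rule filterlim_compose[OF lim])
  \<comment> \<open>From r \<ge> 12 follow 4 K \<ge> 8, hence K \<ge> 2, and the positivity of r - 9
    and r - 4.\<close>
  have "eventually (\<lambda>m. 12 \<le> r m) sequentially"
    using r unfolding filterlim_at_top by blast
  moreover have "eventually (\<lambda>m. m \<ge> (1::nat)) sequentially"
    by (rule eventually_ge_at_top)
  ultimately have le: "eventually (\<lambda>m. ?a (4 * K m) \<le>
    (r m ^ 5 * real m / (r m - 9) ^ 5 / (4 * sqrt (r m - 4)) * b +
    (16 * real m * \<epsilon> + 64) / (4 * sqrt (r m - 4)) +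
    64 * r m * real m * exp (- (\<epsilon> / real m * ((r m - 4) / 4))) / (4 * sqrt (r m - 4)))) sequentially"
  proof eventually_elim
    case (elim m)
    have K2: "K m \<ge> 2" using K(2)[of m] elim(1) by linarith
    have sq: "0 < sqrt (r m - 4)" "sqrt (r m - 4) \<le> sqrt (4 * real (K m))"
      using K(2)[of m] elim(1) by auto
    have "?a (4 * K m) =
      (\<integral>\<omega>. 4 * TSPD_speed \<alpha> ((\<lambda>i. X i \<omega>) ` {..<4 * K m}) \<partial>M) / (4 * sqrt (4 * real (K m)))"
      by simp
    also have "\<dots> \<le> ((4 * real (K m)) ^ 5 * real m / (4 * real (K m) - 5) ^ 5 * b + (16 * real m * \<epsilon> + 64) +
      256 * real (K m) * real m * exp (- (\<epsilon> / real m * real (K m)))) / (4 * sqrt (4 * real (K m)))"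
      using K(1)[of m] by (intro divide_right_mono expected_TSPD_le[where h = h] ind unif \<alpha> elim(2) \<epsilon> K2 B) (auto simp: r_def)
    \<comment> \<open>K is eliminated through r - 4 \<le> 4 K \<le> r, with the upper bound in
      numerators and the lower one in denominators and in the exponent, so that the limit involves
      no floor.\<close>
    also have "\<dots> \<le> (r m ^ 5 * real m / (r m - 9) ^ 5 * b + (16 * real m * \<epsilon> + 64) +
      64 * r m * real m * exp (- (\<epsilon> / real m * ((r m - 4) / 4)))) / (4 * sqrt (r m - 4))"
    proof (rule frac_le)
      have "(4 * real (K m)) ^ 5 * real m / (4 * real (K m) - 5) ^ 5 \<le> r m ^ 5 * real m / (r m - 9) ^ 5"
        using K[of m] elim by (intro frac_le mult_mono power_mono) auto
      moreover have "256 * real (K m) * real m * exp (- (\<epsilon> / real m * real (K m))) \<le>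
        64 * r m * real m * exp (- (\<epsilon> / real m * ((r m - 4) / 4)))"
      proof (rule mult_mono)
        show "256 * real (K m) * real m \<le> 64 * r m * real m"
          using K(1)[of m] by (intro mult_right_mono) auto
        have "\<epsilon> / real m * ((r m - 4) / 4) \<le> \<epsilon> / real m * real (K m)"
          using K(2)[of m] \<epsilon> by (intro mult_left_mono) auto
        then show "exp (- (\<epsilon> / real m * real (K m))) \<le> exp (- (\<epsilon> / real m * ((r m - 4) / 4)))" by simp
      qed (use elim in auto)
      ultimately show "(4 * real (K m)) ^ 5 * real m / (4 * real (K m) - 5) ^ 5 * b + (16 * real m * \<epsilon> + 64) +
        256 * real (K m) * real m * exp (- (\<epsilon> / real m * real (K m))) \<le>
        r m ^ 5 * real m / (r m - 9) ^ 5 * b + (16 * real m * \<epsilon> + 64) +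
        64 * r m * real m * exp (- (\<epsilon> / real m * ((r m - 4) / 4)))"
        using B(2) \<epsilon> by (intro add_mono mult_right_mono) auto
      show "0 \<le> r m ^ 5 * real m / (r m - 9) ^ 5 * b + (16 * real m * \<epsilon> + 64) +
        64 * r m * real m * exp (- (\<epsilon> / real m * ((r m - 4) / 4)))"
        using elim B(2) \<epsilon> by (intro add_nonneg_nonneg mult_nonneg_nonneg divide_nonneg_nonneg) auto
    qed (use sq in auto)
    finally show ?case by (simp add: add_divide_distrib)
  qed
  from tendsto_le[OF sequentially_bot strip_count_bound_tendsto[OF h \<epsilon>(1), of b] lim' le[unfolded r_def]]
  show ?thesis by simp
qed

theorem mainTheorem7:
  fixes \<alpha> h \<beta> :: real
    and P :: "'a measure" and X :: "nat \<Rightarrow> 'a \<Rightarrow> real \<times> real"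
    and Q :: "'b measure" and Z U :: "nat \<Rightarrow> 'b \<Rightarrow> real"
  assumes "\<alpha> \<ge> 1" and "h > 0"
    \<comment> \<open>\<open>\<beta>\<close> is the constant \<open>\<beta>_TSPD\<close>\<close>
    and "prob_space P"
    and "prob_space.indep_vars P (\<lambda>_. borel) X UNIV"
    and "\<And>i. distr P borel (X i) = uniform_measure lborel ({0..1} \<times> {0..1})"
    and "AE \<omega> in P. (\<lambda>n. TSPD_speed \<alpha> ((\<lambda>i. X i \<omega>) ` {..<n}) / sqrt (real n)) \<longlonglongrightarrow> \<beta>"
    and "(\<lambda>n. (\<integral>\<omega>. TSPD_speed \<alpha> ((\<lambda>i. X i \<omega>) ` {..<n}) / sqrt (real n) \<partial>P)) \<longlonglongrightarrow> \<beta>"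
    and "prob_space Q"
    and "\<And>i. i \<in> {1..4} \<Longrightarrow> distributed Q lborel (Z i) (exponential_density 1)"
    and "\<And>i. i \<in> {0..4} \<Longrightarrow> distr Q borel (U i) = uniform_measure lborel {0..1}"
    and "prob_space.indep_vars Q (\<lambda>_. borel) (case_sum Z U) ({1..4} <+> {0..4})"
  shows "\<beta> \<le> 1 / (4 * h) *
    (\<integral>\<omega>. block_min \<alpha> (L h (\<lambda>i. Z i \<omega>) (\<lambda>i. U i \<omega>)) \<partial>Q)"
proof -
  interpret P: prob_space P by fact
  interpret Q: prob_space Q by fact
  define b where "b = (\<integral>\<omega>. block_min \<alpha> (L h (\<lambda>i. Z i \<omega>) (\<lambda>i. U i \<omega>)) \<partial>Q)"
  have nn: "0 \<le> block_min \<alpha> (L h (\<lambda>i. Z i \<omega>) (\<lambda>i. U i \<omega>))" for \<omega>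
    unfolding block_min_L_eq_window_cost by (rule window_cost_nonneg)
  then have b0: "b \<ge> 0" unfolding b_def by (intro integral_nonneg_AE) simp
  have "Q.random_variable borel (U i)" if "i \<in> {0..4}" for i
  proof -
    have "Inr i \<in> {1..4} <+> {0..4}" using that by (rule InrI)
    then have "Q.random_variable borel (case_sum Z U (Inr i))"
      using assms(11) unfolding Q.indep_vars_def by blast
    then show ?thesis by simp
  qed
  then have "integrable Q (\<lambda>\<omega>. block_min \<alpha> (L h (\<lambda>i. Z i \<omega>) (\<lambda>i. U i \<omega>)))"
    by (intro Q.integrable_block_min assms(1,9,10)) simp_all
  then have "(\<integral>\<^sup>+\<omega>. ennreal (block_min \<alpha> (L h (\<lambda>i. Z i \<omega>) (\<lambda>i. U i \<omega>))) \<partial>Q) = ennreal b"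
    unfolding b_def by (rule nn_integral_eq_integral) (simp add: nn)
  then have B: "block_integral \<alpha> h = ennreal b"
    using Q.nn_integral_block_min[OF assms(9,10,11)] by simp
  have "\<beta> \<le> 1 / (4 * h) * b"
  proof (rule field_le_epsilon)
    fix e :: real assume e: "e > 0"
    \<comment> \<open>This choice makes the margin term 4 \<epsilon> / h at most e and respects
      \<epsilon> \<le> 1.\<close>
    define \<epsilon> where "\<epsilon> = min 1 (e * h / 4)"
    have \<epsilon>: "0 < \<epsilon>" "\<epsilon> \<le> 1" "4 * \<epsilon> / h \<le> e"
      using e \<open>h > 0\<close> by (auto simp: \<epsilon>_def divide_le_eq)
    have "\<beta> \<le> 1 / (4 * h) * b + 4 * \<epsilon> / h"
      by (rule P.limit_TSPD_le[OF assms(4,5,1,2) \<epsilon>(1,2) B b0 assms(7)])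
    then show "\<beta> \<le> 1 / (4 * h) * b + e" using \<epsilon>(3) by linarith
  qed
  then show ?thesis unfolding b_def .
qed

end
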